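(* Let $\pi=(\pi^n)_{n\ge1}$, $\pi^n=(0=t^n_0<\cdots<t^n_{m(n)}=T)$, be a sequence of partitions of $[0,T]$ with $|\pi^n|=\max_i|t^n_{i+1}-t^n_i|\to0$, and let $\bar\omega\in Q_\pi([0,T],\mathbb{R}^d)\cap C^{1/2-}([0,T],\mathbb{R}^d)$ be a path with strictly increasing quadratic variation along $\pi$ such that $\frac{d[\bar\omega]_\pi}{dt}>0$ (positive definite) $dt$-almost everywhere. Then any path $\omega\in\mathcal{U}(\bar\omega)$ has a unique decomposition $$\omega(t)=\omega(0)+\int_0^t\phi\,d^\pi\bar\omega+s(t),\qquad t\in[0,T],\qquad\text{where }\phi\in\mathbb{V}_a(\bar\omega),\quad [s]_\pi=0 .$$
   Context: Fix $T>0$ and $d\ge 1$. $D([0,T],\mathbb{R}^d)$ is the set of càdlàg paths. For a path $\omega$, $\omega_t:=\omega(t\wedge\cdot)$ is the path stopped at $t$, and $\omega_{t-}$ is the path equal to $\omega$ on $[0,t)$ and to $\omega(t-)$ on $[t,T]$. The space of stopped paths $\Lambda^d_T=\{(t,\omega_t):(t,\omega)\in[0,T]\times D([0,T],\mathbb{R}^d)\}$ carries the metric $d_\infty((t,\omega),(t',\omega'))=\|\omega_t-\omega'_{t'}\|_\infty+|t-t'|$, where $\|\cdot\|_\infty$ is the sup norm on $[0,T]$. A non-anticipative functional is a measurable map $F:(\Lambda^d_T,d_\infty)\to\mathbb{R}$ (so $F(t,\omega)=F(t,\omega_t)$); vector-, matrix- or tensor-valued functionals are treated componentwise. Regularity: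 $F$ is continuous at fixed times if for all $t,\omega,\epsilon>0$ there is $\eta>0$ such that $\|\omega_t-\omega'_t\|_\infty<\eta$ implies $|F(t,\omega)-F(t,\omega')|<\epsilon$. $F$ is left-continuous ($F\in\mathbb{C}^{0,0}_l(\Lambda^d_T)$) if for all $(t,\omega)\in\Lambda_T^d$, $\epsilon>0$ there is $\eta>0$ such that for $(t',\omega')\in\Lambda_T^d$, $t'<t$ and $d_\infty((t,\omega),(t',\omega'))<\eta$ imply $|F(t,\omega)-F(t',\omega')|<\epsilon$. $F$ is boundedness-preserving ($F\in\mathbb{B}(\Lambda^d_T)$) if for every compact $K\subset\mathbb{R}^d$ and $t_0\in[0,T]$ there is $C(K,t_0)>0$ with $|F(t,\omega)|<C(K,t_0)$ whenever $t\le t_0$ and $\omega([0,t])\subset K$. Derivatives: the horizontal derivative is $\mathcal{D}F(t,\omega)=\lim_{h\to0^+}\frac{F(t+h,\omega_t)-F(t,\omega_t)}{h}$ (for $t<T$, so that $t+h\le T$). The vertical derivative $\nabla_\omega F(t,\omega)\in\mathbb{R}^d$ is the gradient at $e=0$ of $e\mapsto F(t,\omega_t+e\mathbf{1}_{[t,T]})$ (this map being required to be differentiable at $0$); $\nabla^j_\omega F$ is the iterated vertical derivative, $\nabla_\omega^0F=F$. $\mathbb{C}^{1,k}_b(\Lambda^d_T)$ is the set of non-anticipative functionals $F$ that are horizontally differentiable with $\mathcal{D}F$ continuous at fixed times, $k$ times vertically differentiable with $\nabla^j_\omega F\in\mathbb{C}^{0,0}_l(\Lambda^d_T)$ for $j=0,\dots,k$,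 and with $\mathcal{D}F,\nabla_\omega F,\dots,\nabla^k_\omega F\in\mathbb{B}(\Lambda^d_T)$. $Lip(\Lambda^d_T,\|\cdot\|_\infty)$ is the set of non-anticipative functionals for which there is $K>0$ with $|F(t,\omega)-F(t,\omega')|\le K\|\omega_t-\omega'_t\|_\infty$ for all $t\in[0,T]$ and all $\omega,\omega'\in D([0,T],\mathbb{R}^d)$. A non-anticipative functional $G$ with values in a finite-dimensional real vector space is horizontally locally Lipschitz if for every $\omega\in D([0,T],\mathbb{R}^d)$ there are $C>0$, $\eta>0$ such that for all $h\ge0$, all $t\le T-h$ and all $\omega'\in D([0,T],\mathbb{R}^d)$, $\|\omega_t-\omega'_t\|_\infty<\eta$ implies $|G(t+h,\omega'_t)-G(t,\omega'_t)|\le Ch$. Quadratic variation: a càdlàg $x:[0,T]\to\mathbb{R}$ is in $Q_\pi([0,T],\mathbb{R})$ if for every $t\in[0,T]$ the limit $[x]_\pi(t)=\lim_{n}\sum_{t^n_{i+1}\le t}(x(t^n_{i+1})-x(t^n_i))^2<\infty$ exists and $[x]_\pi(t)=[x]^c_\pi(t)+\sum_{0<s\le t}|\Delta x(s)|^2$ with $[x]_\pi^c$ continuous and increasing. $x\in Q_\pi([0,T],\mathbb{R}^d)$ if $x^i$ and $x^i+x^j$ are in $Q_\pi([0,T],\mathbb{R})$ for all $i,j$; then $[x]_\pi$ is the $d\times d$ symmetric matrix-valued function $[x]^{ij}_\pi=\frac12([x^i+x^j]_\pi-[x^i]_\pi-[x^j]_\pi)$. $C^\alpha([0,T],\mathbb{R}^d)$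 is the space of $\alpha$-Hölder continuous functions and $C^{1/2-}=\bigcap_{\alpha<1/2}C^\alpha$. Pathwise integral: for continuous $\omega$ let $\omega^n=\sum_{i}\omega(t^n_{i+1})\mathbf{1}_{[t^n_i,t^n_{i+1})}+\omega(T)\mathbf{1}_{\{T\}}$. Then $\int_0^t\nabla_\omega F(s,\omega)\,d^\pi\omega:=\lim_{n}\sum_{i=0}^{m(n)-1}\nabla_\omega F(t^n_i,\omega^n_{t^n_i-})\cdot(\omega(t^n_{i+1}\wedge t)-\omega(t^n_i\wedge t))$. Let $\mathcal{S}$ be the set of $F\in\mathbb{C}^{1,2}_b(\Lambda^d_T)$ such that $\nabla_\omega F,\nabla^2_\omega F\in\mathbb{C}^{1,1}_b(\Lambda^d_T)$, $F,\mathcal{D}F,\nabla^3_\omega F\in Lip(\Lambda^d_T,\|\cdot\|_\infty)$, and $\nabla^3_\omega F$ is horizontally locally Lipschitz. Then $\mathcal{U}(\bar\omega)=\{F(\cdot,\bar\omega):F\in\mathcal{S}\}$ and $\mathbb{V}_a(\bar\omega)=\{\nabla_\omega F(\cdot,\bar\omega):F\in\mathcal{S}\}$. For $\phi=\nabla_\omega F(\cdot,\bar\omega)\in\mathbb{V}_a(\bar\omega)$ with $F\in\mathcal{S}$, $\int_0^t\phi\,d^\pi\bar\omega:=\int_0^t\nabla_\omega F(s,\bar\omega)\,d^\pi\bar\omega$. *)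

theory Defs
  imports "HOL-Analysis.Analysis"
begin

section \<open>Stopped paths\<close>

text \<open>
  A path on \<open>[0,T]\<close> is a function on the reals of which only the restriction to \<open>{0..T}\<close> matters.
  The path components of elements of the space of stopped paths are made \<open>extensional\<close> on
  \<open>{0..T}\<close>, so that equality there is equality on \<open>[0,T]\<close>.
\<close>

definition cadlag :: "real \<Rightarrow> (real \<Rightarrow> 'v::real_normed_vector) \<Rightarrow> bool" where
  "cadlag T \<omega> \<longleftrightarrow>
     (\<forall>t\<in>{0..<T}. continuous (at_right t) \<omega>) \<and>
     (\<forall>t\<in>{0<..T}. \<exists>l. (\<omega> \<longlongrightarrow> l) (at_left t))"

text \<open>The left limit \<open>\<omega>(t-)\<close>, with the usual convention \<open>\<omega>(0-) = \<omega>(0)\<close>.\<close>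

definition left_val :: "(real \<Rightarrow> 'v::real_normed_vector) \<Rightarrow> real \<Rightarrow> 'v" where
  "left_val \<omega> t = (if t = 0 then \<omega> 0 else Lim (at_left t) \<omega>)"

definition stop :: "real \<Rightarrow> real \<Rightarrow> (real \<Rightarrow> 'v::real_normed_vector) \<Rightarrow> real \<Rightarrow> 'v" where
  "stop T t \<omega> = restrict (\<lambda>s. \<omega> (min t s)) {0..T}"

definition stop_left :: "real \<Rightarrow> real \<Rightarrow> (real \<Rightarrow> 'v::real_normed_vector) \<Rightarrow> real \<Rightarrow> 'v" where
  "stop_left T t \<omega> = restrict (\<lambda>s. if s < t then \<omega> s else left_val \<omega> t) {0..T}"

text \<open>The vertical perturbation \<open>\<omega> + e 1\<^bsub>[t,T]\<^esub>\<close>.\<close>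

definition bump :: "real \<Rightarrow> real \<Rightarrow> 'v::real_normed_vector \<Rightarrow> (real \<Rightarrow> 'v) \<Rightarrow> real \<Rightarrow> 'v" where
  "bump T t e \<omega> = restrict (\<lambda>s. \<omega> s + indicator {t..T} s *\<^sub>R e) {0..T}"

definition sup_dist :: "real \<Rightarrow> (real \<Rightarrow> 'v::real_normed_vector) \<Rightarrow> (real \<Rightarrow> 'v) \<Rightarrow> real" where
  "sup_dist T \<omega> \<omega>' = (SUP s\<in>{0..T}. norm (\<omega> s - \<omega>' s))"

definition Lam :: "real \<Rightarrow> (real \<times> (real \<Rightarrow> 'v::real_normed_vector)) set" where
  "Lam T = {(t, stop T t \<omega>) | t \<omega>. t \<in> {0..T} \<and> cadlag T \<omega>}"

definition d_inf ::
  "real \<Rightarrow> real \<times> (real \<Rightarrow> 'v::real_normed_vector) \<Rightarrow> real \<times> (real \<Rightarrow> 'v) \<Rightarrow> real" where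
  "d_inf T p p' = sup_dist T (snd p) (snd p') + \<bar>fst p - fst p'\<bar>"

text \<open>The suprema in \<open>sup_dist\<close> are over bounded sets, because cadlag paths are bounded.\<close>

lemma cadlag_bounded:
  assumes "cadlag T \<omega>"
  shows "bounded (\<omega> ` {0..T})"
proof -
  have loc: "\<exists>U. open U \<and> t \<in> U \<and> bounded (\<omega> ` (U \<inter> {0..T}))" if t: "t \<in> {0..T}" for t
  proof -
    have lim: "\<exists>d>0. \<exists>B. \<forall>x\<in>S. dist x t < d \<and> x \<noteq> t \<longrightarrow> norm (\<omega> x) \<le> B"
      if "(\<omega> \<longlongrightarrow> l) (at t within S)" for l S
    proof -
      from tendstoD[OF that, of 1]
      have "\<forall>\<^sub>F x in at t within S. dist (\<omega> x) l < 1" by simp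
      then obtain d where d: "d > 0" "\<forall>x\<in>S. x \<noteq> t \<and> dist x t < d \<longrightarrow> dist (\<omega> x) l < 1"
        by (auto simp: eventually_at)
      have "norm (\<omega> x) \<le> norm l + 1" if "dist (\<omega> x) l < 1" for x
        using that norm_triangle_sub[of "\<omega> x" l] by (simp add: dist_norm)
      with d show ?thesis by blast
    qed
    have "\<exists>d>0. \<exists>B. \<forall>x\<in>{t<..} \<inter> {0..T}. dist x t < d \<and> x \<noteq> t \<longrightarrow> norm (\<omega> x) \<le> B"
    proof (cases "t < T")
      case True
      then have "(\<omega> \<longlongrightarrow> \<omega> t) (at_right t)"
        using assms t by (auto simp: cadlag_def continuous_within)
      from lim[OF this] show ?thesis by blast
    next
      case False
      then show ?thesis by (intro exI[of _ 1]) auto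
    qed
    then obtain d1 B1 where 1: "d1 > 0"
      "\<forall>x\<in>{t<..} \<inter> {0..T}. dist x t < d1 \<and> x \<noteq> t \<longrightarrow> norm (\<omega> x) \<le> B1"
      by blast
    have "\<exists>d>0. \<exists>B. \<forall>x\<in>{..<t} \<inter> {0..T}. dist x t < d \<and> x \<noteq> t \<longrightarrow> norm (\<omega> x) \<le> B"
    proof (cases "t > 0")
      case True
      then obtain l where "(\<omega> \<longlongrightarrow> l) (at_left t)"
        using assms t unfolding cadlag_def by (metis atLeastAtMost_iff greaterThanAtMost_iff)
      from lim[OF this] show ?thesis by blast
    next
      case False
      then show ?thesis by (intro exI[of _ 1]) auto
    qed
    then obtain d2 B2 where 2: "d2 > 0"
      "\<forall>x\<in>{..<t} \<inter> {0..T}. dist x t < d2 \<and> x \<noteq> t \<longrightarrow> norm (\<omega> x) \<le> B2"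
      by blast
    have "norm (\<omega> x) \<le> max (norm (\<omega> t)) (max B1 B2)"
      if "x \<in> ball t (min d1 d2) \<inter> {0..T}" for x
      using that 1(2)[rule_format, of x] 2(2)[rule_format, of x]
      by (cases x t rule: linorder_cases) (auto simp: dist_commute)
    then have "bounded (\<omega> ` (ball t (min d1 d2) \<inter> {0..T}))"
      unfolding bounded_iff by blast
    moreover have "t \<in> ball t (min d1 d2)" using 1 2 by simp
    ultimately show ?thesis by blast
  qed
  then obtain U where U: "\<And>t. t \<in> {0..T} \<Longrightarrow> open (U t) \<and> t \<in> U t \<and> bounded (\<omega> ` (U t \<inter> {0..T}))"
    by metis
  then obtain C where C: "C \<subseteq> {0..T}" "finite C" "{0..T} \<subseteq> (\<Union>c\<in>C. U c)"
    using compactE_image[of "{0..T}" "{0..T}" U] by (metis UN_I compact_Icc subsetI)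
  have "bounded (\<Union>c\<in>C. \<omega> ` (U c \<inter> {0..T}))"
    using C U by (intro bounded_UN) auto
  then show ?thesis
    by (rule bounded_subset) (use C in blast)
qed

section \<open>Non-anticipative functionals\<close>

text \<open>
  A functional is a function on pairs (time, path); only its values on \<open>Lam T\<close> are meaningful.
\<close>

type_synonym ('d, 'v) functional = "real \<times> (real \<Rightarrow> real^'d) \<Rightarrow> 'v"

text \<open>
  The Borel sigma-algebra of the metric space \<open>(Lam T, d_inf T)\<close>. The locale \<open>Metric_space\<close> asks for
  nonnegativity of the distance on the whole type, where the supremum in \<open>sup_dist\<close> may be over an
  unbounded set; hence the open sets are spelled out.
\<close>

definition Lam_open :: "real \<Rightarrow> (real \<times> (real \<Rightarrow> 'v::real_normed_vector)) set \<Rightarrow> bool" where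
  "Lam_open T V \<longleftrightarrow> V \<subseteq> Lam T \<and>
     (\<forall>p\<in>V. \<exists>r>0. \<forall>q\<in>Lam T. d_inf T p q < r \<longrightarrow> q \<in> V)"

definition Lam_borel :: "real \<Rightarrow> (real \<times> (real \<Rightarrow> real^'d::finite)) measure" where
  "Lam_borel T = sigma (Lam T) {V. Lam_open T V}"

definition nonanticipative :: "real \<Rightarrow> ('d::finite, 'v::euclidean_space) functional set" where
  "nonanticipative T = Lam_borel T \<rightarrow>\<^sub>M borel"

definition cont_fixed :: "real \<Rightarrow> ('d::finite, 'v::euclidean_space) functional set" where
  "cont_fixed T = {F \<in> nonanticipative T. \<forall>t \<omega>. (t, \<omega>) \<in> Lam T \<longrightarrow>
     (\<forall>\<epsilon>>0. \<exists>\<eta>>0. \<forall>\<omega>'. (t, \<omega>') \<in> Lam T \<and> sup_dist T \<omega> \<omega>' < \<eta> \<longrightarrow>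
        norm (F (t, \<omega>) - F (t, \<omega>')) < \<epsilon>)}"

definition C00l :: "real \<Rightarrow> ('d::finite, 'v::euclidean_space) functional set" where
  "C00l T = {F \<in> nonanticipative T. \<forall>t \<omega>. (t, \<omega>) \<in> Lam T \<longrightarrow>
     (\<forall>\<epsilon>>0. \<exists>\<eta>>0. \<forall>t' \<omega>'. (t', \<omega>') \<in> Lam T \<and> t' < t \<and> d_inf T (t, \<omega>) (t', \<omega>') < \<eta> \<longrightarrow>
        norm (F (t, \<omega>) - F (t', \<omega>')) < \<epsilon>)}"

definition bdd_pres :: "real \<Rightarrow> ('d::finite, 'v::euclidean_space) functional set" where
  "bdd_pres T = {F \<in> nonanticipative T. \<forall>K t\<^sub>0. compact K \<and> t\<^sub>0 \<in> {0..T} \<longrightarrow>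
     (\<exists>C>0. \<forall>t \<omega>. (t, \<omega>) \<in> Lam T \<and> t \<le> t\<^sub>0 \<and> \<omega> ` {0..t} \<subseteq> K \<longrightarrow> norm (F (t, \<omega>)) < C)}"

definition Lip :: "real \<Rightarrow> ('d::finite, 'v::euclidean_space) functional set" where
  "Lip T = {F \<in> nonanticipative T. \<exists>K>0. \<forall>t \<omega> \<omega>'. (t, \<omega>) \<in> Lam T \<and> (t, \<omega>') \<in> Lam T \<longrightarrow>
     norm (F (t, \<omega>) - F (t, \<omega>')) \<le> K * sup_dist T \<omega> \<omega>'}"

definition hor_loc_Lip :: "real \<Rightarrow> ('d::finite, 'v::euclidean_space) functional set" where
  "hor_loc_Lip T = {G \<in> nonanticipative T. \<forall>\<omega>. cadlag T \<omega> \<longrightarrow>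
     (\<exists>C>0. \<exists>\<eta>>0. \<forall>h\<ge>0. \<forall>t\<in>{0..T - h}. \<forall>\<omega>'. cadlag T \<omega>' \<and>
        sup_dist T (stop T t \<omega>) (stop T t \<omega>') < \<eta> \<longrightarrow>
        norm (G (t + h, stop T t \<omega>') - G (t, stop T t \<omega>')) \<le> C * h)}"

section \<open>Horizontal and vertical derivatives\<close>

definition hor_differentiable :: "real \<Rightarrow> ('d::finite, 'v::euclidean_space) functional \<Rightarrow> bool" where
  "hor_differentiable T F \<longleftrightarrow> (\<forall>t \<omega>. (t, \<omega>) \<in> Lam T \<and> t < T \<longrightarrow>
     (\<exists>l. ((\<lambda>h. (F (t + h, \<omega>) - F (t, \<omega>)) /\<^sub>R h) \<longlongrightarrow> l) (at_right 0)))"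

text \<open>
  The horizontal derivative exists only for \<open>t < T\<close>. It is extended by \<open>0\<close> to \<open>t = T\<close>; as
  \<open>cont_fixed\<close>, \<open>bdd_pres\<close> and \<open>Lip\<close> never compare values at two different times, membership of
  the extension in these sets amounts to the respective condition at times \<open>t < T\<close>.
\<close>

definition hderiv ::
  "real \<Rightarrow> ('d::finite, 'v::euclidean_space) functional \<Rightarrow> ('d, 'v) functional" where
  "hderiv T F = (\<lambda>(t, \<omega>).
     if t < T then Lim (at_right 0) (\<lambda>h. (F (t + h, \<omega>) - F (t, \<omega>)) /\<^sub>R h) else 0)"

definition vert_differentiable :: "real \<Rightarrow> ('d::finite, 'v::euclidean_space) functional \<Rightarrow> bool" where
  "vert_differentiable T F \<longleftrightarrow>
     (\<forall>t \<omega>. (t, \<omega>) \<in> Lam T \<longrightarrow> (\<lambda>e. F (t, bump T t e \<omega>)) differentiable (at 0))"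

text \<open>
  The gradient of a \<open>'v\<close>-valued functional has values in \<open>'v^'d\<close>, its \<open>i\<close>-th component being the
  partial derivative in direction \<open>i\<close>; so iterating gives \<open>real^'d\<close>, \<open>real^'d^'d\<close>, \<dots> for real \<open>F\<close>.
\<close>

definition vderiv ::
  "real \<Rightarrow> ('d::finite, 'v::euclidean_space) functional \<Rightarrow> ('d, 'v^'d) functional" where
  "vderiv T F = (\<lambda>(t, \<omega>).
     \<chi> i. frechet_derivative (\<lambda>e. F (t, bump T t e \<omega>)) (at 0) (axis i 1))"

definition C11b :: "real \<Rightarrow> ('d::finite, 'v::euclidean_space) functional set" where
  "C11b T = {F \<in> nonanticipative T.
     hor_differentiable T F \<and> hderiv T F \<in> cont_fixed T \<and>
     vert_differentiable T F \<and>
     F \<in> C00l T \<and> vderiv T F \<in> C00l T \<and>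
     hderiv T F \<in> bdd_pres T \<and> vderiv T F \<in> bdd_pres T}"

definition C12b :: "real \<Rightarrow> ('d::finite, 'v::euclidean_space) functional set" where
  "C12b T = {F \<in> nonanticipative T.
     hor_differentiable T F \<and> hderiv T F \<in> cont_fixed T \<and>
     vert_differentiable T F \<and> vert_differentiable T (vderiv T F) \<and>
     F \<in> C00l T \<and> vderiv T F \<in> C00l T \<and> vderiv T (vderiv T F) \<in> C00l T \<and>
     hderiv T F \<in> bdd_pres T \<and> vderiv T F \<in> bdd_pres T \<and> vderiv T (vderiv T F) \<in> bdd_pres T}"

definition S_class :: "real \<Rightarrow> ('d::finite, real) functional set" where
  "S_class T = {F \<in> C12b T.
     vderiv T F \<in> C11b T \<and> vderiv T (vderiv T F) \<in> C11b T \<and>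
     F \<in> Lip T \<and> hderiv T F \<in> Lip T \<and> vderiv T (vderiv T (vderiv T F)) \<in> Lip T \<and>
     vderiv T (vderiv T (vderiv T F)) \<in> hor_loc_Lip T}"

section \<open>Partitions, quadratic variation and Hoelder continuity\<close>

definition is_partition :: "real \<Rightarrow> real list \<Rightarrow> bool" where
  "is_partition T p \<longleftrightarrow> length p \<ge> 2 \<and> sorted_wrt (<) p \<and> hd p = 0 \<and> last p = T"

definition mesh :: "real list \<Rightarrow> real" where
  "mesh p = Max {p ! Suc i - p ! i | i. i < length p - 1}"

definition qv_sum :: "real list \<Rightarrow> (real \<Rightarrow> real) \<Rightarrow> real \<Rightarrow> real" where
  "qv_sum p x t = (\<Sum>i | i < length p - 1 \<and> p ! Suc i \<le> t. (x (p ! Suc i) - x (p ! i))\<^sup>2)"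

definition qv :: "(nat \<Rightarrow> real list) \<Rightarrow> (real \<Rightarrow> real) \<Rightarrow> real \<Rightarrow> real" where
  "qv \<pi> x t = lim (\<lambda>n. qv_sum (\<pi> n) x t)"

definition jump_sq :: "(real \<Rightarrow> real) \<Rightarrow> real \<Rightarrow> real" where
  "jump_sq x s = (x s - left_val x s)\<^sup>2"

definition Q_real :: "real \<Rightarrow> (nat \<Rightarrow> real list) \<Rightarrow> (real \<Rightarrow> real) set" where
  "Q_real T \<pi> = {x. cadlag T x \<and>
     (\<forall>t\<in>{0..T}. convergent (\<lambda>n. qv_sum (\<pi> n) x t)) \<and>
     jump_sq x summable_on {0<..T} \<and>
     (\<exists>c. continuous_on {0..T} c \<and> mono_on {0..T} c \<and>
        (\<forall>t\<in>{0..T}. qv \<pi> x t = c t + infsum (jump_sq x) {0<..t}))}"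

definition Q_vec :: "real \<Rightarrow> (nat \<Rightarrow> real list) \<Rightarrow> (real \<Rightarrow> real^'d) set" where
  "Q_vec T \<pi> = {x. (\<forall>i. (\<lambda>t. x t $ i) \<in> Q_real T \<pi>) \<and> (\<forall>i j. (\<lambda>t. x t $ i + x t $ j) \<in> Q_real T \<pi>)}"

definition qv_mat :: "(nat \<Rightarrow> real list) \<Rightarrow> (real \<Rightarrow> real^'d) \<Rightarrow> real \<Rightarrow> real^'d^'d" where
  "qv_mat \<pi> x t = (\<chi> i j.
     (qv \<pi> (\<lambda>s. x s $ i + x s $ j) t - qv \<pi> (\<lambda>s. x s $ i) t - qv \<pi> (\<lambda>s. x s $ j) t) / 2)"

definition pos_def :: "real^'d^'d \<Rightarrow> bool" where
  "pos_def A \<longleftrightarrow> transpose A = A \<and> (\<forall>v. v \<noteq> 0 \<longrightarrow> v \<bullet> (A *v v) > 0)"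

text \<open>Strict increase is meant with respect to the positive definite (Loewner) order.\<close>

definition strictly_increasing_qv :: "real \<Rightarrow> (nat \<Rightarrow> real list) \<Rightarrow> (real \<Rightarrow> real^'d) \<Rightarrow> bool" where
  "strictly_increasing_qv T \<pi> x \<longleftrightarrow>
     (\<forall>s\<in>{0..T}. \<forall>t\<in>{0..T}. s < t \<longrightarrow> pos_def (qv_mat \<pi> x t - qv_mat \<pi> x s))"

definition Holder :: "real \<Rightarrow> real \<Rightarrow> (real \<Rightarrow> 'v::real_normed_vector) set" where
  "Holder T \<alpha> = {x. \<exists>C. \<forall>s\<in>{0..T}. \<forall>t\<in>{0..T}. norm (x t - x s) \<le> C * \<bar>t - s\<bar> powr \<alpha>}"

definition Holder_half_minus :: "real \<Rightarrow> (real \<Rightarrow> 'v::real_normed_vector) set" where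
  "Holder_half_minus T = (\<Inter>\<alpha>\<in>{0<..<1/2}. Holder T \<alpha>)"

section \<open>The pathwise integral\<close>

definition approx_path :: "real \<Rightarrow> real list \<Rightarrow> (real \<Rightarrow> real^'d) \<Rightarrow> real \<Rightarrow> real^'d" where
  "approx_path T p \<omega> s =
     (\<Sum>i<length p - 1. indicator {p ! i..<p ! Suc i} s *\<^sub>R \<omega> (p ! Suc i)) + indicator {T} s *\<^sub>R \<omega> T"

text \<open>
  For \<open>p ! 0 = 0\<close> the convention \<open>\<omega>(0-) = \<omega>(0)\<close> is applied to \<open>approx_path T p \<omega>\<close>; this affects only
  the first summand, which vanishes in the limit for continuous \<open>\<omega>\<close> and bounded integrand.
\<close>

definition integral_sum ::
  "real \<Rightarrow> real list \<Rightarrow> ('d::finite, real) functional \<Rightarrow> (real \<Rightarrow> real^'d) \<Rightarrow> real \<Rightarrow> real" where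
  "integral_sum T p F \<omega> t =
     (\<Sum>i<length p - 1. vderiv T F (p ! i, stop_left T (p ! i) (approx_path T p \<omega>)) \<bullet>
        (\<omega> (min (p ! Suc i) t) - \<omega> (min (p ! i) t)))"

definition along :: "real \<Rightarrow> ('d::finite, 'v) functional \<Rightarrow> (real \<Rightarrow> real^'d) \<Rightarrow> real \<Rightarrow> 'v" where
  "along T F \<omega> = restrict (\<lambda>t. F (t, stop T t \<omega>)) {0..T}"

definition U_paths :: "real \<Rightarrow> (real \<Rightarrow> real^'d::finite) \<Rightarrow> (real \<Rightarrow> real) set" where
  "U_paths T \<omega> = {along T F \<omega> | F. F \<in> S_class T}"

definition V_a :: "real \<Rightarrow> (real \<Rightarrow> real^'d::finite) \<Rightarrow> (real \<Rightarrow> real^'d) set" where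
  "V_a T \<omega> = {along T (vderiv T F) \<omega> | F. F \<in> S_class T}"

text \<open>
  \<open>I\<close> is an integral process of \<open>\<phi>\<close>: the defining limits exist on \<open>[0,T]\<close>, with value \<open>I\<close>, for some
  \<open>F\<close> representing \<open>\<phi>\<close>. Independence of the choice of \<open>F\<close> is not built into the definition.
\<close>

definition has_path_integral ::
  "real \<Rightarrow> (nat \<Rightarrow> real list) \<Rightarrow> (real \<Rightarrow> real^'d::finite) \<Rightarrow> (real \<Rightarrow> real^'d) \<Rightarrow> (real \<Rightarrow> real) \<Rightarrow> bool"
  where
  "has_path_integral T \<pi> \<omega> \<phi> I \<longleftrightarrow>
     (\<exists>F\<in>S_class T. \<phi> = along T (vderiv T F) \<omega> \<and>
        (\<forall>t\<in>{0..T}. (\<lambda>n. integral_sum T (\<pi> n) F \<omega> t) \<longlonglongrightarrow> I t))"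

end

theory Submission
  imports Defs
begin

text \<open>
  Write \<open>\<phi>\<close>, \<open>\<psi>\<close> for the first and second vertical derivatives of \<open>F\<close> in the class \<open>S_class\<close>, and
  \<open>d\<omega>\<close> for the increment of the path over an interval of length \<open>h\<close>. Everything rests on expansions
  of functionals along the path with explicit orders in \<open>h\<close>; no change of variable formula is used.

  Since \<open>F\<close> and its third vertical derivative are Lipschitz in sup norm, so are \<open>\<phi>\<close> and \<open>\<psi>\<close>, by
  interpolation along lines (\<open>path_Lip_vderiv_from_third\<close>). Bounded horizontal derivatives make all
  three Lipschitz in time for a frozen path. This gives the expansion
  \<open>G(v) - G(u) - \<nabla>G(u) \<bullet> d\<omega> = O(h powr (5/4 * \<alpha>))\<close> for \<open>G = F\<close> and \<open>G = \<phi>\<close>, for the path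
  itself and, uniformly in the partition, for the step paths in the definition of the integral
  (\<open>first_order_expansion\<close>). Here \<open>\<alpha> < 1/2\<close> is a Hoelder exponent close to \<open>1/2\<close>, so that
  \<open>5/4 * \<alpha> > 1/2\<close> and \<open>9/4 * \<alpha> > 1\<close>.

  The expansion of \<open>\<phi>\<close> says that the compensated increments \<open>\<phi> \<bullet> d\<omega> + 1/2 * \<psi> d\<omega> \<bullet> d\<omega>\<close> are
  additive up to \<open>O(h powr (9/4 * \<alpha>))\<close>. By the sewing lemma (\<open>discrete_sewing\<close>, \<open>Xi_sewing\<close>) their
  sum over a fine grid differs from that over a coarse grid by a positive power of the coarse mesh,
  however fine the fine grid is. As the step paths converge to the path, the compensated sums
  converge; so do the compensators, hence the integral sums, and their limit \<open>I\<close> is also that of the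
  Riemann sums of \<open>\<phi>\<close> along the path itself (\<open>pathwise_integral\<close>). In particular \<open>I\<close> depends on
  the values of \<open>\<phi>\<close> along the path only, and \<open>I(v) - I(u) = \<phi>(u) \<bullet> d\<omega>\<close> up to a remainder of order
  \<open>h powr (5/4 * \<alpha>)\<close> plus the increment of the quadratic variation.

  Existence: the increments of \<open>s = F - F(0) - I\<close> are differences of two such remainders. The sum of
  the squares of the remainders over a partition vanishes in the limit, because \<open>5/2 * \<alpha> > 1\<close> and the
  quadratic variation is continuous; so \<open>[s] = 0\<close>.

  Uniqueness: for two decompositions with integrands \<open>\<phi>\<close>, \<open>\<phi>'\<close> the sums of \<open>((\<phi> - \<phi>') \<bullet> d\<omega>)\<^sup>2\<close>
  vanish in the limit. At a time at which the quadratic variation has a positive definite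
  derivative this forces \<open>\<phi> = \<phi>'\<close>; such times are dense and both sides are continuous. Equal
  integrands have equal integrals, hence equal remainders.
\<close>

section \<open>Stopped paths and vertical perturbations\<close>

lemma sup_dist_le:
  assumes "0 \<le> T" and "\<And>s. s \<in> {0..T} \<Longrightarrow> norm (x s - y s) \<le> B"
  shows "sup_dist T x y \<le> B"
  unfolding sup_dist_def using assms by (intro cSUP_least) auto

lemma sup_dist_cong:
  assumes "\<And>s. s \<in> {0..T} \<Longrightarrow> norm (x s - y s) = norm (x' s - y' s)"
  shows "sup_dist T x y = sup_dist T x' y'"
  unfolding sup_dist_def using assms by (intro SUP_cong) auto

lemma sup_dist_self: "0 \<le> T \<Longrightarrow> sup_dist T x x = 0"
  by (simp add: sup_dist_def)

lemma cadlag_cong: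
  assumes "cadlag T x" and eq: "\<And>s. s \<in> {0..T} \<Longrightarrow> y s = x s"
  shows "cadlag T y"
  unfolding cadlag_def
proof safe
  fix t assume t: "t \<in> {0..<T}"
  then have "\<forall>\<^sub>F s in at_right t. y s = x s"
    using eventually_at_right_real[of t T] by (auto elim!: eventually_mono intro: eq)
  moreover have "(x \<longlongrightarrow> x t) (at_right t)"
    using assms(1) t by (auto simp: cadlag_def continuous_within)
  ultimately show "continuous (at_right t) y"
    unfolding continuous_within using t eq[of t] by (simp add: tendsto_cong)
next
  fix t assume t: "t \<in> {0<..T}"
  then have "\<forall>\<^sub>F s in at_left t. y s = x s"
    using eventually_at_left_real[of 0 t] by (auto elim!: eventually_mono intro: eq)
  then show "\<exists>l. (y \<longlongrightarrow> l) (at_left t)"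
    using assms(1) t by (auto simp: cadlag_def tendsto_cong)
qed

lemma cadlag_const: "cadlag T (\<lambda>_. c)"
  by (auto simp: cadlag_def)

lemma cadlag_add:
  assumes "cadlag T x" "cadlag T y"
  shows "cadlag T (\<lambda>s. x s + y s)"
  using assms unfolding cadlag_def by (blast intro: continuous_add tendsto_add)

lemma tendsto_at_left_eventually_const:
  fixes f :: "real \<Rightarrow> 'b::topological_space"
  assumes "a < t" "\<And>s. a < s \<Longrightarrow> s < t \<Longrightarrow> f s = c"
  shows "(f \<longlongrightarrow> c) (at_left t)"
proof -
  have "\<forall>\<^sub>F s in at_left t. f s = c"
    using eventually_at_left_real[OF assms(1)] by (auto elim!: eventually_mono intro: assms(2))
  then show ?thesis by (rule tendsto_eventually)
qed

lemma tendsto_at_right_eventually_const: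
  fixes f :: "real \<Rightarrow> 'b::topological_space"
  assumes "t < b" "\<And>s. t < s \<Longrightarrow> s < b \<Longrightarrow> f s = c"
  shows "(f \<longlongrightarrow> c) (at_right t)"
proof -
  have "\<forall>\<^sub>F s in at_right t. f s = c"
    using eventually_at_right_real[OF assms(1)] by (auto elim!: eventually_mono intro: assms(2))
  then show ?thesis by (rule tendsto_eventually)
qed

lemma cadlag_jump: "cadlag T (\<lambda>s. indicator {t..T} s *\<^sub>R e)"
  unfolding cadlag_def
proof safe
  fix r assume r: "r \<in> {0..<T}"
  show "continuous (at_right r) (\<lambda>s. indicator {t..T} s *\<^sub>R e)"
    unfolding continuous_within
    by (rule tendsto_at_right_eventually_const[of r "if r < t then min t T else T"])
      (use r in \<open>auto simp: indicator_def split: if_splits\<close>)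
next
  fix r assume r: "r \<in> {0<..T}"
  have "((\<lambda>s. indicator {t..T} s *\<^sub>R e) \<longlongrightarrow> (if r \<le> t then 0 else e)) (at_left r)"
    by (rule tendsto_at_left_eventually_const[of "if r \<le> t then 0 else t"])
      (use r in \<open>auto simp: indicator_def\<close>)
  then show "\<exists>l. ((\<lambda>s. indicator {t..T} s *\<^sub>R e) \<longlongrightarrow> l) (at_left r)" by blast
qed

lemma cadlag_bump: "cadlag T x \<Longrightarrow> cadlag T (bump T t e x)"
  by (rule cadlag_cong[OF cadlag_add[OF _ cadlag_jump]]) (auto simp: bump_def)

lemma cadlag_stop:
  assumes "cadlag T x" "t \<in> {0..T}"
  shows "cadlag T (stop T t x)"
proof -
  have "cadlag T (\<lambda>s. x (min t s))"
    unfolding cadlag_def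
  proof safe
    fix r assume r: "r \<in> {0..<T}"
    show "continuous (at_right r) (\<lambda>s. x (min t s))"
    proof (cases "r < t")
      case True
      have "\<forall>\<^sub>F s in at_right r. x (min t s) = x s"
        using eventually_at_right_real[OF True] by (auto elim!: eventually_mono)
      moreover have "(x \<longlongrightarrow> x r) (at_right r)"
        using assms(1) r by (auto simp: cadlag_def continuous_within)
      ultimately show ?thesis
        unfolding continuous_within using True by (simp add: tendsto_cong)
    next
      case False
      show ?thesis unfolding continuous_within
        by (rule tendsto_at_right_eventually_const[of r T]) (use False r in auto)
    qed
  next
    fix r assume r: "r \<in> {0<..T}"
    show "\<exists>l. ((\<lambda>s. x (min t s)) \<longlongrightarrow> l) (at_left r)"
    proof (cases "r \<le> t")
      case True
      have "\<forall>\<^sub>F s in at_left r. x (min t s) = x s"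
        using eventually_at_left_real[of 0 r] True r by (auto elim!: eventually_mono)
      then show ?thesis using assms(1) r by (auto simp: cadlag_def tendsto_cong)
    next
      case False
      then have "((\<lambda>s. x (min t s)) \<longlongrightarrow> x t) (at_left r)"
        by (intro tendsto_at_left_eventually_const[of t]) auto
      then show ?thesis by blast
    qed
  qed
  then show ?thesis by (rule cadlag_cong) (simp add: stop_def)
qed

lemma cadlag_continuous:
  assumes "continuous_on {0..T} x"
  shows "cadlag T x"
  unfolding cadlag_def continuous_within
proof safe
  fix t assume "t \<in> {0..<T}"
  then show "(x \<longlongrightarrow> x t) (at_right t)"
    using continuous_on_Icc_at_rightD[of t T x] continuous_on_subset[OF assms, of "{t..T}"] by auto
next
  fix t assume "t \<in> {0<..T}"
  then show "\<exists>l. (x \<longlongrightarrow> l) (at_left t)"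
    using continuous_on_Icc_at_leftD[of 0 t x] continuous_on_subset[OF assms, of "{0..t}"] by auto
qed

text \<open>
  An intrinsic description of stopped paths, convenient because a path constant after \<open>t\<close> may be
  regarded as stopped at any later time as well.
\<close>

lemma Lam_iff:
  assumes "0 \<le> T"
  shows "(t, x) \<in> Lam T \<longleftrightarrow>
    t \<in> {0..T} \<and> x \<in> extensional {0..T} \<and> (\<forall>s\<in>{t..T}. x s = x t) \<and> cadlag T x"
proof
  assume "(t, x) \<in> Lam T"
  then obtain w where w: "t \<in> {0..T}" "cadlag T w" "x = stop T t w"
    by (auto simp: Lam_def)
  then show "t \<in> {0..T} \<and> x \<in> extensional {0..T} \<and> (\<forall>s\<in>{t..T}. x s = x t) \<and> cadlag T x"
    using cadlag_stop[OF w(2,1)] by (auto simp: stop_def)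
next
  assume *: "t \<in> {0..T} \<and> x \<in> extensional {0..T} \<and> (\<forall>s\<in>{t..T}. x s = x t) \<and> cadlag T x"
  have "x s = stop T t x s" for s
  proof (cases "s \<in> {0..T}")
    case True
    have "t \<le> s \<Longrightarrow> x s = x t" using * True by (meson atLeastAtMost_iff)
    with True show ?thesis by (auto simp: stop_def min_def)
  next
    case False
    with * show ?thesis unfolding stop_def restrict_def extensional_def by auto
  qed
  then have "x = stop T t x" by blast
  then show "(t, x) \<in> Lam T" unfolding Lam_def using * by blast
qed

lemma Lam_later:
  assumes "(t, x) \<in> Lam T" "0 \<le> T" "t \<le> u" "u \<le> T"
  shows "(u, x) \<in> Lam T"
  using assms unfolding Lam_iff[OF assms(2)]
  by (metis (no_types, lifting) atLeastAtMost_iff order.trans)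

lemma Lam_bump:
  assumes "(t, x) \<in> Lam T" "0 \<le> T"
  shows "(t, bump T t e x) \<in> Lam T"
proof -
  note iff = Lam_iff[OF assms(2), of t]
  have *: "t \<in> {0..T}" "x \<in> extensional {0..T}" "\<And>s. s \<in> {t..T} \<Longrightarrow> x s = x t" "cadlag T x"
    using assms(1) unfolding iff by blast+
  have "bump T t e x s = bump T t e x t" if "s \<in> {t..T}" for s
    using *(1) *(3)[OF that] that by (simp add: bump_def)
  moreover have "bump T t e x \<in> extensional {0..T}" by (simp add: bump_def)
  ultimately show ?thesis
    unfolding Lam_iff[OF assms(2)] using *(1) cadlag_bump[OF *(4)] by blast
qed

lemma Lam_stop: "\<lbrakk>cadlag T w; t \<in> {0..T}\<rbrakk> \<Longrightarrow> (t, stop T t w) \<in> Lam T"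
  by (auto simp: Lam_def)

lemma bump_bump: "bump T t e (bump T t e' x) = bump T t (e + e') x"
  by (auto simp: bump_def restrict_def algebra_simps)

lemma bump_zero:
  assumes "(t, x) \<in> Lam T" "0 \<le> T"
  shows "bump T t 0 x = x"
proof -
  have "x \<in> extensional {0..T}" using assms(1) unfolding Lam_iff[OF assms(2)] by blast
  then show ?thesis by (auto simp: bump_def fun_eq_iff extensional_def)
qed

lemma sup_dist_bump_same: "sup_dist T (bump T t e x) (bump T t e y) = sup_dist T x y"
  by (rule sup_dist_cong) (simp add: bump_def)

lemma sup_dist_bump:
  assumes "0 \<le> T"
  shows "sup_dist T (bump T t e x) (bump T t e' x) \<le> norm (e - e')"
  by (rule sup_dist_le[OF assms])
    (auto simp: bump_def indicator_def scaleR_diff_right[symmetric])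

section \<open>Vertical derivatives\<close>

text \<open>
  The derivative in direction \<open>e\<close> of a functional with vertical gradient \<open>w\<close>. The index of the
  direction is the outer one, so for second derivatives this is multiplication by the transpose.
\<close>

definition vlin :: "'v::real_vector^'d::finite \<Rightarrow> real^'d \<Rightarrow> 'v" where
  "vlin w e = (\<Sum>k\<in>UNIV. (e $ k) *\<^sub>R (w $ k))"

lemma norm_vlin_le:
  fixes w :: "'v::real_normed_vector^'d::finite"
  shows "norm (vlin w e) \<le> norm w * norm e"
proof -
  have "norm (vlin w e) \<le> (\<Sum>k\<in>UNIV. \<bar>e $ k\<bar> * norm (w $ k))"
    unfolding vlin_def by (intro order.trans[OF norm_sum]) simp
  also have "\<dots> \<le> L2_set (\<lambda>k. e $ k) UNIV * L2_set (\<lambda>k. norm (w $ k)) UNIV"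
    using L2_set_mult_ineq[of "\<lambda>k. e $ k" "\<lambda>k. norm (w $ k)" UNIV] by simp
  also have "L2_set (\<lambda>k. e $ k) UNIV = norm e"
    by (simp add: norm_vec_def L2_set_def)
  also have "L2_set (\<lambda>k. norm (w $ k)) UNIV = norm w"
    by (simp add: norm_vec_def)
  finally show ?thesis by (simp add: mult.commute)
qed

lemma vlin_diff_left: "vlin (w - w') e = vlin w e - vlin w' e"
  by (simp add: vlin_def sum_subtractf algebra_simps)

lemma vlin_linear: "linear (vlin w)"
  by (rule linearI) (simp_all add: vlin_def sum.distrib scaleR_sum_right algebra_simps)

lemma vlin_add_right: "vlin w (e + e') = vlin w e + vlin w e'"
  using vlin_linear by (rule linear_add)

lemma vlin_scaleR_right: "vlin w (c *\<^sub>R e) = c *\<^sub>R vlin w e"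
  using vlin_linear by (rule linear_cmul)

lemma vlin_inner: "vlin (w :: real^'d::finite) e = w \<bullet> e"
  by (simp add: vlin_def inner_vec_def mult.commute)

lemma vlin_axis: "vlin w (axis i 1) = w $ i"
  by (simp add: vlin_def axis_def if_distrib[of "\<lambda>c. c *\<^sub>R _"] cong: if_cong)

lemma vertical_has_derivative_zero:
  fixes G :: "('d::finite, 'v::euclidean_space) functional"
  assumes "vert_differentiable T G" "(t, x) \<in> Lam T"
  shows "((\<lambda>e. G (t, bump T t e x)) has_derivative vlin (vderiv T G (t, x))) (at 0)"
proof -
  let ?f = "\<lambda>e. G (t, bump T t e x)"
  have "?f differentiable (at 0)" using assms by (auto simp: vert_differentiable_def)
  then have D: "(?f has_derivative frechet_derivative ?f (at 0)) (at 0)"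
    by (simp only: frechet_derivative_works)
  have "frechet_derivative ?f (at 0) e = vlin (vderiv T G (t, x)) e" for e
  proof -
    have lin: "linear (frechet_derivative ?f (at 0))" using D by (rule has_derivative_linear)
    have "frechet_derivative ?f (at 0) e =
        frechet_derivative ?f (at 0) (\<Sum>k\<in>UNIV. (e $ k) *\<^sub>R axis k 1)"
      using basis_expansion[of e] by (simp add: scalar_mult_eq_scaleR)
    also have "\<dots> = vlin (vderiv T G (t, x)) e"
      unfolding vlin_def using lin by (simp add: linear_sum linear_cmul vderiv_def)
    finally show ?thesis .
  qed
  then have "frechet_derivative ?f (at 0) = vlin (vderiv T G (t, x))" by blast
  with D show ?thesis by simp
qed

lemma vertical_has_derivative:
  fixes G :: "('d::finite, 'v::euclidean_space) functional"
  assumes "vert_differentiable T G" "(t, x) \<in> Lam T" "0 \<le> T"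
  shows "((\<lambda>e. G (t, bump T t e x)) has_derivative vlin (vderiv T G (t, bump T t e x)))
    (at e within A)"
proof -
  let ?y = "bump T t e x"
  have D: "((\<lambda>e'. G (t, bump T t e' ?y)) has_derivative vlin (vderiv T G (t, ?y))) (at (e - e))"
    using vertical_has_derivative_zero[OF assms(1) Lam_bump[OF assms(2,3)]] by simp
  have S: "((\<lambda>e'. e' - e) has_derivative (\<lambda>h. h)) (at e)"
    by (auto intro!: derivative_eq_intros)
  have "((\<lambda>e'. G (t, bump T t (e' - e) ?y)) has_derivative vlin (vderiv T G (t, ?y))) (at e)"
    by (rule has_derivative_compose[OF S D])
  then have "((\<lambda>e. G (t, bump T t e x)) has_derivative vlin (vderiv T G (t, ?y))) (at e)"
    by (simp add: bump_bump)
  then show ?thesis by (rule has_derivative_at_withinI)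
qed

text \<open>
  A vertical perturbation by \<open>e\<close> moves the path by \<open>norm e\<close> in sup norm, so the vertical derivative
  varies by at most \<open>K * norm e\<close> along the segment from \<open>0\<close> to \<open>e\<close>.
\<close>

lemma vertical_expansion:
  fixes G :: "('d::finite, 'v::euclidean_space) functional"
  assumes "vert_differentiable T G" "(t, x) \<in> Lam T" "0 \<le> T" "0 \<le> K"
    and lip: "\<And>y y'. (t, y) \<in> Lam T \<Longrightarrow> (t, y') \<in> Lam T \<Longrightarrow>
      norm (vderiv T G (t, y) - vderiv T G (t, y')) \<le> K * sup_dist T y y'"
  shows "norm (G (t, bump T t e x) - G (t, x) - vlin (vderiv T G (t, x)) e) \<le> K * (norm e)\<^sup>2"
proof -
  let ?S = "cball (0::real^'d) (norm e)"
  let ?f' = "\<lambda>e. vlin (vderiv T G (t, bump T t e x))"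
  have on: "onorm (\<lambda>h. ?f' e' h - ?f' 0 h) \<le> K * norm e" if "e' \<in> ?S" for e'
  proof (rule onorm_le)
    fix h
    have "norm (?f' e' h - ?f' 0 h) \<le>
        norm (vderiv T G (t, bump T t e' x) - vderiv T G (t, bump T t 0 x)) * norm h"
      unfolding vlin_diff_left[symmetric] by (rule norm_vlin_le)
    also have "\<dots> \<le> (K * norm e) * norm h"
    proof (rule mult_right_mono)
      have "norm (vderiv T G (t, bump T t e' x) - vderiv T G (t, bump T t 0 x)) \<le>
          K * sup_dist T (bump T t e' x) (bump T t 0 x)"
        by (intro lip Lam_bump assms)
      also have "\<dots> \<le> K * norm e"
        using sup_dist_bump[OF assms(3), of t e' x 0] that assms(4)
        by (intro mult_left_mono) (auto intro: order.trans)
      finally show "norm (vderiv T G (t, bump T t e' x) - vderiv T G (t, bump T t 0 x)) \<le> K * norm e" .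
    qed auto
    finally show "norm (?f' e' h - ?f' 0 h) \<le> (K * norm e) * norm h" .
  qed
  have "norm (G (t, bump T t e x) - G (t, bump T t 0 x) - ?f' 0 (e - 0)) \<le>
      norm (e - 0) * (K * norm e)"
  proof (rule differentiable_bound_linearization[where S = ?S and f' = ?f'])
    fix s :: real assume "s \<in> {0..1}"
    then show "0 + s *\<^sub>R (e - 0) \<in> ?S" by (auto intro: mult_left_le_one_le)
  qed (use on vertical_has_derivative[OF assms(1-3)] in \<open>auto simp: fun_diff_def\<close>)
  then show ?thesis
    using bump_zero[OF assms(2,3)] by (simp add: power2_eq_square algebra_simps)
qed

lemma vderiv_line:
  fixes G :: "('d::finite, 'v::euclidean_space) functional"
  assumes "vert_differentiable T G" "(t, x) \<in> Lam T" "0 \<le> T"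
  shows "((\<lambda>r. G (t, bump T t (r *\<^sub>R axis i 1) x)) has_vector_derivative
     vderiv T G (t, bump T t (r *\<^sub>R axis i 1) x) $ i) (at r)"
proof -
  have "((\<lambda>r. r *\<^sub>R axis i (1::real)) has_derivative (\<lambda>h. h *\<^sub>R axis i 1)) (at r)"
    by (auto intro!: derivative_eq_intros)
  from has_derivative_compose[OF this vertical_has_derivative[OF assms, of "r *\<^sub>R axis i 1" UNIV]]
  show ?thesis
    by (simp add: has_vector_derivative_def vlin_scaleR_right vlin_axis)
qed

section \<open>Regularity of the functionals along bounded paths\<close>

definition path_Lip :: "real \<Rightarrow> real \<Rightarrow> ('d::finite, 'v::real_normed_vector) functional \<Rightarrow> bool" where
  "path_Lip T K G \<longleftrightarrow> (\<forall>t x y. (t, x) \<in> Lam T \<longrightarrow> (t, y) \<in> Lam T \<longrightarrow>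
     norm (G (t, x) - G (t, y)) \<le> K * sup_dist T x y)"

lemma path_LipD:
  "path_Lip T K G \<Longrightarrow> (t, x) \<in> Lam T \<Longrightarrow> (t, y) \<in> Lam T \<Longrightarrow>
    norm (G (t, x) - G (t, y)) \<le> K * sup_dist T x y"
  by (simp add: path_Lip_def)

lemma norm_le_card_mult:
  fixes w :: "'v::real_normed_vector^'d::finite"
  assumes "\<And>i. norm (w $ i) \<le> B"
  shows "norm w \<le> real CARD('d) * B"
proof -
  have "norm w \<le> (\<Sum>i\<in>(UNIV::'d set). norm (w $ i))"
    unfolding norm_vec_def by (rule L2_set_le_sum) simp
  also have "\<dots> \<le> (\<Sum>i\<in>(UNIV::'d set). B)" by (rule sum_mono) (rule assms)
  finally show ?thesis by simp
qed

lemma onorm_line_le: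
  fixes v :: "'v::real_normed_vector"
  assumes "norm v \<le> B"
  shows "onorm (\<lambda>h. h *\<^sub>R v) \<le> B"
proof (rule onorm_le)
  fix h :: real
  show "norm (h *\<^sub>R v) \<le> B * norm h"
    using mult_left_mono[OF assms abs_ge_zero[of h]] by (simp add: mult.commute)
qed

lemma taylor2_at_1:
  fixes k :: "real \<Rightarrow> 'v::real_normed_vector"
  assumes k: "\<And>r. r \<in> {0..1} \<Longrightarrow> (k has_vector_derivative k' r) (at r)"
    and k': "\<And>r. r \<in> {0..1} \<Longrightarrow> (k' has_vector_derivative k'' r) (at r)"
    and B: "\<And>r. r \<in> {0..1} \<Longrightarrow> norm (k'' r) \<le> B"
  shows "norm (k 1 - k 0 - k' 0) \<le> B"
proof -
  have B0: "0 \<le> B" using order.trans[OF norm_ge_zero B[of 0]] by simp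
  have d: "norm (k' r - k' 0) \<le> B" if r: "r \<in> {0..1}" for r
  proof -
    have "norm (k' r - k' 0) \<le> B * norm (r - 0)"
    proof (rule differentiable_bound[where S = "{0..1}" and f' = "\<lambda>r h. h *\<^sub>R k'' r"])
      fix x :: real assume x: "x \<in> {0..1}"
      show "(k' has_derivative (\<lambda>h. h *\<^sub>R k'' x)) (at x within {0..1})"
        using k'[OF x] unfolding has_vector_derivative_def by (rule has_derivative_at_withinI)
      show "onorm (\<lambda>h. h *\<^sub>R k'' x) \<le> B"
        by (rule onorm_line_le[OF B[OF x]])
    qed (use r in auto)
    also have "\<dots> \<le> B" using r B0 by (simp add: mult_left_le)
    finally show ?thesis .
  qed
  have "norm (k 1 - k 0 - (1 - 0) *\<^sub>R k' 0) \<le> norm (1 - 0 :: real) * B"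
  proof (rule differentiable_bound_linearization[where S = "{0..1}" and f' = "\<lambda>r h. h *\<^sub>R k' r"])
    fix x :: real assume x: "x \<in> {0..1}"
    show "(k has_derivative (\<lambda>h. h *\<^sub>R k' x)) (at x within {0..1})"
      using k[OF x] unfolding has_vector_derivative_def by (rule has_derivative_at_withinI)
    show "onorm ((\<lambda>h. h *\<^sub>R k' x) - (\<lambda>h. h *\<^sub>R k' 0)) \<le> B"
      using onorm_line_le[OF d[OF x]] by (simp add: fun_diff_def scaleR_diff_right)
  qed auto
  then show ?thesis by simp
qed

text \<open>The difference of the values at two paths under a common perturbation by \<open>r\<close> along the axis \<open>i\<close>.\<close>

definition line_diff ::
  "real \<Rightarrow> ('d::finite, 'v::euclidean_space) functional \<Rightarrow> real \<Rightarrow> 'd \<Rightarrow> (real \<Rightarrow> real^'d) \<Rightarrow>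
    (real \<Rightarrow> real^'d) \<Rightarrow> real \<Rightarrow> 'v" where
  "line_diff T G t i x y r = G (t, bump T t (r *\<^sub>R axis i 1) x) - G (t, bump T t (r *\<^sub>R axis i 1) y)"

context
  fixes T t :: real and x y :: "real \<Rightarrow> real^'d::finite"
  assumes T: "0 \<le> T" and xy: "(t, x) \<in> Lam T" "(t, y) \<in> Lam T"
begin

lemma line_diff_deriv:
  fixes G :: "('d, 'v::euclidean_space) functional"
  assumes "vert_differentiable T G"
  shows "(line_diff T G t i x y has_vector_derivative line_diff T (vderiv T G) t i x y r $ i) (at r)"
  unfolding line_diff_def[abs_def] vector_minus_component
  by (intro has_vector_derivative_diff vderiv_line assms xy T)

lemma line_diff_bound:
  fixes G :: "('d, 'v::euclidean_space) functional"
  assumes "path_Lip T K G"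
  shows "norm (line_diff T G t i x y r) \<le> K * sup_dist T x y"
  using path_LipD[OF assms Lam_bump[OF xy(1) T] Lam_bump[OF xy(2) T]]
  by (metis line_diff_def sup_dist_bump_same)

lemma line_diff_zero: "line_diff T G t i x y 0 = G (t, x) - G (t, y)"
  using xy T by (simp add: line_diff_def bump_zero)

end

lemma has_vector_derivative_nth:
  assumes "(f has_vector_derivative f') (at r)"
  shows "((\<lambda>r. f r $ i) has_vector_derivative f' $ i) (at r)"
  using assms by (rule bounded_linear.has_vector_derivative[OF bounded_linear_vec_nth])

lemma norm_nth_nth_le:
  fixes w :: "'v::real_normed_vector^'d^'d::finite"
  shows "norm (w $ i $ j) \<le> norm w"
  by (rule order.trans[OF Finite_Cartesian_Product.norm_nth_le Finite_Cartesian_Product.norm_nth_le])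

text \<open>
  Interpolation: let \<open>k\<close> be the difference of the values of \<open>G\<close> at two paths, as a function of a common
  vertical perturbation along an axis. By assumption \<open>k\<close> and its third derivative are bounded by
  multiples of the distance of the paths, which a common perturbation does not change. Taylor's
  formula for the odd part of \<open>k\<close>, from which the second derivative drops out, bounds \<open>k'\<close>.
\<close>

lemma path_Lip_vderiv_from_third:
  fixes G :: "('d::finite, 'v::euclidean_space) functional"
  assumes T: "0 \<le> T"
    and dif: "vert_differentiable T G" "vert_differentiable T (vderiv T G)"
      "vert_differentiable T (vderiv T (vderiv T G))"
    and lip: "path_Lip T K G" "path_Lip T K' (vderiv T (vderiv T (vderiv T G)))"
  shows "path_Lip T (real CARD('d) * (K + K')) (vderiv T G)"
  unfolding path_Lip_def
proof safe
  fix t and x y :: "real \<Rightarrow> real^'d"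
  assume xy: "(t, x) \<in> Lam T" "(t, y) \<in> Lam T"
  let ?\<delta> = "sup_dist T x y"
  have "norm ((vderiv T G (t, x) - vderiv T G (t, y)) $ i) \<le> (K + K') * ?\<delta>" for i
  proof -
    define k0 where "k0 = line_diff T G t i x y"
    define k1 where "k1 r = line_diff T (vderiv T G) t i x y r $ i" for r
    define k2 where "k2 r = line_diff T (vderiv T (vderiv T G)) t i x y r $ i $ i" for r
    define k3 where "k3 r = line_diff T (vderiv T (vderiv T (vderiv T G))) t i x y r $ i $ i $ i" for r
    have D0: "(k0 has_vector_derivative k1 r) (at r)" for r
      unfolding k0_def k1_def by (rule line_diff_deriv[OF T xy dif(1)])
    have D1: "(k1 has_vector_derivative k2 r) (at r)" for r
      unfolding k1_def[abs_def] k2_def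
      by (intro has_vector_derivative_nth line_diff_deriv[OF T xy dif(2)])
    have D2: "(k2 has_vector_derivative k3 r) (at r)" for r
      unfolding k2_def[abs_def] k3_def
      by (intro has_vector_derivative_nth line_diff_deriv[OF T xy dif(3)])
    have b0: "norm (k0 r) \<le> K * ?\<delta>" for r
      unfolding k0_def by (rule line_diff_bound[OF T xy lip(1)])
    have b3: "norm (k3 r) \<le> K' * ?\<delta>" for r
      unfolding k3_def
      by (intro order.trans[OF norm_nth_nth_le] order.trans[OF Finite_Cartesian_Product.norm_nth_le]
          line_diff_bound[OF T xy lip(2)])
    have b2: "norm (k2 r - k2 (- r)) \<le> 2 * (K' * ?\<delta>)" if "r \<in> {0..1}" for r
    proof -
      have "norm (k2 r - k2 (- r)) \<le> K' * ?\<delta> * norm (r - (- r))"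
      proof (rule differentiable_bound[where S = UNIV and f' = "\<lambda>r h. h *\<^sub>R k3 r"])
        fix z :: real
        show "(k2 has_derivative (\<lambda>h. h *\<^sub>R k3 z)) (at z within UNIV)"
          using D2[of z] unfolding has_vector_derivative_def by simp
        show "onorm (\<lambda>h. h *\<^sub>R k3 z) \<le> K' * ?\<delta>"
          by (rule onorm_line_le[OF b3])
      qed auto
      also have "\<dots> \<le> K' * ?\<delta> * 2"
        using that order.trans[OF norm_ge_zero b3[of 0]] by (intro mult_left_mono) auto
      finally show ?thesis by simp
    qed
    have neg: "((\<lambda>r. f (- r)) has_vector_derivative - f' (- r)) (at r)"
      if "\<And>r. (f has_vector_derivative f' r) (at r)" for f f' :: "real \<Rightarrow> 'v" and r
    proof -
      have "(uminus has_vector_derivative (- 1 :: real)) (at r)"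
        by (auto intro!: derivative_eq_intros)
      from vector_diff_chain_at[OF this that] show ?thesis by (simp add: o_def)
    qed
    have "norm ((\<lambda>r. k0 r - k0 (- r)) 1 - (\<lambda>r. k0 r - k0 (- r)) 0 - (\<lambda>r. k1 r + k1 (- r)) 0)
        \<le> 2 * (K' * ?\<delta>)"
    proof (rule taylor2_at_1[where k'' = "\<lambda>r. k2 r - k2 (- r)"])
      fix r :: real
      show "((\<lambda>r. k0 r - k0 (- r)) has_vector_derivative k1 r + k1 (- r)) (at r)"
        using has_vector_derivative_diff[OF D0[of r] neg[OF D0, of r]] by simp
      show "((\<lambda>r. k1 r + k1 (- r)) has_vector_derivative k2 r - k2 (- r)) (at r)"
        using has_vector_derivative_add[OF D1[of r] neg[OF D1, of r]] by simp
    qed (use b2 in auto)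
    then have e: "norm (k0 1 - k0 (- 1) - 2 *\<^sub>R k1 0) \<le> 2 * (K' * ?\<delta>)"
      by (simp add: scaleR_2)
    have "2 * norm (k1 0) = norm (2 *\<^sub>R k1 0)" by simp
    also have "2 *\<^sub>R k1 0 = k0 1 - k0 (- 1) - (k0 1 - k0 (- 1) - 2 *\<^sub>R k1 0)" by simp
    also have "norm \<dots> \<le> norm (k0 1) + norm (k0 (- 1)) + norm (k0 1 - k0 (- 1) - 2 *\<^sub>R k1 0)"
      by (meson add_mono norm_triangle_ineq4 order_refl order_trans)
    also have "\<dots> \<le> 2 * ((K + K') * ?\<delta>)"
      using e b0[of 1] b0[of "- 1"] by (simp add: algebra_simps)
    finally have "norm (k1 0) \<le> (K + K') * ?\<delta>" by simp
    then show ?thesis by (simp add: k1_def line_diff_zero[OF T xy])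
  qed
  from norm_le_card_mult[OF this]
  show "norm (vderiv T G (t, x) - vderiv T G (t, y)) \<le> real CARD('d) * (K + K') * ?\<delta>"
    by (simp add: mult.assoc)
qed

text \<open>
  The same argument one order lower. It serves to pass from the first to the second derivative of a
  functional whose third derivative is Lipschitz.
\<close>

lemma path_Lip_vderiv_from_second:
  fixes G :: "('d::finite, 'v::euclidean_space) functional"
  assumes T: "0 \<le> T"
    and dif: "vert_differentiable T G" "vert_differentiable T (vderiv T G)"
    and lip: "path_Lip T K G" "path_Lip T K' (vderiv T (vderiv T G))"
  shows "path_Lip T (real CARD('d) * (2 * K + K')) (vderiv T G)"
  unfolding path_Lip_def
proof safe
  fix t and x y :: "real \<Rightarrow> real^'d"
  assume xy: "(t, x) \<in> Lam T" "(t, y) \<in> Lam T"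
  let ?\<delta> = "sup_dist T x y"
  have "norm ((vderiv T G (t, x) - vderiv T G (t, y)) $ i) \<le> (2 * K + K') * ?\<delta>" for i
  proof -
    define k0 where "k0 = line_diff T G t i x y"
    define k1 where "k1 r = line_diff T (vderiv T G) t i x y r $ i" for r
    define k2 where "k2 r = line_diff T (vderiv T (vderiv T G)) t i x y r $ i $ i" for r
    have D0: "(k0 has_vector_derivative k1 r) (at r)" for r
      unfolding k0_def k1_def by (rule line_diff_deriv[OF T xy dif(1)])
    have D1: "(k1 has_vector_derivative k2 r) (at r)" for r
      unfolding k1_def[abs_def] k2_def
      by (intro has_vector_derivative_nth line_diff_deriv[OF T xy dif(2)])
    have b0: "norm (k0 r) \<le> K * ?\<delta>" for r
      unfolding k0_def by (rule line_diff_bound[OF T xy lip(1)])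
    have b2: "norm (k2 r) \<le> K' * ?\<delta>" for r
      unfolding k2_def by (intro order.trans[OF norm_nth_nth_le] line_diff_bound[OF T xy lip(2)])
    have e: "norm (k0 1 - k0 0 - k1 0) \<le> K' * ?\<delta>"
      by (rule taylor2_at_1[OF D0 D1 b2])
    have "k1 0 = k0 1 - k0 0 - (k0 1 - k0 0 - k1 0)" by simp
    also have "norm \<dots> \<le> norm (k0 1) + norm (k0 0) + norm (k0 1 - k0 0 - k1 0)"
      by (meson add_mono norm_triangle_ineq4 order_refl order_trans)
    also have "\<dots> \<le> (2 * K + K') * ?\<delta>"
      using e b0[of 1] b0[of 0] by (simp add: algebra_simps)
    finally have "norm (k1 0) \<le> (2 * K + K') * ?\<delta>" .
    then show ?thesis by (simp add: k1_def line_diff_zero[OF T xy])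
  qed
  from norm_le_card_mult[OF this]
  show "norm (vderiv T G (t, x) - vderiv T G (t, y)) \<le> real CARD('d) * (2 * K + K') * ?\<delta>"
    by (simp add: mult.assoc)
qed

text \<open>
  The second difference of \<open>F\<close> under perturbations by \<open>s e\<close> and \<open>s e'\<close> is symmetric in \<open>e\<close> and \<open>e'\<close>, and
  equals \<open>s\<^sup>2\<close> times the second derivative up to \<open>O(s\<^sup>3)\<close>.
\<close>

lemma vderiv2_symmetric:
  fixes F :: "('d::finite, real) functional"
  assumes T: "0 \<le> T" and K: "0 \<le> K"
    and dif: "vert_differentiable T F" "vert_differentiable T (vderiv T F)"
    and lip: "path_Lip T K (vderiv T (vderiv T F))" and x: "(t, x) \<in> Lam T"
  shows "vlin (vderiv T (vderiv T F) (t, x)) e \<bullet> e' = vlin (vderiv T (vderiv T F) (t, x)) e' \<bullet> e"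
proof -
  define f where "f e = F (t, bump T t e x)" for e
  define g where "g e = vderiv T F (t, bump T t e x)" for e
  define h where "h = vlin (vderiv T (vderiv T F) (t, x))"
  have gexp: "norm (g e - g 0 - h e) \<le> K * (norm e)\<^sup>2" for e
    using vertical_expansion[OF dif(2) x T K, of e] path_LipD[OF lip] bump_zero[OF x T]
    by (simp add: g_def h_def)
  have fd: "(f has_derivative (\<lambda>v. g e \<bullet> v)) (at e)" for e
    using vertical_has_derivative[OF dif(1) x T, of e UNIV]
    unfolding f_def[abs_def] g_def by (simp add: vlin_inner[abs_def])
  \<comment> \<open>Mean value theorem in direction \<open>e'\<close>, applied to the difference of two translates.\<close>
  have mixed: "\<bar>(f (e + e') - f e - f e' + f 0) - h e \<bullet> e'\<bar> \<le> 2 * K * (norm e + norm e')\<^sup>2 * norm e'"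
    for e e'
  proof -
    have line: "((\<lambda>r. f (a + r *\<^sub>R e')) has_derivative (\<lambda>v. v * (g (a + r *\<^sub>R e') \<bullet> e'))) (at r within {0..1})"
      for a r
    proof -
      have "((\<lambda>r. a + r *\<^sub>R e') has_derivative (\<lambda>v. v *\<^sub>R e')) (at r within {0..1})"
        by (auto intro!: derivative_eq_intros)
      from has_derivative_compose[OF this fd] show ?thesis by simp
    qed
    have "\<exists>r\<in>{0<..<1::real}. (\<lambda>r. f (e + r *\<^sub>R e') - f (0 + r *\<^sub>R e')) 1 -
        (\<lambda>r. f (e + r *\<^sub>R e') - f (0 + r *\<^sub>R e')) 0 =
        (1 - 0) * (g (e + r *\<^sub>R e') \<bullet> e') - (1 - 0) * (g (0 + r *\<^sub>R e') \<bullet> e')"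
      by (rule mvt_simple) (simp, rule has_derivative_diff[OF line line])
    then obtain r where r: "0 < r" "r < 1"
      and eq: "f (e + e') - f e - f e' + f 0 = (g (e + r *\<^sub>R e') - g (r *\<^sub>R e')) \<bullet> e'"
      by (auto simp: inner_diff_left)
    have lin: "h (e + r *\<^sub>R e') - h (r *\<^sub>R e') = h e"
      unfolding h_def by (simp add: vlin_add_right)
    have re: "norm (r *\<^sub>R e') \<le> norm e'" using r by (simp add: mult_left_le_one_le)
    have "norm (g (e + r *\<^sub>R e') - g (r *\<^sub>R e') - h e)
        = norm ((g (e + r *\<^sub>R e') - g 0 - h (e + r *\<^sub>R e')) - (g (r *\<^sub>R e') - g 0 - h (r *\<^sub>R e')))"
      using lin by (simp add: algebra_simps)
    also have "\<dots> \<le> K * (norm (e + r *\<^sub>R e'))\<^sup>2 + K * (norm (r *\<^sub>R e'))\<^sup>2"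
      by (rule order.trans[OF norm_triangle_ineq4 add_mono[OF gexp gexp]])
    also have "\<dots> \<le> K * (norm e + norm e')\<^sup>2 + K * (norm e + norm e')\<^sup>2"
      using re norm_triangle_ineq[of e "r *\<^sub>R e'"] norm_ge_zero[of e]
      by (intro add_mono mult_left_mono power_mono K norm_ge_zero) linarith+
    finally have b: "norm (g (e + r *\<^sub>R e') - g (r *\<^sub>R e') - h e) \<le> 2 * K * (norm e + norm e')\<^sup>2"
      by simp
    have "\<bar>(g (e + r *\<^sub>R e') - g (r *\<^sub>R e') - h e) \<bullet> e'\<bar> \<le> 2 * K * (norm e + norm e')\<^sup>2 * norm e'"
      by (rule order.trans[OF Cauchy_Schwarz_ineq2 mult_right_mono[OF b norm_ge_zero]])
    then show ?thesis by (simp add: eq inner_diff_left)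
  qed
  let ?C = "4 * K * (norm e + norm e')^3"
  have "\<bar>h e \<bullet> e' - h e' \<bullet> e\<bar> \<le> s * ?C" if s: "0 < s" for s :: real
  proof -
    have n: "norm (s *\<^sub>R e) + norm (s *\<^sub>R e') = s * (norm e + norm e')"
      "norm (s *\<^sub>R e') + norm (s *\<^sub>R e) = s * (norm e + norm e')"
      using s by (simp_all add: algebra_simps)
    have b: "2 * K * (s * (norm e + norm e'))\<^sup>2 * norm (s *\<^sub>R v) \<le> s^3 * ?C / 2"
      if "norm v \<le> norm e + norm e'" for v :: "real^'d"
    proof -
      have "2 * K * (s * (norm e + norm e'))\<^sup>2 * norm (s *\<^sub>R v)
          \<le> 2 * K * (s * (norm e + norm e'))\<^sup>2 * (s * (norm e + norm e'))"
        using s that K by (intro mult_left_mono) auto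
      also have "\<dots> = s^3 * ?C / 2" by (simp add: power2_eq_square power3_eq_cube algebra_simps)
      finally show ?thesis .
    qed
    have 1: "\<bar>(f (s *\<^sub>R e + s *\<^sub>R e') - f (s *\<^sub>R e) - f (s *\<^sub>R e') + f 0) - h (s *\<^sub>R e) \<bullet> (s *\<^sub>R e')\<bar> \<le> s^3 * ?C / 2"
      using mixed[of "s *\<^sub>R e" "s *\<^sub>R e'"] b[of e'] unfolding n by simp
    have 2: "\<bar>(f (s *\<^sub>R e' + s *\<^sub>R e) - f (s *\<^sub>R e') - f (s *\<^sub>R e) + f 0) - h (s *\<^sub>R e') \<bullet> (s *\<^sub>R e)\<bar> \<le> s^3 * ?C / 2"
      using mixed[of "s *\<^sub>R e'" "s *\<^sub>R e"] b[of e] unfolding n by simp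
    have "s\<^sup>2 * \<bar>h e \<bullet> e' - h e' \<bullet> e\<bar> = \<bar>h (s *\<^sub>R e) \<bullet> (s *\<^sub>R e') - h (s *\<^sub>R e') \<bullet> (s *\<^sub>R e)\<bar>"
    proof -
      have "h (s *\<^sub>R e) \<bullet> (s *\<^sub>R e') - h (s *\<^sub>R e') \<bullet> (s *\<^sub>R e) = s\<^sup>2 * (h e \<bullet> e' - h e' \<bullet> e)"
        by (simp add: h_def vlin_scaleR_right power2_eq_square algebra_simps)
      then show ?thesis by (simp add: abs_mult)
    qed
    also have "\<dots> \<le> s^3 * ?C"
    proof -
      have c: "f (s *\<^sub>R e' + s *\<^sub>R e) = f (s *\<^sub>R e + s *\<^sub>R e')" by (simp add: add.commute)
      show ?thesis using 1 2 unfolding c by linarith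
    qed
    also have "\<dots> = s\<^sup>2 * (s * ?C)" by (simp add: power2_eq_square power3_eq_cube)
    finally show ?thesis using s by simp
  qed
  then have "\<bar>h e \<bullet> e' - h e' \<bullet> e\<bar> \<le> 0 + r" if "0 < r" for r
  proof -
    have C: "?C < ?C + 1" by simp
    have C0: "0 \<le> ?C" using K by simp
    have "\<bar>h e \<bullet> e' - h e' \<bullet> e\<bar> \<le> r / (?C + 1) * ?C"
      using \<open>\<And>s. 0 < s \<Longrightarrow> \<bar>h e \<bullet> e' - h e' \<bullet> e\<bar> \<le> s * ?C\<close>[of "r / (?C + 1)"] that C0 by simp
    also have "\<dots> \<le> r" using that C0 by (simp add: divide_simps mult_left_mono)
    finally show ?thesis by simp
  qed
  then have "\<bar>h e \<bullet> e' - h e' \<bullet> e\<bar> \<le> 0" by (rule field_le_epsilon)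
  then show ?thesis by (simp add: h_def)
qed

text \<open>
  A mean value inequality for functions that are differentiable from the right only. The bound with
  \<open>C + \<epsilon>\<close> persists to the supremum of the times up to which it holds by left continuity, and beyond
  it by the right derivative.
\<close>

lemma right_derivative_bound:
  fixes g :: "real \<Rightarrow> 'v::real_normed_vector"
  assumes "u \<le> v"
    and der: "\<And>r. u \<le> r \<Longrightarrow> r < v \<Longrightarrow>
      \<exists>l. ((\<lambda>h. (g (r + h) - g r) /\<^sub>R h) \<longlongrightarrow> l) (at_right 0) \<and> norm l \<le> C"
    and left: "\<And>r. u < r \<Longrightarrow> r \<le> v \<Longrightarrow> (g \<longlongrightarrow> g r) (at_left r)"
  shows "norm (g v - g u) \<le> C * (v - u)"
proof -
  have "norm (g v - g u) \<le> (C + \<epsilon>) * (v - u)" if \<epsilon>: "\<epsilon> > 0" for \<epsilon>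
  proof -
    define P where "P r \<longleftrightarrow> norm (g r - g u) \<le> (C + \<epsilon>) * (r - u)" for r
    define A where "A = {r \<in> {u..v}. \<forall>r'\<in>{u..r}. P r'}"
    have uA: "u \<in> A" using assms(1) by (auto simp: A_def P_def)
    have bdd: "bdd_above A" by (auto simp: A_def)
    define s where "s = Sup A"
    have us: "u \<le> s" unfolding s_def by (rule cSup_upper[OF uA bdd])
    have sv: "s \<le> v" unfolding s_def by (rule cSup_least) (use uA in \<open>auto simp: A_def\<close>)
    have below: "P r" if "u \<le> r" "r < s" for r
    proof -
      obtain a where "a \<in> A" "r < a" using less_cSupE[OF \<open>r < s\<close>[unfolded s_def]] uA by blast
      then show ?thesis using that by (auto simp: A_def)
    qed
    have Ps: "P s"
    proof (cases "u < s")
      case True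
      have "((\<lambda>r. norm (g r - g u)) \<longlongrightarrow> norm (g s - g u)) (at_left s)"
        using left[OF True sv] by (intro tendsto_intros)
      moreover have "((\<lambda>r. (C + \<epsilon>) * (r - u)) \<longlongrightarrow> (C + \<epsilon>) * (s - u)) (at_left s)"
        by (intro tendsto_intros)
      moreover have "\<forall>\<^sub>F r in at_left s. norm (g r - g u) \<le> (C + \<epsilon>) * (r - u)"
        using eventually_at_left_real[OF True] by (rule eventually_mono) (use below in \<open>auto simp: P_def\<close>)
      ultimately show ?thesis unfolding P_def by (intro tendsto_le[OF _ _ _ ]) auto
    next
      case False
      with us have "s = u" by simp
      then show ?thesis by (simp add: P_def)
    qed
    have "s = v"
    proof (rule ccontr)
      assume "s \<noteq> v"
      with sv have "s < v" by simp
      from der[OF us this] obtain l where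
        l: "((\<lambda>h. (g (s + h) - g s) /\<^sub>R h) \<longlongrightarrow> l) (at_right 0)" "norm l \<le> C" by blast
      from tendstoD[OF l(1) \<epsilon>]
      obtain d where d: "d > 0" "\<And>h. 0 < h \<Longrightarrow> h < d \<Longrightarrow> dist ((g (s + h) - g s) /\<^sub>R h) l < \<epsilon>"
        unfolding eventually_at_right_field by auto
      have step: "P (s + h)" if h: "0 < h" "h < d" for h
      proof -
        have "norm ((g (s + h) - g s) /\<^sub>R h) \<le> C + \<epsilon>"
          using d(2)[OF h] l(2) norm_triangle_sub[of "(g (s + h) - g s) /\<^sub>R h" l]
          by (simp add: dist_norm)
        then have "norm (g (s + h) - g s) \<le> (C + \<epsilon>) * h"
          using h by (simp add: divide_simps mult.commute)
        moreover have "norm (g (s + h) - g u) \<le> norm (g (s + h) - g s) + norm (g s - g u)"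
          using norm_triangle_ineq[of "g (s + h) - g s" "g s - g u"] by simp
        ultimately show ?thesis using Ps by (simp add: P_def algebra_simps)
      qed
      define q where "q = s + min (d / 2) (v - s)"
      have "P r" if "u \<le> r" "r \<le> q" for r
      proof -
        consider "r < s" | "r = s" | "s < r" by linarith
        then show ?thesis
        proof cases
          case 3
          have "r - s < d" using that d(1) by (auto simp: q_def min_def split: if_splits)
          then show ?thesis using step[of "r - s"] 3 by simp
        qed (use below Ps that in auto)
      qed
      then have "q \<in> A" using us \<open>s < v\<close> d(1) by (auto simp: A_def q_def)
      then have "q \<le> s" unfolding s_def by (rule cSup_upper[OF _ bdd])
      then show False using \<open>s < v\<close> d(1) by (auto simp: q_def)
    qed
    then show ?thesis using Ps by (simp add: P_def)
  qed
  then have "norm (g v - g u) \<le> C * (v - u) + e" if "e > 0" for e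
  proof (cases "v = u")
    case False
    then have vu: "v - u > 0" using assms(1) by simp
    have "norm (g v - g u) \<le> (C + e / (v - u)) * (v - u)"
      by (rule \<open>\<And>\<epsilon>. \<epsilon> > 0 \<Longrightarrow> norm (g v - g u) \<le> (C + \<epsilon>) * (v - u)\<close>) (use vu that in simp)
    also have "\<dots> = C * (v - u) + e" using vu by (simp add: distrib_right)
    finally show ?thesis .
  qed (use that in simp)
  then show ?thesis by (rule field_le_epsilon)
qed

text \<open>
  A path stopped at \<open>u\<close> is also stopped at every later time. So \<open>r \<mapsto> G (r, x)\<close> is left continuous by
  \<open>C00l\<close>, and its right derivative is bounded on \<open>[u, T)\<close>.
\<close>

lemma horizontal_Lipschitz:
  fixes G :: "('d::finite, 'v::euclidean_space) functional"
  assumes T: "0 \<le> T" and G: "hor_differentiable T G" "G \<in> C00l T" "hderiv T G \<in> bdd_pres T"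
    and W: "compact W"
  shows "\<exists>C>0. \<forall>u v x. (u, x) \<in> Lam T \<longrightarrow> u \<le> v \<longrightarrow> v \<le> T \<longrightarrow> x ` {0..T} \<subseteq> W \<longrightarrow>
    norm (G (v, x) - G (u, x)) \<le> C * (v - u)"
proof -
  from G(3) W T obtain C where C: "C > 0"
    "\<And>t x. (t, x) \<in> Lam T \<Longrightarrow> t \<le> T \<Longrightarrow> x ` {0..t} \<subseteq> W \<Longrightarrow> norm (hderiv T G (t, x)) < C"
    unfolding bdd_pres_def by (smt (verit, best) atLeastAtMost_iff mem_Collect_eq order_refl)
  have "norm (G (v, x) - G (u, x)) \<le> C * (v - u)"
    if x: "(u, x) \<in> Lam T" and uv: "u \<le> v" "v \<le> T" and xW: "x ` {0..T} \<subseteq> W" for u v x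
  proof (rule right_derivative_bound[OF uv(1)])
    fix r assume r: "u \<le> r" "r < v"
    then have rx: "(r, x) \<in> Lam T" using Lam_later[OF x T] uv by simp
    then obtain l where l: "((\<lambda>h. (G (r + h, x) - G (r, x)) /\<^sub>R h) \<longlongrightarrow> l) (at_right 0)"
      using G(1) r uv unfolding hor_differentiable_def by (meson less_le_trans)
    have "hderiv T G (r, x) = l"
      using r uv tendsto_Lim[OF _ l] by (simp add: hderiv_def)
    moreover have "norm (hderiv T G (r, x)) < C"
      by (rule C(2)[OF rx]) (use r uv xW in auto)
    ultimately show "\<exists>l. ((\<lambda>h. (G (r + h, x) - G (r, x)) /\<^sub>R h) \<longlongrightarrow> l) (at_right 0) \<and> norm l \<le> C"
      using l by force
  next
    fix r assume r: "u < r" "r \<le> v"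
    then have rx: "(r, x) \<in> Lam T" using Lam_later[OF x T] uv by simp
    show "((\<lambda>r. G (r, x)) \<longlongrightarrow> G (r, x)) (at_left r)"
    proof (rule tendstoI)
      fix e :: real assume "e > 0"
      with G(2) rx obtain \<eta> where \<eta>: "\<eta> > 0" "\<And>t' x'. (t', x') \<in> Lam T \<Longrightarrow> t' < r \<Longrightarrow>
          d_inf T (r, x) (t', x') < \<eta> \<Longrightarrow> norm (G (r, x) - G (t', x')) < e"
        unfolding C00l_def by (smt (verit, best) mem_Collect_eq)
      have "max u (r - \<eta>) < r" using r \<eta> by simp
      from eventually_at_left_real[OF this]
      show "\<forall>\<^sub>F r' in at_left r. dist (G (r', x)) (G (r, x)) < e"
      proof (rule eventually_mono)
        fix r' assume r': "r' \<in> {max u (r - \<eta>)<..<r}"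
        have "(r', x) \<in> Lam T" using Lam_later[OF x T] uv r r' by simp
        moreover have "d_inf T (r, x) (r', x) < \<eta>"
          using r' T by (simp add: d_inf_def sup_dist_self)
        ultimately show "dist (G (r', x)) (G (r, x)) < e"
          using \<eta>(2)[of r' x] r' by (simp add: dist_norm norm_minus_commute)
      qed
    qed
  qed
  with C(1) show ?thesis by blast
qed

text \<open>
  Quantitative regularity, with a single constant: Lipschitz in the path at a fixed time, and Lipschitz
  in time as long as the path is frozen. The set \<open>W\<close>, later the compact range of the reference path, makes the
  bound on the horizontal derivative uniform.
\<close>

definition tame ::
  "real \<Rightarrow> (real^'d) set \<Rightarrow> real \<Rightarrow> ('d::finite, 'v::real_normed_vector) functional \<Rightarrow> bool" where
  "tame T W K G \<longleftrightarrow> 0 \<le> K \<and> path_Lip T K G \<and>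
     (\<forall>u v x. (u, x) \<in> Lam T \<longrightarrow> u \<le> v \<longrightarrow> v \<le> T \<longrightarrow> x ` {0..T} \<subseteq> W \<longrightarrow>
        norm (G (v, x) - G (u, x)) \<le> K * (v - u))"

lemma tame_time:
  "tame T W K G \<Longrightarrow> (u, x) \<in> Lam T \<Longrightarrow> u \<le> v \<Longrightarrow> v \<le> T \<Longrightarrow> x ` {0..T} \<subseteq> W \<Longrightarrow>
    norm (G (v, x) - G (u, x)) \<le> K * (v - u)"
  by (simp add: tame_def)

lemma sup_dist_nonneg:
  assumes "0 \<le> T" "cadlag T x" "cadlag T y"
  shows "0 \<le> sup_dist T x y"
proof -
  have "bounded ((\<lambda>s. x s - y s) ` {0..T})"
    using bounded_minus_comp[of x "{0..T}" y] assms by (auto intro: cadlag_bounded)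
  then have "bdd_above ((\<lambda>s. norm (x s - y s)) ` {0..T})"
    by (auto simp: bounded_iff bdd_above_def)
  then have "norm (x 0 - y 0) \<le> sup_dist T x y"
    unfolding sup_dist_def by (rule cSUP_upper[rotated]) (use assms in auto)
  then show ?thesis using norm_ge_zero order.trans by blast
qed

lemma path_Lip_mono:
  fixes G :: "('d::finite, 'v::real_normed_vector) functional"
  assumes "path_Lip T K G" "K \<le> K'" "0 \<le> T"
  shows "path_Lip T K' G"
  unfolding path_Lip_def
proof safe
  fix t and x y :: "real \<Rightarrow> real^'d"
  assume xy: "(t, x) \<in> Lam T" "(t, y) \<in> Lam T"
  then have "cadlag T x" "cadlag T y" unfolding Lam_iff[OF assms(3)] by blast+
  then have "K * sup_dist T x y \<le> K' * sup_dist T x y"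
    using assms by (intro mult_right_mono sup_dist_nonneg)
  with path_LipD[OF assms(1) xy] show "norm (G (t, x) - G (t, y)) \<le> K' * sup_dist T x y" by simp
qed

lemma tame_mono:
  assumes "tame T W K G" "K \<le> K'" "0 \<le> T"
  shows "tame T W K' G"
  unfolding tame_def
proof (intro conjI allI impI)
  show "path_Lip T K' G" using assms path_Lip_mono by (auto simp: tame_def)
  fix u v :: real and x assume a: "(u, x) \<in> Lam T" "u \<le> v" "v \<le> T" "x ` {0..T} \<subseteq> W"
  have "K * (v - u) \<le> K' * (v - u)" using a assms by (intro mult_right_mono) auto
  with tame_time[OF assms(1) a] show "norm (G (v, x) - G (u, x)) \<le> K' * (v - u)" by simp
qed (use assms in \<open>auto simp: tame_def\<close>)

lemma tameI:
  fixes G :: "('d::finite, 'v::euclidean_space) functional"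
  assumes T: "0 \<le> T" and lip: "path_Lip T K G" and W: "compact W"
    and G: "hor_differentiable T G" "G \<in> C00l T" "hderiv T G \<in> bdd_pres T"
  shows "\<exists>K'. tame T W K' G"
proof -
  from horizontal_Lipschitz[OF T G W] obtain C where C: "C > 0"
    "\<And>u v x. (u, x) \<in> Lam T \<Longrightarrow> u \<le> v \<Longrightarrow> v \<le> T \<Longrightarrow> x ` {0..T} \<subseteq> W \<Longrightarrow>
      norm (G (v, x) - G (u, x)) \<le> C * (v - u)" by blast
  have "norm (G (v, x) - G (u, x)) \<le> max K C * (v - u)"
    if "(u, x) \<in> Lam T" "u \<le> v" "v \<le> T" "x ` {0..T} \<subseteq> W" for u v x
    using C(2)[OF that] that(2) mult_right_mono[of C "max K C" "v - u"] by simp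
  then have "tame T W (max K C) G"
    using path_Lip_mono[OF lip _ T, of "max K C"] C(1) by (simp add: tame_def)
  then show ?thesis by blast
qed

lemma S_class_tame:
  fixes F :: "('d::finite, real) functional"
  assumes T: "0 \<le> T" and F: "F \<in> S_class T" and W: "compact W"
  obtains K where "tame T W K F" "tame T W K (vderiv T F)" "tame T W K (vderiv T (vderiv T F))"
    "vert_differentiable T F" "vert_differentiable T (vderiv T F)"
proof -
  let ?\<phi> = "vderiv T F" let ?\<psi> = "vderiv T ?\<phi>" let ?\<chi> = "vderiv T ?\<psi>"
  have dif: "vert_differentiable T F" "vert_differentiable T ?\<phi>" "vert_differentiable T ?\<psi>"
    using F by (auto simp: S_class_def C12b_def C11b_def)
  obtain K K' where "path_Lip T K F" "path_Lip T K' ?\<chi>"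
    using F unfolding S_class_def Lip_def path_Lip_def mem_Collect_eq by meson
  note lip = this
  note lip\<phi> = path_Lip_vderiv_from_third[OF T dif lip]
  note lip\<psi> = path_Lip_vderiv_from_second[OF T dif(2,3) lip\<phi> lip(2)]
  have "\<exists>K. tame T W K F" "\<exists>K. tame T W K ?\<phi>" "\<exists>K. tame T W K ?\<psi>"
    using F by (auto simp: S_class_def C12b_def C11b_def
        intro: tameI[OF T lip(1) W] tameI[OF T lip\<phi> W] tameI[OF T lip\<psi> W])
  then obtain K1 K2 K3 where K: "tame T W K1 F" "tame T W K2 ?\<phi>" "tame T W K3 ?\<psi>" by blast
  let ?K = "max K1 (max K2 K3)"
  show ?thesis
    by (rule that[of ?K]) (use dif tame_mono[OF K(1) _ T, of ?K] tame_mono[OF K(2) _ T, of ?K]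
      tame_mono[OF K(3) _ T, of ?K] in auto)
qed

section \<open>Sewing over a finite grid\<close>

lemma crossing_index:
  fixes a :: "nat \<Rightarrow> real"
  assumes "i \<le> j" "a i \<le> s" "s < a j"
  obtains l where "i \<le> l" "l < j" "a l \<le> s" "s < a (Suc l)"
proof -
  have "\<exists>l. i \<le> l \<and> l < j \<and> a l \<le> s \<and> s < a (Suc l)"
    using assms
  proof (induction j rule: dec_induct)
    case (step n)
    show ?case
    proof (cases "s < a n")
      case True
      with step show ?thesis using less_Suc_eq by blast
    next
      case False
      with step show ?thesis by (intro exI[of _ n]) auto
    qed
  qed simp
  with that show ?thesis by blast
qed

lemma strict_grid_less:
  fixes a :: "nat \<Rightarrow> real"
  assumes "\<And>k. k < M \<Longrightarrow> a k < a (Suc k)" "i < j" "j \<le> M"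
  shows "a i < a j"
  using assms(2,3)
proof (induction j)
  case (Suc j)
  then show ?case using assms(1)[of j] by (cases "i = j") auto
qed simp

lemma weak_grid_le:
  fixes a :: "nat \<Rightarrow> real"
  assumes "\<And>k. k < M \<Longrightarrow> a k \<le> a (Suc k)" "i \<le> j" "j \<le> M"
  shows "a i \<le> a j"
  using assms(2,3)
proof (induction j rule: dec_induct)
  case (step n)
  then show ?case using assms(1)[of n] by auto
qed simp

text \<open>
  The sewing lemma without limits. Splitting at the step that contains the midpoint leaves two
  intervals of at most half the length, and \<open>2 (h / 2)\<^sup>\<theta>\<close> is a fixed fraction of \<open>h\<^sup>\<theta>\<close>; so the
  defects sum up as a geometric series, whatever the number and the spacing of the grid points.
\<close>

lemma discrete_sewing:
  fixes a :: "nat \<Rightarrow> real" and X :: "nat \<Rightarrow> nat \<Rightarrow> real"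
  assumes grid: "\<And>k. k < M \<Longrightarrow> a k < a (Suc k)" and \<theta>: "1 < \<theta>" and C: "0 \<le> C"
    and defect: "\<And>i j k. i \<le> j \<Longrightarrow> j \<le> k \<Longrightarrow> k \<le> M \<Longrightarrow>
      \<bar>X i k - X i j - X j k\<bar> \<le> C * (a k - a i) powr \<theta>"
    and ik: "i \<le> k" "k \<le> M"
  shows "\<bar>(\<Sum>l=i..<k. X l (Suc l)) - X i k\<bar> \<le> 2 * C / (1 - 2 powr (1 - \<theta>)) * (a k - a i) powr \<theta>"
  using ik
proof (induction "k - i" arbitrary: i k rule: less_induct)
  case less
  define q where "q = 2 powr (1 - \<theta>)"
  define D where "D = 2 * C / (1 - q)"
  have q: "q < 1" using \<theta> powr_less_mono[of "1 - \<theta>" 0 "2::real"] by (simp add: q_def)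
  have D0: "0 \<le> D" using q C by (simp add: D_def)
  \<comment> \<open>The two halves contribute \<open>D * q\<close>, the two splittings \<open>2 * C\<close>; \<open>D\<close> is the fixed point.\<close>
  have D: "D * q + 2 * C = D" using q by (simp add: D_def field_simps)
  show ?case
  proof (cases "i = k")
    case True
    with less.prems defect[of i i i] show ?thesis by simp
  next
    case False
    with less.prems have ik: "i < k" by simp
    define h where "h = a k - a i"
    have h: "0 < h" unfolding h_def using strict_grid_less[of M a i k] grid ik less.prems(2) by simp
    obtain l where l: "i \<le> l" "l < k" "a l \<le> a i + h / 2" "a i + h / 2 < a (Suc l)"
      by (rule crossing_index[of i k a "a i + h / 2"]) (use ik h in \<open>auto simp: h_def field_simps\<close>)
    have le: "a m \<le> a n" if "m \<le> n" "n \<le> M" for m n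
      using weak_grid_le[of M a m n] grid that by (simp add: less_imp_le)
    have half: "D * x powr \<theta> \<le> D * q / 2 * h powr \<theta>" if "0 \<le> x" "x \<le> h / 2" for x
    proof -
      have "x powr \<theta> \<le> (h / 2) powr \<theta>" using that \<theta> by (intro powr_mono2) auto
      also have "\<dots> = q / 2 * h powr \<theta>"
        using h by (simp add: q_def powr_divide powr_diff)
      finally show ?thesis using D0 mult_left_mono[of "x powr \<theta>" "q / 2 * h powr \<theta>" D] by simp
    qed
    have 1: "\<bar>(\<Sum>l=i..<l. X l (Suc l)) - X i l\<bar> \<le> D * q / 2 * h powr \<theta>"
      using less.hyps[of l i] l less.prems half[of "a l - a i"] le[of i l]
      by (force simp: D_def q_def)
    have 2: "\<bar>(\<Sum>l=Suc l..<k. X l (Suc l)) - X (Suc l) k\<bar> \<le> D * q / 2 * h powr \<theta>"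
      using less.hyps[of k "Suc l"] l less.prems half[of "a k - a (Suc l)"] le[of "Suc l" k]
      by (force simp: D_def q_def h_def field_simps)
    have 3: "\<bar>X i k - X i l - X l k\<bar> \<le> C * h powr \<theta>"
      unfolding h_def by (rule defect) (use l less.prems in auto)
    have "\<bar>X l k - X l (Suc l) - X (Suc l) k\<bar> \<le> C * (a k - a l) powr \<theta>"
      by (rule defect) (use l less.prems in auto)
    also have "\<dots> \<le> C * h powr \<theta>"
      using le[of i l] le[of l k] l less.prems \<theta> C unfolding h_def
      by (intro mult_left_mono powr_mono2) auto
    finally have 4: "\<bar>X l k - X l (Suc l) - X (Suc l) k\<bar> \<le> C * h powr \<theta>" .
    have "(\<Sum>l=i..<k. X l (Suc l)) = (\<Sum>l=i..<l. X l (Suc l)) + (\<Sum>l=l..<k. X l (Suc l))"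
      using l by (simp add: sum.atLeastLessThan_concat)
    also have "(\<Sum>l=l..<k. X l (Suc l)) = X l (Suc l) + (\<Sum>l=Suc l..<k. X l (Suc l))"
      using l by (simp add: sum.atLeast_Suc_lessThan)
    finally have "\<bar>(\<Sum>l=i..<k. X l (Suc l)) - X i k\<bar> \<le>
        D * q / 2 * h powr \<theta> + D * q / 2 * h powr \<theta> + C * h powr \<theta> + C * h powr \<theta>"
      using 1 2 3 4 by linarith
    also have "\<dots> = (D * q + 2 * C) * h powr \<theta>" by (simp add: algebra_simps)
    finally show ?thesis unfolding D by (simp add: D_def q_def h_def)
  qed
qed

lemma powr_le_scale:
  fixes h :: real
  assumes "0 \<le> h" "h \<le> T" "c \<le> b"
  shows "h powr b \<le> T powr (b - c) * h powr c"
proof (cases "h = 0")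
  case False
  have "h powr b = h powr (b - c) * h powr c" using False assms by (simp add: powr_add[symmetric])
  also have "\<dots> \<le> T powr (b - c) * h powr c"
    using assms by (intro mult_right_mono powr_mono2) auto
  finally show ?thesis .
qed simp

section \<open>Step paths\<close>

text \<open>
  The step path that takes the value \<open>\<omega> (a (k + 1))\<close> on \<open>[a k, a (k + 1))\<close>, up to the index \<open>l\<close>, and
  is constant from \<open>a l\<close> on. Each step is a single vertical perturbation.
\<close>

primrec step_path ::
  "real \<Rightarrow> (real \<Rightarrow> 'v::real_normed_vector) \<Rightarrow> (nat \<Rightarrow> real) \<Rightarrow> nat \<Rightarrow> real \<Rightarrow> 'v" where
  "step_path T \<omega> a 0 = restrict (\<lambda>_. \<omega> (a 0)) {0..T}"
| "step_path T \<omega> a (Suc l) = bump T (a l) (\<omega> (a (Suc l)) - \<omega> (a l)) (step_path T \<omega> a l)"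

lemma step_path_cong:
  "(\<And>k. k \<le> l \<Longrightarrow> a k = b k) \<Longrightarrow> step_path T \<omega> a l = step_path T \<omega> b l"
  by (induction l) simp_all

definition chain :: "real \<Rightarrow> (nat \<Rightarrow> real) \<Rightarrow> nat \<Rightarrow> bool" where
  "chain T a M \<longleftrightarrow> (\<forall>k<M. a k \<le> a (Suc k)) \<and> (\<forall>k\<le>M. a k \<in> {0..T})"

lemma chain_le: "chain T a M \<Longrightarrow> i \<le> j \<Longrightarrow> j \<le> M \<Longrightarrow> a i \<le> a j"
  using weak_grid_le[of M a i j] by (simp add: chain_def)

lemma chain_in: "chain T a M \<Longrightarrow> k \<le> M \<Longrightarrow> a k \<in> {0..T}"
  by (simp add: chain_def)

lemma step_path_after:
  assumes "chain T a M" "l \<le> M" "s \<in> {a l..T}"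
  shows "step_path T \<omega> a l s = \<omega> (a l)"
  using assms(2,3)
proof (induction l)
  case 0
  then show ?case using chain_in[OF assms(1), of 0] by simp
next
  case (Suc l)
  have "a l \<le> a (Suc l)" by (rule chain_le[OF assms(1)]) (use Suc in auto)
  then show ?case using Suc chain_in[OF assms(1), of l] by (simp add: bump_def)
qed

lemma step_path_stable:
  assumes "chain T a M" "k \<le> l" "l \<le> M" "s \<in> {0..T}" "s < a k"
  shows "step_path T \<omega> a l s = step_path T \<omega> a k s"
  using assms(2,3)
proof (induction l rule: dec_induct)
  case (step n)
  have "a k \<le> a n" by (rule chain_le[OF assms(1)]) (use step in auto)
  then show ?case using step assms(4,5) by (simp add: bump_def)
qed simp

lemma step_path_on:
  assumes "chain T a M" "k < l" "l \<le> M" "s \<in> {0..T}" "a k \<le> s" "s < a (Suc k)"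
  shows "step_path T \<omega> a l s = \<omega> (a (Suc k))"
proof -
  have "step_path T \<omega> a l s = step_path T \<omega> a (Suc k) s"
    by (rule step_path_stable[OF assms(1)]) (use assms in auto)
  also have "\<dots> = \<omega> (a (Suc k))"
    using step_path_after[OF assms(1), of k s \<omega>] assms by (simp add: bump_def)
  finally show ?thesis .
qed

lemma step_path_Lam:
  assumes "chain T a M" "l \<le> M" "0 \<le> T"
  shows "(a l, step_path T \<omega> a l) \<in> Lam T"
  using assms(2)
proof (induction l)
  case 0
  have "cadlag T (restrict (\<lambda>_. \<omega> (a 0)) {0..T})"
    by (rule cadlag_cong[OF cadlag_const]) simp
  then show ?case
    using chain_in[OF assms(1), of 0] unfolding Lam_iff[OF assms(3)] by auto
next
  case (Suc l)
  have "(a l, step_path T \<omega> a (Suc l)) \<in> Lam T" using Suc Lam_bump[OF _ assms(3)] by simp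
  moreover have "a l \<le> a (Suc l)" by (rule chain_le[OF assms(1)]) (use Suc in auto)
  ultimately show ?case using Lam_later[OF _ assms(3)] chain_in[OF assms(1) Suc.prems] by auto
qed

lemma step_path_value:
  assumes "chain T a M" "i \<le> l" "l \<le> M" "s \<in> {0..T}" "a i \<le> s"
  shows "\<exists>k\<in>{i..l}. step_path T \<omega> a l s = \<omega> (a k)"
proof (cases "s < a l")
  case True
  obtain k where "i \<le> k" "k < l" "a k \<le> s" "s < a (Suc k)"
    by (rule crossing_index[OF assms(2,5) True])
  then show ?thesis using step_path_on[OF assms(1) _ assms(3,4)]
    by (intro bexI[of _ "Suc k"]) auto
next
  case False
  then show ?thesis using step_path_after[OF assms(1,3), of s \<omega>] assms by (intro bexI[of _ l]) auto
qed

lemma step_path_range: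
  assumes "chain T a M" "l \<le> M"
  shows "step_path T \<omega> a l ` {0..T} \<subseteq> \<omega> ` {0..T}"
proof safe
  fix s assume s: "s \<in> {0..T}"
  show "step_path T \<omega> a l s \<in> \<omega> ` {0..T}"
  proof (cases "a 0 \<le> s")
    case True
    then obtain k where "k \<in> {0..l}" "step_path T \<omega> a l s = \<omega> (a k)"
      using step_path_value[OF assms(1) _ assms(2) s] by blast
    then show ?thesis using chain_in[OF assms(1), of k] assms(2) by auto
  next
    case False
    then have "step_path T \<omega> a l s = \<omega> (a 0)"
      using step_path_stable[OF assms(1) _ assms(2) s, of 0] s by simp
    then show ?thesis using chain_in[OF assms(1), of 0] by auto
  qed
qed

section \<open>Expansions along step paths of a Hoelder path\<close>

definition grid :: "real \<Rightarrow> (nat \<Rightarrow> real) \<Rightarrow> nat \<Rightarrow> bool" where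
  "grid T a M \<longleftrightarrow> (\<forall>k<M. a k < a (Suc k)) \<and> (\<forall>k\<le>M. a k \<in> {0..T})"

lemma grid_chain: "grid T a M \<Longrightarrow> chain T a M"
  by (auto simp: grid_def chain_def less_imp_le)

lemma grid_less: "grid T a M \<Longrightarrow> i < j \<Longrightarrow> j \<le> M \<Longrightarrow> a i < a j"
  using strict_grid_less[of M a i j] by (simp add: grid_def)

text \<open>
  The numerical condition on \<open>\<alpha>\<close> makes \<open>5/4 * \<alpha> + \<alpha> > 1\<close>, where \<open>5/4 * \<alpha>\<close> is the order of the
  remainder in the first order expansion below.
\<close>

locale holder_path =
  fixes T H \<alpha> :: real and \<omega> :: "real \<Rightarrow> real^'d::finite"
  assumes T: "0 < T" and H: "0 \<le> H" and \<alpha>: "4/9 < \<alpha>" "\<alpha> < 1/2"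
    and holder: "s \<in> {0..T} \<Longrightarrow> t \<in> {0..T} \<Longrightarrow> norm (\<omega> t - \<omega> s) \<le> H * \<bar>t - s\<bar> powr \<alpha>"
begin

lemma T0: "0 \<le> T" using T by simp

lemma holder_le:
  assumes "s \<in> {0..T}" "t \<in> {0..T}" "\<bar>t - s\<bar> \<le> r"
  shows "norm (\<omega> t - \<omega> s) \<le> H * r powr \<alpha>"
proof -
  have "H * \<bar>t - s\<bar> powr \<alpha> \<le> H * r powr \<alpha>"
    using assms(3) H \<alpha> by (intro mult_left_mono powr_mono2) auto
  with holder[OF assms(1,2)] show ?thesis by simp
qed

abbreviation W where "W \<equiv> \<omega> ` {0..T}"

abbreviation step_err where
  "step_err K h \<equiv> K * (H * h powr \<alpha>)\<^sup>2 + (K * (H * h powr \<alpha>) + K * h) * (H * h powr \<alpha>)"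

abbreviation S where "S \<equiv> step_path T \<omega>"

lemma sup_dist_step_path:
  assumes "chain T a M" "i \<le> l" "l \<le> M"
  shows "sup_dist T (S a l) (S a i) \<le> H * (a l - a i) powr \<alpha>"
proof (rule sup_dist_le[OF T0])
  fix s assume s: "s \<in> {0..T}"
  show "norm (S a l s - S a i s) \<le> H * (a l - a i) powr \<alpha>"
  proof (cases "s < a i")
    case True
    then show ?thesis using step_path_stable[OF assms s True, of \<omega>] H by simp
  next
    case False
    then obtain k where k: "k \<in> {i..l}" "S a l s = \<omega> (a k)"
      using step_path_value[OF assms s, of \<omega>] by auto
    have i: "S a i s = \<omega> (a i)"
      using step_path_after[OF assms(1), of i s \<omega>] assms False s by auto
    have "\<bar>a k - a i\<bar> \<le> a l - a i"
      using chain_le[OF assms(1), of i k] chain_le[OF assms(1), of k l] k assms by auto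
    then show ?thesis unfolding i k(2)
      using chain_in[OF assms(1)] k assms by (intro holder_le) auto
  qed
qed

context
  fixes G :: "('d, 'v::euclidean_space) functional" and K :: real
  assumes tame: "tame T W K G" "tame T W K (vderiv T G)" and dif: "vert_differentiable T G"
begin

lemma K0: "0 \<le> K" using tame(1) by (simp add: tame_def)

lemma tame_step_diff:
  fixes G' :: "('d, 'w::euclidean_space) functional"
  assumes t: "tame T W K G'" and c: "chain T a M" and il: "i \<le> l" "l \<le> M"
  shows "norm (G' (a l, S a l) - G' (a i, S a i)) \<le>
    K * (H * (a l - a i) powr \<alpha>) + K * (a l - a i)"
proof -
  have Li: "(a i, S a i) \<in> Lam T" by (rule step_path_Lam[OF c _ T0]) (use il in simp)
  have ail: "a i \<le> a l" "a l \<le> T" using chain_le[OF c il] chain_in[OF c il(2)] by auto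
  have Lil: "(a l, S a i) \<in> Lam T" by (rule Lam_later[OF Li T0 ail])
  have "norm (G' (a l, S a l) - G' (a l, S a i)) \<le> K * sup_dist T (S a l) (S a i)"
    using path_LipD[OF _ step_path_Lam[OF c il(2) T0] Lil, of K G'] t by (simp add: tame_def)
  also have "\<dots> \<le> K * (H * (a l - a i) powr \<alpha>)"
    by (rule mult_left_mono[OF sup_dist_step_path[OF c il] K0])
  finally have 1: "norm (G' (a l, S a l) - G' (a l, S a i)) \<le> K * (H * (a l - a i) powr \<alpha>)" .
  have 2: "norm (G' (a l, S a i) - G' (a i, S a i)) \<le> K * (a l - a i)"
    by (rule tame_time[OF t Li ail step_path_range[OF c]]) (use il in simp)
  show ?thesis
    using norm_triangle_ineq[of "G' (a l, S a l) - G' (a l, S a i)" "G' (a l, S a i) - G' (a i, S a i)"] 1 2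
    by simp
qed

text \<open>
  Along the step path, \<open>G\<close> moves horizontally, with total cost \<open>K * h\<close>, and vertically. A vertical step
  costs a second order error and the replacement of the derivative at the current point by that at the
  starting point, both \<open>O(h powr (2 * \<alpha>))\<close>.
\<close>

lemma expansion_chain:
  assumes c: "chain T a M" and iM: "i \<le> M" and h: "h = a M - a i"
  shows "norm (G (a M, S a M) - G (a i, S a i) - vlin (vderiv T G (a i, S a i)) (\<omega> (a M) - \<omega> (a i)))
    \<le> K * h + (M - i) * step_err K h"
proof -
  define R where "R = step_err K h"
  let ?g = "\<lambda>l. G (a l, S a l)" and ?D = "\<lambda>l. vderiv T G (a l, S a l)"
  have step: "norm (?g (Suc l) - ?g l - vlin (?D i) (\<omega> (a (Suc l)) - \<omega> (a l))) \<le> K * (a (Suc l) - a l) + R"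
    if l: "i \<le> l" "Suc l \<le> M" for l
  proof -
    define \<delta> where "\<delta> = \<omega> (a (Suc l)) - \<omega> (a l)"
    have ord: "a i \<le> a l" "a l \<le> a (Suc l)" "a (Suc l) \<le> a M"
      using chain_le[OF c] l by auto
    have h0: "0 \<le> h" using ord h by simp
    have n\<delta>: "norm \<delta> \<le> H * h powr \<alpha>"
      unfolding \<delta>_def using chain_in[OF c] l ord h by (intro holder_le) auto
    have Ll: "(a l, S a l) \<in> Lam T" by (rule step_path_Lam[OF c _ T0]) (use l in simp)
    have Lb: "(a l, S a (Suc l)) \<in> Lam T" using Lam_bump[OF Ll T0] by simp
    have 1: "norm (?g (Suc l) - G (a l, S a (Suc l))) \<le> K * (a (Suc l) - a l)"
      by (rule tame_time[OF tame(1) Lb ord(2) _ step_path_range[OF c l(2)]])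
        (use chain_in[OF c l(2)] in simp)
    have "norm (G (a l, S a (Suc l)) - ?g l - vlin (?D l) \<delta>) \<le> K * (norm \<delta>)\<^sup>2"
      using vertical_expansion[OF dif Ll T0 K0, of \<delta>] tame(2) path_LipD[of T K "vderiv T G"]
      by (simp add: tame_def \<delta>_def)
    also have "\<dots> \<le> K * (H * h powr \<alpha>)\<^sup>2" using n\<delta> K0 by (intro mult_left_mono power_mono) auto
    finally have 2: "norm (G (a l, S a (Suc l)) - ?g l - vlin (?D l) \<delta>) \<le> K * (H * h powr \<alpha>)\<^sup>2" .
    have "norm (?D l - ?D i) \<le> K * (H * (a l - a i) powr \<alpha>) + K * (a l - a i)"
      by (rule tame_step_diff[OF tame(2) c l(1)]) (use l in simp)
    also have "\<dots> \<le> K * (H * h powr \<alpha>) + K * h"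
      using ord h H K0 \<alpha> by (intro add_mono mult_left_mono powr_mono2) auto
    finally have "norm (?D l - ?D i) \<le> K * (H * h powr \<alpha>) + K * h" .
    then have "norm (?D l - ?D i) * norm \<delta> \<le> (K * (H * h powr \<alpha>) + K * h) * (H * h powr \<alpha>)"
      using n\<delta> K0 H h0 by (intro mult_mono) auto
    then have 3: "norm (vlin (?D l) \<delta> - vlin (?D i) \<delta>) \<le> (K * (H * h powr \<alpha>) + K * h) * (H * h powr \<alpha>)"
      using norm_vlin_le[of "?D l - ?D i" \<delta>] by (simp add: vlin_diff_left)
    have "?g (Suc l) - ?g l - vlin (?D i) \<delta> = (?g (Suc l) - G (a l, S a (Suc l))) +
        (G (a l, S a (Suc l)) - ?g l - vlin (?D l) \<delta>) + (vlin (?D l) \<delta> - vlin (?D i) \<delta>)" by simp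
    also have "norm \<dots> \<le> K * (a (Suc l) - a l) + K * (H * h powr \<alpha>)\<^sup>2 +
        (K * (H * h powr \<alpha>) + K * h) * (H * h powr \<alpha>)"
      by (intro norm_triangle_le add_mono 1 2 3 order_refl)
    finally show ?thesis by (simp add: R_def \<delta>_def)
  qed
  have "norm (?g (i + n) - ?g i - vlin (?D i) (\<omega> (a (i + n)) - \<omega> (a i))) \<le> K * (a (i + n) - a i) + n * R"
    if "i + n \<le> M" for n
    using that
  proof (induction n)
    case 0
    then show ?case by (simp add: linear_0[OF vlin_linear])
  next
    case (Suc n)
    have e: "\<omega> (a (i + Suc n)) - \<omega> (a i) = (\<omega> (a (i + n)) - \<omega> (a i)) + (\<omega> (a (Suc (i + n))) - \<omega> (a (i + n)))"
      by simp
    have "?g (i + Suc n) - ?g i - vlin (?D i) (\<omega> (a (i + Suc n)) - \<omega> (a i)) =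
        (?g (i + n) - ?g i - vlin (?D i) (\<omega> (a (i + n)) - \<omega> (a i))) +
        (?g (Suc (i + n)) - ?g (i + n) - vlin (?D i) (\<omega> (a (Suc (i + n))) - \<omega> (a (i + n))))"
      unfolding e vlin_add_right by simp
    also have "norm \<dots> \<le> (K * (a (i + n) - a i) + n * R) + (K * (a (Suc (i + n)) - a (i + n)) + R)"
      by (rule norm_triangle_le[OF add_mono[OF Suc.IH step]]) (use Suc.prems in auto)
    also have "\<dots> = K * (a (i + Suc n) - a i) + Suc n * R" by (simp add: algebra_simps)
    finally show ?case .
  qed
  from this[of "M - i"] iM show ?thesis by (simp add: R_def h)
qed

text \<open>
  The grid may be refined arbitrarily, so the errors of its individual steps cannot be summed.
  Instead at most \<open>N\<close> grid points are kept, one for each of the \<open>N\<close> intervals of length \<open>h / N\<close>: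
  this moves the path by \<open>H (h / N)\<^sup>\<alpha>\<close> in sup norm, which the Lipschitz property absorbs.
\<close>

lemma expansion_coarsened:
  assumes g: "grid T a M" and ij: "i \<le> j" "j \<le> M" and h: "h = a j - a i" and N: "0 < N"
  shows "norm (G (a j, S a j) - G (a i, S a i) - vlin (vderiv T G (a i, S a i)) (\<omega> (a j) - \<omega> (a i)))
    \<le> K * (H * (h / real N) powr \<alpha>) + K * h +
      N * step_err K h"
proof -
  note c = grid_chain[OF g]
  have h0: "0 \<le> h" using chain_le[OF c ij] h by simp
  \<comment> \<open>\<open>\<rho> k\<close> is the last grid index up to the \<open>k\<close>-th of \<open>N\<close> equidistant times; the coarse chain \<open>b\<close>
     follows the grid up to \<open>i\<close> and the selected points from there on.\<close>
  define A where "A k = {l \<in> {i..j}. a l \<le> a i + k * (h / N)}" for k :: nat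
  define \<rho> where "\<rho> k = Max (A k)" for k
  have A: "finite (A k)" "i \<in> A k" for k using ij h0 by (auto simp: A_def)
  have \<rho>A: "\<rho> k \<in> A k" for k unfolding \<rho>_def by (rule Max_in) (use A[of k] in auto)
  have \<rho>max: "l \<in> A k \<Longrightarrow> l \<le> \<rho> k" for l k unfolding \<rho>_def using A by simp
  have \<rho>0: "\<rho> 0 = i"
  proof (rule ccontr)
    assume "\<rho> 0 \<noteq> i"
    then have "i < \<rho> 0" using \<rho>A[of 0] by (auto simp: A_def)
    then have "a i < a (\<rho> 0)" using grid_less[OF g] \<rho>A[of 0] ij by (auto simp: A_def)
    then show False using \<rho>A[of 0] by (auto simp: A_def)
  qed
  have \<rho>N: "\<rho> N = j"
  proof -
    have "j \<in> A N" using N ij h by (simp add: A_def)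
    then show ?thesis using \<rho>max[of j N] \<rho>A[of N] by (auto simp: A_def)
  qed
  have \<rho>mono: "\<rho> k \<le> \<rho> (Suc k)" for k
  proof (rule \<rho>max)
    have "real k * (h / N) \<le> real (Suc k) * (h / N)" using h0 by (intro mult_right_mono) auto
    then show "\<rho> k \<in> A (Suc k)" using \<rho>A[of k] by (auto simp: A_def)
  qed
  have \<rho>ij: "\<rho> k \<in> {i..j}" for k using \<rho>A[of k] by (auto simp: A_def)
  define b where "b k = (if k \<le> i then a k else a (\<rho> (k - i)))" for k
  have bi: "b (i + k) = a (\<rho> k)" for k by (cases k) (auto simp: b_def \<rho>0)
  have cb: "chain T b (i + N)"
    unfolding chain_def
  proof safe
    fix k assume "k < i + N"
    show "b k \<le> b (Suc k)"
    proof (cases "k < i")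
      case True
      then show ?thesis using chain_le[OF c, of k "Suc k"] ij by (simp add: b_def)
    next
      case False
      then obtain n where n: "k = i + n" by (metis le_iff_add not_le)
      show ?thesis using chain_le[OF c \<rho>mono[of n]] \<rho>ij[of "Suc n"] ij bi[of n] bi[of "Suc n"]
        by (simp add: n)
    qed
  next
    fix k assume "k \<le> i + N"
    show "b k \<in> {0..T}"
      unfolding b_def using chain_in[OF c, of k] chain_in[OF c, of "\<rho> (k - i)"] \<rho>ij[of "k - i"] ij by auto
  qed
  have Si: "S b i = S a i" by (rule step_path_cong) (simp add: b_def)
  have bi0: "b i = a i" and bN: "b (i + N) = a j" using bi[of 0] bi[of N] \<rho>0 \<rho>N by auto
  have dist: "sup_dist T (S a j) (S b (i + N)) \<le> H * (h / N) powr \<alpha>"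
  proof (rule sup_dist_le[OF T0])
    fix s assume s: "s \<in> {0..T}"
    consider "s < a i" | "a i \<le> s" "s < a j" | "a j \<le> s" by linarith
    then show "norm (S a j s - S b (i + N) s) \<le> H * (h / N) powr \<alpha>"
    proof cases
      case 1
      have "S b (i + N) s = S b i s" by (rule step_path_stable[OF cb]) (use s 1 bi0 in auto)
      moreover have "S a j s = S a i s" by (rule step_path_stable[OF c ij s 1])
      ultimately show ?thesis using H Si by simp
    next
      case 2
      obtain l where l: "i \<le> l" "l < j" "a l \<le> s" "s < a (Suc l)"
        by (rule crossing_index[OF ij(1) 2])
      have "\<exists>k. i \<le> k \<and> k < i + N \<and> b k \<le> s \<and> s < b (Suc k)"
        by (rule crossing_index[of i "i + N" b s]) (use 2 bi0 bN in auto)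
      then obtain k where k: "k < N" "a (\<rho> k) \<le> s" "s < a (\<rho> (Suc k))"
        by (metis bi add_Suc_right le_iff_add nat_add_left_cancel_less)
      have "\<rho> k \<le> l"
      proof (rule ccontr)
        assume "\<not> \<rho> k \<le> l"
        then have "a (Suc l) \<le> a (\<rho> k)" using chain_le[OF c, of "Suc l" "\<rho> k"] \<rho>ij[of k] ij by auto
        then show False using k l by simp
      qed
      then have "Suc l \<notin> A k" using \<rho>max[of "Suc l" k] by auto
      then have lo: "a i + k * (h / N) < a (Suc l)" using l by (auto simp: A_def)
      have "l < \<rho> (Suc k)"
      proof (rule ccontr)
        assume "\<not> l < \<rho> (Suc k)"
        then have "a (\<rho> (Suc k)) \<le> a l" using chain_le[OF c, of "\<rho> (Suc k)" l] l ij by auto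
        then show False using k l by simp
      qed
      then have le: "a (Suc l) \<le> a (\<rho> (Suc k))"
        using chain_le[OF c, of "Suc l" "\<rho> (Suc k)"] \<rho>ij[of "Suc k"] ij by auto
      have "a (\<rho> (Suc k)) \<le> a i + Suc k * (h / N)" using \<rho>A[of "Suc k"] by (simp add: A_def)
      moreover have "Suc k * (h / N) = k * (h / N) + h / N" by (simp only: of_nat_Suc distrib_right mult_1_left)
      ultimately have "\<bar>a (Suc l) - a (\<rho> (Suc k))\<bar> \<le> h / N" using lo le by linarith
      moreover have "S a j s = \<omega> (a (Suc l))" by (rule step_path_on[OF c l(2) ij(2) s l(3,4)])
      moreover have "S b (i + N) s = \<omega> (b (Suc (i + k)))"
        by (rule step_path_on[OF cb _ _ s]) (use k bi[of k] bi[of "Suc k"] in auto)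
      ultimately show ?thesis
        using chain_in[OF c, of "Suc l"] chain_in[OF c, of "\<rho> (Suc k)"] \<rho>ij[of "Suc k"] ij l bi[of "Suc k"]
        by (auto intro!: holder_le simp del: atLeastAtMost_iff simp: atLeastAtMost_iff[where 'a = nat])
    next
      case 3
      have "S b (i + N) s = \<omega> (b (i + N))" by (rule step_path_after[OF cb]) (use s 3 bN in auto)
      moreover have "S a j s = \<omega> (a j)" by (rule step_path_after[OF c ij(2)]) (use s 3 in auto)
      ultimately show ?thesis using H bN by simp
    qed
  qed
  have "norm (G (a j, S a j) - G (a j, S b (i + N))) \<le> K * sup_dist T (S a j) (S b (i + N))"
    using path_LipD[OF _ step_path_Lam[OF c ij(2) T0], of K G "S b (i + N)"]
      step_path_Lam[OF cb order_refl T0, of \<omega>] tame(1)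
    unfolding bN by (simp add: tame_def)
  also have "\<dots> \<le> K * (H * (h / N) powr \<alpha>)" by (rule mult_left_mono[OF dist K0])
  finally have 1: "norm (G (a j, S a j) - G (a j, S b (i + N))) \<le> K * (H * (h / N) powr \<alpha>)" .
  have 2: "norm (G (a j, S b (i + N)) - G (a i, S a i) - vlin (vderiv T G (a i, S a i)) (\<omega> (a j) - \<omega> (a i)))
    \<le> K * h + N * step_err K h"
    using expansion_chain[OF cb, of i h] by (simp add: bN bi0 Si h)
  have "G (a j, S a j) - G (a i, S a i) - vlin (vderiv T G (a i, S a i)) (\<omega> (a j) - \<omega> (a i)) =
    (G (a j, S a j) - G (a j, S b (i + N))) +
    (G (a j, S b (i + N)) - G (a i, S a i) - vlin (vderiv T G (a i, S a i)) (\<omega> (a j) - \<omega> (a i)))" by simp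
  also have "norm \<dots> \<le> K * (H * (h / N) powr \<alpha>) +
    (K * h + N * step_err K h)"
    by (rule norm_triangle_le[OF add_mono[OF 1 2]])
  finally show ?thesis by simp
qed

text \<open>
  With \<open>N\<close> about \<open>h powr (- 1/4)\<close> the two competing errors \<open>(h / N) powr \<alpha>\<close> and \<open>N * h powr (2 * \<alpha>)\<close> are
  of orders \<open>5/4 * \<alpha>\<close> and \<open>2 * \<alpha> - 1/4\<close>, and the second order is the larger one.
\<close>

lemma first_order_expansion:
  "\<exists>C\<ge>0. \<forall>a M i j. grid T a M \<longrightarrow> i \<le> j \<longrightarrow> j \<le> M \<longrightarrow>
    norm (G (a j, S a j) - G (a i, S a i) - vlin (vderiv T G (a i, S a i)) (\<omega> (a j) - \<omega> (a i)))
    \<le> C * (a j - a i) powr (5/4 * \<alpha>)"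
proof -
  define \<gamma> where "\<gamma> = 5/4 * \<alpha>"
  have \<gamma>: "\<gamma> \<le> 1" "\<gamma> \<le> 2 * \<alpha> - 1/4" using \<alpha> by (auto simp: \<gamma>_def)
  define R0 where "R0 = K * H\<^sup>2 + (K * H + K * T powr (1 - \<alpha>)) * H"
  define C where "C = K * H + K * T powr (1 - \<gamma>) + (T powr (2 * \<alpha> - 1/4 - \<gamma>) + T powr (2 * \<alpha> - \<gamma>)) * R0"
  have R0: "0 \<le> R0" using K0 H by (simp add: R0_def)
  have C0: "0 \<le> C" using K0 H R0 by (simp add: C_def)
  have "norm (G (a j, S a j) - G (a i, S a i) - vlin (vderiv T G (a i, S a i)) (\<omega> (a j) - \<omega> (a i)))
    \<le> C * (a j - a i) powr \<gamma>" if g: "grid T a M" and ij: "i \<le> j" "j \<le> M" for a M i j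
  proof (cases "i = j")
    case True
    then show ?thesis by (simp add: linear_0[OF vlin_linear])
  next
    case False
    define h where "h = a j - a i"
    have h: "0 < h" unfolding h_def using grid_less[OF g, of i j] False ij by simp
    have hT: "h \<le> T" using chain_in[OF grid_chain[OF g]] ij unfolding h_def
      by (smt (verit, best) atLeastAtMost_iff order_trans)
    define N where "N = nat \<lceil>h powr (- (1/4))\<rceil>"
    have Np: "0 < N" using h by (simp add: N_def)
    have N1: "h powr (- (1/4)) \<le> N" unfolding N_def by linarith
    have N2: "N \<le> h powr (- (1/4)) + 1" unfolding N_def using ceiling_correct[of "h powr (- (1/4))"] 
      by (smt (verit) of_nat_nat powr_ge_zero zero_le_ceiling)
    have "h / N \<le> h / h powr (- (1/4))" using N1 h Np by (intro divide_left_mono) auto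
    also have "\<dots> = h powr (5/4)" using h powr_add[of h 1 "1/4"] by (simp add: powr_minus divide_simps)
    finally have "(h / N) powr \<alpha> \<le> (h powr (5/4)) powr \<alpha>" using h \<alpha> by (intro powr_mono2) auto
    then have p1: "(h / N) powr \<alpha> \<le> h powr \<gamma>" by (simp add: powr_powr \<gamma>_def)
    have p2: "h \<le> T powr (1 - \<gamma>) * h powr \<gamma>" using powr_le_scale[of h T \<gamma> 1] h hT \<gamma> by simp
    have p3: "h \<le> T powr (1 - \<alpha>) * h powr \<alpha>" using powr_le_scale[of h T \<alpha> 1] h hT \<alpha> by simp
    have "step_err K h \<le>
        K * (H * h powr \<alpha>)\<^sup>2 + (K * (H * h powr \<alpha>) + K * (T powr (1 - \<alpha>) * h powr \<alpha>)) * (H * h powr \<alpha>)"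
      using p3 K0 H by (intro add_mono mult_right_mono mult_left_mono) auto
    also have "\<dots> = R0 * (h powr \<alpha>)\<^sup>2"
      by (simp add: R0_def power2_eq_square algebra_simps)
    also have "(h powr \<alpha>)\<^sup>2 = h powr (2 * \<alpha>)" using h by (simp add: power2_eq_square powr_add[symmetric])
    finally have R: "step_err K h \<le> R0 * h powr (2 * \<alpha>)" .
    have "N * step_err K h
        \<le> (h powr (- (1/4)) + 1) * (R0 * h powr (2 * \<alpha>))"
      using N2 R K0 H h by (intro mult_mono) auto
    also have "\<dots> = (h powr (2 * \<alpha> - 1/4) + h powr (2 * \<alpha>)) * R0"
      using powr_add[of h "- (1/4)" "2 * \<alpha>"] by (simp add: algebra_simps)
    also have "\<dots> \<le> (T powr (2 * \<alpha> - 1/4 - \<gamma>) * h powr \<gamma> + T powr (2 * \<alpha> - \<gamma>) * h powr \<gamma>) * R0"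
      using h hT \<gamma> by (intro mult_right_mono add_mono powr_le_scale R0) auto
    finally have p4: "N * step_err K h
        \<le> (T powr (2 * \<alpha> - 1/4 - \<gamma>) * h powr \<gamma> + T powr (2 * \<alpha> - \<gamma>) * h powr \<gamma>) * R0" .
    have "K * (H * (h / N) powr \<alpha>) \<le> K * (H * h powr \<gamma>)"
      using p1 K0 H by (intro mult_left_mono) auto
    moreover have "K * h \<le> K * (T powr (1 - \<gamma>) * h powr \<gamma>)" using p2 K0 by (intro mult_left_mono)
    ultimately have "K * (H * (h / N) powr \<alpha>) + K * h +
      N * step_err K h \<le>
      K * (H * h powr \<gamma>) + K * (T powr (1 - \<gamma>) * h powr \<gamma>) +
      (T powr (2 * \<alpha> - 1/4 - \<gamma>) * h powr \<gamma> + T powr (2 * \<alpha> - \<gamma>) * h powr \<gamma>) * R0"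
      using p4 by linarith
    also have "\<dots> = C * h powr \<gamma>" by (simp add: C_def algebra_simps)
    finally show ?thesis
      using expansion_coarsened[OF g ij h_def Np] by (simp add: h_def)
  qed
  with C0 show ?thesis unfolding \<gamma>_def by blast
qed

end

text \<open>
  The compensated increment. Its defect is of order \<open>9/4 * \<alpha> > 1\<close> by the first order expansion of
  the first derivative; the symmetry of the second derivative makes the mixed terms match.
\<close>

definition Xi :: "('d, real) functional \<Rightarrow> (nat \<Rightarrow> real) \<Rightarrow> nat \<Rightarrow> nat \<Rightarrow> real" where
  "Xi F a i j = vderiv T F (a i, S a i) \<bullet> (\<omega> (a j) - \<omega> (a i)) +
     1/2 * (vlin (vderiv T (vderiv T F) (a i, S a i)) (\<omega> (a j) - \<omega> (a i)) \<bullet> (\<omega> (a j) - \<omega> (a i)))"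

lemma Xi_sewing:
  fixes F :: "('d, real) functional"
  assumes tame: "tame T W K (vderiv T F)" "tame T W K (vderiv T (vderiv T F))"
    and dif: "vert_differentiable T F" "vert_differentiable T (vderiv T F)"
  shows "\<exists>C\<ge>0. \<forall>a M i k. grid T a M \<longrightarrow> i \<le> k \<longrightarrow> k \<le> M \<longrightarrow>
    \<bar>(\<Sum>l=i..<k. Xi F a l (Suc l)) - Xi F a i k\<bar> \<le> C * (a k - a i) powr (9/4 * \<alpha>)"
proof -
  define \<theta> where "\<theta> = 9/4 * \<alpha>"
  have \<theta>: "1 < \<theta>" "\<theta> \<le> 3 * \<alpha>" using \<alpha> by (auto simp: \<theta>_def)
  let ?\<phi> = "vderiv T F" let ?\<psi> = "vderiv T ?\<phi>"
  have K: "0 \<le> K" using tame(1) by (simp add: tame_def)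
  from first_order_expansion[OF tame dif(2)] obtain C1 where C1: "0 \<le> C1"
    "\<And>a M i j. grid T a M \<Longrightarrow> i \<le> j \<Longrightarrow> j \<le> M \<Longrightarrow>
      norm (?\<phi> (a j, S a j) - ?\<phi> (a i, S a i) - vlin (?\<psi> (a i, S a i)) (\<omega> (a j) - \<omega> (a i)))
      \<le> C1 * (a j - a i) powr (5/4 * \<alpha>)" by blast
  define C where "C = C1 * H + 1/2 * (K * H + K * T powr (1 - \<alpha>)) * H\<^sup>2 * T powr (3 * \<alpha> - \<theta>)"
  have C0: "0 \<le> C" using C1 H K by (simp add: C_def)
  have defect: "\<bar>Xi F a i k - Xi F a i j - Xi F a j k\<bar> \<le> C * (a k - a i) powr \<theta>"
    if g: "grid T a M" and ij: "i \<le> j" "j \<le> k" "k \<le> M" for a M i j k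
  proof -
    note c = grid_chain[OF g]
    define h where "h = a k - a i"
    define x where "x = \<omega> (a j) - \<omega> (a i)"
    define y where "y = \<omega> (a k) - \<omega> (a j)"
    define P where "P = ?\<psi> (a i, S a i)"
    define P' where "P' = ?\<psi> (a j, S a j)"
    define p where "p = ?\<phi> (a i, S a i)"
    define p' where "p' = ?\<phi> (a j, S a j)"
    have ord: "a i \<le> a j" "a j \<le> a k" using chain_le[OF c] ij by auto
    have in0: "a i \<in> {0..T}" "a j \<in> {0..T}" "a k \<in> {0..T}" using chain_in[OF c] ij by auto
    have h0: "0 \<le> h" "h \<le> T" using ord in0 by (auto simp: h_def)
    have ny: "norm y \<le> H * h powr \<alpha>" unfolding y_def
      using in0 ord h_def by (intro holder_le) auto
    have Li: "(a i, S a i) \<in> Lam T" by (rule step_path_Lam[OF c _ T0]) (use ij in simp)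
    have sym: "vlin P y \<bullet> x = vlin P x \<bullet> y"
      unfolding P_def by (rule vderiv2_symmetric[OF T0 K dif _ Li]) (use tame in \<open>simp add: tame_def\<close>)
    have xy: "\<omega> (a k) - \<omega> (a i) = x + y" by (simp add: x_def y_def)
    have "Xi F a i k - Xi F a i j - Xi F a j k = - ((p' - p - vlin P x) \<bullet> y) - 1/2 * (vlin (P' - P) y \<bullet> y)"
      unfolding Xi_def xy x_def[symmetric] y_def[symmetric] P_def[symmetric] P'_def[symmetric]
        p_def[symmetric] p'_def[symmetric]
      using sym by (simp add: vlin_add_right vlin_diff_left inner_add_left inner_add_right
          inner_diff_left algebra_simps)
    then have eq: "\<bar>Xi F a i k - Xi F a i j - Xi F a j k\<bar> \<le>
        \<bar>(p' - p - vlin P x) \<bullet> y\<bar> + 1/2 * \<bar>vlin (P' - P) y \<bullet> y\<bar>" by linarith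
    have "norm (p' - p - vlin P x) \<le> C1 * (a j - a i) powr (5/4 * \<alpha>)"
      unfolding p_def p'_def P_def x_def by (rule C1(2)[OF g]) (use ij in auto)
    also have "\<dots> \<le> C1 * h powr (5/4 * \<alpha>)"
      using ord \<alpha> C1 by (intro mult_left_mono powr_mono2) (auto simp: h_def)
    finally have "norm (p' - p - vlin P x) * norm y \<le> C1 * h powr (5/4 * \<alpha>) * (H * h powr \<alpha>)"
      using ny C1 by (intro mult_mono) auto
    also have "\<dots> = C1 * H * h powr \<theta>"
      using powr_add[of h "5/4 * \<alpha>" \<alpha>] by (simp add: \<theta>_def field_simps)
    finally have 1: "\<bar>(p' - p - vlin P x) \<bullet> y\<bar> \<le> C1 * H * h powr \<theta>"
      using Cauchy_Schwarz_ineq2[of "p' - p - vlin P x" y] by linarith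
    have "norm (P' - P) \<le> K * (H * (a j - a i) powr \<alpha>) + K * (a j - a i)"
      unfolding P_def P'_def by (rule tame_step_diff[OF tame dif(2) tame(2) c]) (use ij in auto)
    also have "\<dots> \<le> K * (H * h powr \<alpha>) + K * h"
      using ord H K \<alpha> by (intro add_mono mult_left_mono powr_mono2) (auto simp: h_def)
    also have "\<dots> \<le> K * (H * h powr \<alpha>) + K * (T powr (1 - \<alpha>) * h powr \<alpha>)"
      using powr_le_scale[of h T \<alpha> 1] h0 \<alpha> K H by (intro add_mono mult_left_mono) auto
    also have "\<dots> = (K * H + K * T powr (1 - \<alpha>)) * h powr \<alpha>" by (simp add: algebra_simps)
    finally have nP: "norm (P' - P) \<le> (K * H + K * T powr (1 - \<alpha>)) * h powr \<alpha>" .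
    have "\<bar>vlin (P' - P) y \<bullet> y\<bar> \<le> norm (P' - P) * norm y * norm y"
      by (rule order.trans[OF Cauchy_Schwarz_ineq2 mult_right_mono[OF norm_vlin_le norm_ge_zero]])
    also have "\<dots> \<le> ((K * H + K * T powr (1 - \<alpha>)) * h powr \<alpha>) * (H * h powr \<alpha>) * (H * h powr \<alpha>)"
      using nP ny H K by (intro mult_mono) auto
    also have "\<dots> = (K * H + K * T powr (1 - \<alpha>)) * H\<^sup>2 * h powr (3 * \<alpha>)"
      using powr_add[of h \<alpha> "2 * \<alpha>"] powr_add[of h \<alpha> \<alpha>] by (simp add: power2_eq_square)
    also have "\<dots> \<le> (K * H + K * T powr (1 - \<alpha>)) * H\<^sup>2 * (T powr (3 * \<alpha> - \<theta>) * h powr \<theta>)"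
      using powr_le_scale[OF h0 \<theta>(2)] K H by (intro mult_left_mono) auto
    finally have 2: "\<bar>vlin (P' - P) y \<bullet> y\<bar> \<le> (K * H + K * T powr (1 - \<alpha>)) * H\<^sup>2 * (T powr (3 * \<alpha> - \<theta>) * h powr \<theta>)" .
    show ?thesis using eq 1 2 by (simp add: C_def h_def[symmetric] algebra_simps)
  qed
  have "\<bar>(\<Sum>l=i..<k. Xi F a l (Suc l)) - Xi F a i k\<bar> \<le> 2 * C / (1 - 2 powr (1 - \<theta>)) * (a k - a i) powr \<theta>"
    if g: "grid T a M" and ik: "i \<le> k" "k \<le> M" for a M i k
    by (rule discrete_sewing[OF _ \<theta>(1) C0 defect[OF g] ik]) (use g in \<open>simp add: grid_def\<close>)
  moreover have "0 \<le> 2 * C / (1 - 2 powr (1 - \<theta>))"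
    using C0 \<theta>(1) powr_less_mono[of "1 - \<theta>" 0 "2::real"] by simp
  ultimately show ?thesis unfolding \<theta>_def by blast
qed

end

section \<open>Limits along partitions\<close>

definition last_index :: "real list \<Rightarrow> real \<Rightarrow> nat" where
  "last_index p t = Max {l. l < length p \<and> p ! l \<le> t}"

context
  fixes T :: real and p :: "real list"
  assumes p: "is_partition T p"
begin

lemma partition_length: "length p - 1 < length p" "Suc (length p - 1) = length p" "0 < length p - 1"
  using p by (auto simp: is_partition_def)

lemma partition_ends: "p ! 0 = 0" "p ! (length p - 1) = T"
proof -
  have "p \<noteq> []" using p by (auto simp: is_partition_def)
  then show "p ! 0 = 0" "p ! (length p - 1) = T"
    using p by (auto simp: is_partition_def hd_conv_nth[symmetric] last_conv_nth[symmetric] simp del: One_nat_def)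
qed

lemma partition_less: "i < j \<Longrightarrow> j < length p \<Longrightarrow> p ! i < p ! j"
  using p by (auto simp: is_partition_def sorted_wrt_iff_nth_less)

lemma partition_le: "i \<le> j \<Longrightarrow> j < length p \<Longrightarrow> p ! i \<le> p ! j"
  using partition_less[of i j] by (cases "i = j") auto

lemma partition_in: "k < length p \<Longrightarrow> p ! k \<in> {0..T}"
  using partition_le[of 0 k] partition_le[of k "length p - 1"] partition_ends partition_length by auto

lemma partition_grid: "grid T ((!) p) (length p - 1)"
  unfolding grid_def using partition_in partition_less partition_length by auto

lemma partition_step_le_mesh:
  assumes "k < length p - 1"
  shows "p ! Suc k - p ! k \<le> mesh p"
proof -
  have "{p ! Suc i - p ! i | i. i < length p - 1} = (\<lambda>i. p ! Suc i - p ! i) ` {..<length p - 1}"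
    by auto
  then show ?thesis unfolding mesh_def using assms by (intro Max_ge) auto
qed

lemma mesh_pos: "0 < mesh p"
proof -
  have "p ! 0 < p ! Suc 0" by (rule partition_less) (use partition_length in auto)
  with partition_step_le_mesh[OF partition_length(3)] show ?thesis by linarith
qed

context
  fixes t :: real
  assumes t: "t \<in> {0..T}"
begin

lemma last_index_props: "last_index p t < length p" "p ! last_index p t \<le> t"
proof -
  have "last_index p t \<in> {l. l < length p \<and> p ! l \<le> t}"
    unfolding last_index_def
    by (rule Max_in) (use t partition_ends partition_length in \<open>auto intro!: exI[of _ 0]\<close>)
  then show "last_index p t < length p" "p ! last_index p t \<le> t" by auto
qed

lemma last_index_iff: "l < length p \<Longrightarrow> p ! l \<le> t \<longleftrightarrow> l \<le> last_index p t"
proof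
  assume "l < length p" "p ! l \<le> t"
  then show "l \<le> last_index p t" unfolding last_index_def by (intro Max_ge) auto
next
  assume "l < length p" "l \<le> last_index p t"
  then show "p ! l \<le> t" using partition_le[of l "last_index p t"] last_index_props by auto
qed

lemma last_index_le: "last_index p t \<le> length p - 1"
  using last_index_props by simp

lemma last_index_close: "t - p ! last_index p t \<le> mesh p"
proof (cases "last_index p t < length p - 1")
  case True
  then have "\<not> p ! Suc (last_index p t) \<le> t" using last_index_iff[of "Suc (last_index p t)"] by auto
  then show ?thesis using partition_step_le_mesh[OF True] by simp
next
  case False
  then have "last_index p t = length p - 1" using last_index_le by simp
  then show ?thesis using partition_ends t mesh_pos by simp
qed

lemma right_endpoints_eq: "{i. i < length p - 1 \<and> p ! Suc i \<le> t} = {..<last_index p t}"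
proof -
  have "i < length p - 1 \<and> p ! Suc i \<le> t \<longleftrightarrow> i < last_index p t" for i
    using last_index_iff[of "Suc i"] last_index_le partition_length(2) by (cases "i < length p - 1") auto
  then show ?thesis by auto
qed

text \<open>
  Stopping at \<open>t\<close> keeps the intervals before \<open>t\<close>, cuts the one that contains \<open>t\<close>, and collapses the rest.
  If \<open>t\<close> is the last partition point, the last summand is \<open>0\<close>.
\<close>

lemma sum_stopped_partition:
  fixes f :: "nat \<Rightarrow> real \<Rightarrow> real \<Rightarrow> real"
  assumes f: "\<And>i. f i t t = 0"
  shows "(\<Sum>i<length p - 1. f i (min (p ! i) t) (min (p ! Suc i) t)) =
    (\<Sum>i<last_index p t. f i (p ! i) (p ! Suc i)) + f (last_index p t) (p ! last_index p t) t"
proof -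
  let ?L = "last_index p t" and ?m = "length p - 1"
  let ?f = "\<lambda>i. f i (min (p ! i) t) (min (p ! Suc i) t)"
  have "(\<Sum>i<?m. ?f i) = (\<Sum>i<?L. ?f i) + (\<Sum>i=?L..<?m. ?f i)"
    using sum.atLeastLessThan_concat[of 0 ?L ?m ?f] last_index_le by (simp add: lessThan_atLeast0)
  moreover have "(\<Sum>i<?L. ?f i) = (\<Sum>i<?L. f i (p ! i) (p ! Suc i))"
  proof (rule sum.cong)
    fix i assume "i \<in> {..<?L}"
    then have "p ! i \<le> t" "p ! Suc i \<le> t"
      using last_index_iff[of i] last_index_iff[of "Suc i"] last_index_props by auto
    then show "?f i = f i (p ! i) (p ! Suc i)" by (simp add: min_absorb1)
  qed simp
  moreover have "(\<Sum>i=?L..<?m. ?f i) = f ?L (p ! ?L) t"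
  proof (cases "?L < ?m")
    case True
    have "(\<Sum>i=?L..<?m. ?f i) = ?f ?L + (\<Sum>i=Suc ?L..<?m. ?f i)"
      using True by (simp add: sum.atLeast_Suc_lessThan)
    also have "(\<Sum>i=Suc ?L..<?m. ?f i) = 0"
    proof (rule sum.neutral, safe)
      fix i assume "i \<in> {Suc ?L..<?m}"
      then have "t < p ! i" "t < p ! Suc i"
        using last_index_iff[of i] last_index_iff[of "Suc i"] by (auto simp: not_le)
      then show "?f i = 0" using f by simp
    qed
    also have "?f ?L = f ?L (p ! ?L) t"
      using last_index_props last_index_iff[of "Suc ?L"] True by (simp add: min_def)
    finally show ?thesis by simp
  next
    case False
    then have "?L = ?m" using last_index_le by simp
    moreover have "t = T" using last_index_props(2) t partition_ends(2) unfolding \<open>?L = ?m\<close> by simp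
    ultimately show ?thesis using f[of ?m] partition_ends by simp
  qed
  ultimately show ?thesis by simp
qed

end

lemma last_index_mono: "u \<in> {0..T} \<Longrightarrow> v \<in> {0..T} \<Longrightarrow> u \<le> v \<Longrightarrow> last_index p u \<le> last_index p v"
  using last_index_iff[of v "last_index p u"] last_index_props[of u] by auto

lemma last_index_0: "0 \<le> T \<Longrightarrow> last_index p 0 = 0"
proof (rule ccontr)
  assume "0 \<le> T" "last_index p 0 \<noteq> 0"
  then have "p ! 0 < p ! last_index p 0" by (intro partition_less last_index_props) auto
  then show False using last_index_props[of 0] \<open>0 \<le> T\<close> partition_ends by simp
qed

lemma last_index_T: "0 \<le> T \<Longrightarrow> last_index p T = length p - 1"
  using last_index_iff[of T "length p - 1"] last_index_le[of T] partition_ends partition_length by auto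

lemma telescope_stopped_partition:
  fixes x :: "real \<Rightarrow> real"
  assumes "t \<in> {0..T}"
  shows "(\<Sum>k<length p - 1. x (min (p ! Suc k) t) - x (min (p ! k) t)) = x t - x 0"
  using sum_lessThan_telescope[of "\<lambda>k. x (min (p ! k) t)" "length p - 1"] assms
  by (simp add: partition_ends min_absorb2 del: One_nat_def)

end

text \<open>
  The hypothesis does not mention a limit: a single large \<open>m\<close> makes \<open>x\<close> Cauchy.
\<close>

lemma iterated_limit:
  fixes x S :: "nat \<Rightarrow> real"
  assumes "\<And>\<epsilon>. 0 < \<epsilon> \<Longrightarrow> \<forall>\<^sub>F m in sequentially. \<forall>\<^sub>F n in sequentially. \<bar>x n - S m\<bar> \<le> \<epsilon>"
  shows "\<exists>l. x \<longlonglongrightarrow> l \<and> S \<longlonglongrightarrow> l"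
proof -
  have "Cauchy x"
  proof (rule metric_CauchyI)
    fix e :: real assume e: "0 < e"
    have "\<forall>\<^sub>F m in sequentially. \<forall>\<^sub>F n in sequentially. \<bar>x n - S m\<bar> \<le> e/3"
      by (rule assms) (use e in simp)
    from eventually_happens[OF this] obtain m where "\<forall>\<^sub>F n in sequentially. \<bar>x n - S m\<bar> \<le> e/3"
      by auto
    then obtain N where N: "\<And>n. n \<ge> N \<Longrightarrow> \<bar>x n - S m\<bar> \<le> e/3" by (auto simp: eventually_sequentially)
    have "dist (x i) (x j) < e" if "i \<ge> N" "j \<ge> N" for i j
      using N[OF that(1)] N[OF that(2)] e unfolding dist_real_def by linarith
    then show "\<exists>M. \<forall>m\<ge>M. \<forall>n\<ge>M. dist (x m) (x n) < e" by blast
  qed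
  then obtain l where l: "x \<longlonglongrightarrow> l" by (auto simp: Cauchy_convergent_iff convergent_def)
  have "S \<longlonglongrightarrow> l"
  proof (rule tendstoI)
    fix e :: real assume e: "0 < e"
    have "\<forall>\<^sub>F m in sequentially. \<forall>\<^sub>F n in sequentially. \<bar>x n - S m\<bar> \<le> e/2"
      by (rule assms) (use e in simp)
    then show "\<forall>\<^sub>F m in sequentially. dist (S m) l < e"
    proof (rule eventually_mono)
      fix m assume ev: "\<forall>\<^sub>F n in sequentially. \<bar>x n - S m\<bar> \<le> e/2"
      have "(\<lambda>n. \<bar>x n - S m\<bar>) \<longlonglongrightarrow> \<bar>l - S m\<bar>" by (intro tendsto_intros l)
      then have "\<bar>l - S m\<bar> \<le> e/2" using ev by (rule tendsto_upperbound) simp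
      then show "dist (S m) l < e" using e unfolding dist_real_def by linarith
    qed
  qed
  with l show ?thesis by blast
qed

text \<open>
  If on short intervals the increments of \<open>X n\<close> are given by \<open>Z n\<close> up to an arbitrarily small multiple
  of the increments of \<open>V n\<close>, then cutting \<open>[0, t]\<close> along a fixed partition \<open>\<pi> m\<close> and letting
  \<open>n \<rightarrow> \<infinity>\<close> traps \<open>X n t\<close> near the sum of the limits of the \<open>Z n\<close>.
\<close>

lemma convergence_by_blocks:
  fixes X V :: "nat \<Rightarrow> real \<Rightarrow> real" and Z :: "nat \<Rightarrow> real \<Rightarrow> real \<Rightarrow> real"
  assumes part: "\<And>n. is_partition T (\<pi> n)" and mesh: "(\<lambda>n. mesh (\<pi> n)) \<longlonglongrightarrow> 0"
    and V: "\<And>s. s \<in> {0..T} \<Longrightarrow> (\<lambda>n. V n s) \<longlonglongrightarrow> V' s"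
    and Z: "\<And>u v. 0 \<le> u \<Longrightarrow> u \<le> v \<Longrightarrow> v \<le> T \<Longrightarrow> (\<lambda>n. Z n u v) \<longlonglongrightarrow> Z' u v"
    and X0: "\<And>n. X n 0 = 0"
    and close: "\<And>\<epsilon>. 0 < \<epsilon> \<Longrightarrow> \<exists>\<rho>>0. \<forall>u v. 0 \<le> u \<longrightarrow> u \<le> v \<longrightarrow> v \<le> T \<longrightarrow> v - u < \<rho> \<longrightarrow>
      (\<forall>\<^sub>F n in sequentially. \<bar>X n v - X n u - Z n u v\<bar> \<le> \<epsilon> * (V n v - V n u))"
    and t: "t \<in> {0..T}"
  shows "\<exists>l. (\<lambda>n. X n t) \<longlonglongrightarrow> l \<and>
    (\<lambda>m. \<Sum>k<length (\<pi> m) - 1. Z' (min (\<pi> m ! k) t) (min (\<pi> m ! Suc k) t)) \<longlonglongrightarrow> l"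
proof (rule iterated_limit)
  fix \<epsilon> :: real assume \<epsilon>: "0 < \<epsilon>"
  define B where "B = \<bar>V' t - V' 0\<bar> + 1"
  have B: "0 < B" by (simp add: B_def)
  have "0 < \<epsilon> / (2 * B)" using \<epsilon> B by simp
  from close[OF this] obtain \<rho> where \<rho>: "0 < \<rho>"
    "\<And>u v. 0 \<le> u \<Longrightarrow> u \<le> v \<Longrightarrow> v \<le> T \<Longrightarrow> v - u < \<rho> \<Longrightarrow>
      \<forall>\<^sub>F n in sequentially. \<bar>X n v - X n u - Z n u v\<bar> \<le> \<epsilon> / (2 * B) * (V n v - V n u)" by blast
  have "\<forall>\<^sub>F m in sequentially. mesh (\<pi> m) < \<rho>" using order_tendstoD(2)[OF mesh \<rho>(1)] .
  then show "\<forall>\<^sub>F m in sequentially. \<forall>\<^sub>F n in sequentially.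
    \<bar>X n t - (\<Sum>k<length (\<pi> m) - 1. Z' (min (\<pi> m ! k) t) (min (\<pi> m ! Suc k) t))\<bar> \<le> \<epsilon>"
  proof (rule eventually_mono)
    fix m assume m: "mesh (\<pi> m) < \<rho>"
    let ?M = "length (\<pi> m) - 1"
    let ?u = "\<lambda>k. min (\<pi> m ! k) t" and ?v = "\<lambda>k. min (\<pi> m ! Suc k) t"
    have uv: "0 \<le> ?u k" "?u k \<le> ?v k" "?v k \<le> T" "?v k - ?u k < \<rho>" if "k < ?M" for k
    proof -
      have "0 \<le> \<pi> m ! k" "\<pi> m ! k \<le> \<pi> m ! Suc k" "\<pi> m ! Suc k \<le> T"
        using partition_in[OF part[of m], of k] partition_in[OF part[of m], of "Suc k"]
          partition_le[OF part[of m], of k "Suc k"] that by auto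
      moreover have "\<pi> m ! Suc k - \<pi> m ! k < \<rho>"
        using partition_step_le_mesh[OF part that] m by simp
      ultimately show "0 \<le> ?u k" "?u k \<le> ?v k" "?v k \<le> T" "?v k - ?u k < \<rho>"
        using t by auto
    qed
    have "\<forall>\<^sub>F n in sequentially. \<forall>k\<in>{..<?M}.
        \<bar>X n (?v k) - X n (?u k) - Z n (?u k) (?v k)\<bar> \<le> \<epsilon> / (2 * B) * (V n (?v k) - V n (?u k))"
      by (rule eventually_ball_finite) (use \<rho>(2) uv in auto)
    moreover have "(\<lambda>n. \<Sum>k<?M. Z n (?u k) (?v k)) \<longlonglongrightarrow> (\<Sum>k<?M. Z' (?u k) (?v k))"
      by (rule tendsto_sum) (use Z uv in auto)
    then have "\<forall>\<^sub>F n in sequentially. dist (\<Sum>k<?M. Z n (?u k) (?v k)) (\<Sum>k<?M. Z' (?u k) (?v k)) < \<epsilon> / 2"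
      by (rule tendstoD) (use \<epsilon> in simp)
    moreover have "(\<lambda>n. V n t - V n 0) \<longlonglongrightarrow> V' t - V' 0" using t by (intro tendsto_diff V) auto
    then have "\<forall>\<^sub>F n in sequentially. V n t - V n 0 < B"
      by (rule order_tendstoD(2)) (simp add: B_def)
    ultimately show "\<forall>\<^sub>F n in sequentially. \<bar>X n t - (\<Sum>k<?M. Z' (?u k) (?v k))\<bar> \<le> \<epsilon>"
    proof eventually_elim
      case (elim n)
      have "\<bar>X n t - (\<Sum>k<?M. Z n (?u k) (?v k))\<bar> =
          \<bar>\<Sum>k<?M. X n (?v k) - X n (?u k) - Z n (?u k) (?v k)\<bar>"
        using telescope_stopped_partition[OF part[of m] t, of "X n"] X0 by (simp add: sum_subtractf)
      also have "\<dots> \<le> (\<Sum>k<?M. \<bar>X n (?v k) - X n (?u k) - Z n (?u k) (?v k)\<bar>)" by (rule sum_abs)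
      also have "\<dots> \<le> (\<Sum>k<?M. \<epsilon> / (2 * B) * (V n (?v k) - V n (?u k)))"
        by (rule sum_mono) (use elim in auto)
      also have "\<dots> = \<epsilon> / (2 * B) * (V n t - V n 0)"
        using telescope_stopped_partition[OF part[of m] t, of "V n"] by (simp only: sum_distrib_left[symmetric])
      also have "\<dots> \<le> \<epsilon> / (2 * B) * B" using elim \<epsilon> B by (intro mult_left_mono) auto
      also have "\<dots> = \<epsilon> / 2" using B by simp
      finally show ?case using elim(2) unfolding dist_real_def by linarith
    qed
  qed
qed

lemma tendsto_last_point:
  assumes part: "\<And>n. is_partition T (\<pi> n)" and mesh: "(\<lambda>n. mesh (\<pi> n)) \<longlonglongrightarrow> 0" and t: "t \<in> {0..T}"
  shows "(\<lambda>n. \<pi> n ! last_index (\<pi> n) t) \<longlonglongrightarrow> t"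
proof (rule tendsto_sandwich)
  show "(\<lambda>n. t - mesh (\<pi> n)) \<longlonglongrightarrow> t" using tendsto_diff[OF tendsto_const mesh, of t] by simp
  show "\<forall>\<^sub>F n in sequentially. t - mesh (\<pi> n) \<le> \<pi> n ! last_index (\<pi> n) t"
    using last_index_close[OF part t] by (intro always_eventually) (auto simp: algebra_simps)
  show "\<forall>\<^sub>F n in sequentially. \<pi> n ! last_index (\<pi> n) t \<le> t"
    using last_index_props[OF part t] by simp
qed simp

lemma sum_diff_lessThan:
  fixes f :: "nat \<Rightarrow> real"
  assumes "i \<le> j"
  shows "(\<Sum>l<j. f l) - (\<Sum>l<i. f l) = (\<Sum>l=i..<j. f l)"
  using sum.atLeastLessThan_concat[of 0 i j f] assms by (simp add: lessThan_atLeast0)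

text \<open>
  On a short block the integrand is nearly constant, so the block contributes its value at the left
  end times the increment of the integrator, which converges. The limit \<open>P\<close> depends on the weights
  through the continuous function \<open>g\<close> only; this is what lets weights evaluated at step paths be
  exchanged for weights evaluated at the path.
\<close>

lemma weighted_sums_converge:
  fixes c q :: "nat \<Rightarrow> nat \<Rightarrow> real" and g :: "real \<Rightarrow> real"
  assumes part: "\<And>n. is_partition T (\<pi> n)" and mesh: "(\<lambda>n. mesh (\<pi> n)) \<longlonglongrightarrow> 0"
    and g: "continuous_on {0..T} g"
    and c: "\<And>s. s \<in> {0..T} \<Longrightarrow> (\<lambda>n. \<Sum>l<last_index (\<pi> n) s. c n l) \<longlonglongrightarrow> M s"
    and q: "\<And>s. s \<in> {0..T} \<Longrightarrow> (\<lambda>n. \<Sum>l<last_index (\<pi> n) s. q n l) \<longlonglongrightarrow> Q s"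
    and cq: "\<And>n l. \<bar>c n l\<bar> \<le> q n l"
  shows "\<exists>P. \<forall>w e t. t \<in> {0..T} \<longrightarrow> e \<longlonglongrightarrow> 0 \<longrightarrow>
      (\<forall>n l. l < length (\<pi> n) - 1 \<longrightarrow> \<bar>w n l - g (\<pi> n ! l)\<bar> \<le> e n) \<longrightarrow>
      (\<lambda>n. \<Sum>l<last_index (\<pi> n) t. w n l * c n l) \<longlonglongrightarrow> P t"
proof -
  define X where "X n t = (\<Sum>l<last_index (\<pi> n) t. g (\<pi> n ! l) * c n l)" for n t
  define C where "C n t = (\<Sum>l<last_index (\<pi> n) t. c n l)" for n t
  define Qn where "Qn n t = (\<Sum>l<last_index (\<pi> n) t. q n l)" for n t
  have q0: "0 \<le> q n l" for n l using cq[of n l] by linarith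
  have "\<exists>l. (\<lambda>n. X n t) \<longlonglongrightarrow> l" if t: "t \<in> {0..T}" for t
  proof -
    have "\<exists>l. (\<lambda>n. X n t) \<longlonglongrightarrow> l \<and>
      (\<lambda>m. \<Sum>k<length (\<pi> m) - 1. g (min (\<pi> m ! k) t) * (M (min (\<pi> m ! Suc k) t) - M (min (\<pi> m ! k) t))) \<longlonglongrightarrow> l"
    proof (rule convergence_by_blocks[OF part mesh, where V = Qn and V' = Q and
          Z = "\<lambda>n u v. g u * (C n v - C n u)" and Z' = "\<lambda>u v. g u * (M v - M u)"])
      show "(\<lambda>n. Qn n s) \<longlonglongrightarrow> Q s" if "s \<in> {0..T}" for s using q[OF that] by (simp add: Qn_def)
      show "(\<lambda>n. g u * (C n v - C n u)) \<longlonglongrightarrow> g u * (M v - M u)" if "0 \<le> u" "u \<le> v" "v \<le> T" for u v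
        unfolding C_def using that by (intro tendsto_intros c) auto
      show "X n 0 = 0" for n using last_index_0[OF part] t by (simp add: X_def)
    next
      fix \<epsilon> :: real assume \<epsilon>: "0 < \<epsilon>"
      have "uniformly_continuous_on {0..T} g" using compact_uniformly_continuous[OF g] by simp
      then obtain \<rho> where \<rho>: "0 < \<rho>"
        "\<And>x y. x \<in> {0..T} \<Longrightarrow> y \<in> {0..T} \<Longrightarrow> dist y x < \<rho> \<Longrightarrow> dist (g y) (g x) < \<epsilon>"
        unfolding uniformly_continuous_on_def using \<epsilon> by meson
      have "\<forall>\<^sub>F n in sequentially. \<bar>X n v - X n u - g u * (C n v - C n u)\<bar> \<le> \<epsilon> * (Qn n v - Qn n u)"
        if uv: "0 \<le> u" "u \<le> v" "v \<le> T" "v - u < \<rho>" for u v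
        using order_tendstoD(2)[OF mesh \<rho>(1)]
      proof eventually_elim
        case (elim n)
        let ?i = "last_index (\<pi> n) u" and ?j = "last_index (\<pi> n) v"
        have u: "u \<in> {0..T}" and v: "v \<in> {0..T}" using uv by auto
        have ij: "?i \<le> ?j" by (rule last_index_mono[OF part u v uv(2)])
        have "X n v - X n u - g u * (C n v - C n u) = (\<Sum>l=?i..<?j. (g (\<pi> n ! l) - g u) * c n l)"
          using sum_diff_lessThan[OF ij, of "\<lambda>l. g (\<pi> n ! l) * c n l"] sum_diff_lessThan[OF ij, of "c n"]
          by (simp add: X_def C_def algebra_simps sum_subtractf sum_distrib_left)
        also have "\<bar>\<dots>\<bar> \<le> (\<Sum>l=?i..<?j. \<bar>(g (\<pi> n ! l) - g u) * c n l\<bar>)" by (rule sum_abs)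
        also have "\<dots> \<le> (\<Sum>l=?i..<?j. \<epsilon> * q n l)"
        proof (rule sum_mono)
          fix l assume l: "l \<in> {?i..<?j}"
          have lj: "l < length (\<pi> n)" using l last_index_props(1)[OF part v, of n] by simp
          have "\<pi> n ! ?i \<le> \<pi> n ! l" by (rule partition_le[OF part]) (use l lj in auto)
          moreover have "\<pi> n ! l \<le> v" using last_index_iff[OF part v lj] l by auto
          ultimately have "dist (\<pi> n ! l) u < \<rho>"
            using last_index_close[OF part u, of n] elim uv unfolding dist_real_def by linarith
          then have "\<bar>g (\<pi> n ! l) - g u\<bar> \<le> \<epsilon>"
            using \<rho>(2)[OF u partition_in[OF part lj]] unfolding dist_real_def by simp
          then show "\<bar>(g (\<pi> n ! l) - g u) * c n l\<bar> \<le> \<epsilon> * q n l"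
            unfolding abs_mult using cq \<epsilon> by (intro mult_mono) auto
        qed
        also have "\<dots> = \<epsilon> * (Qn n v - Qn n u)"
          using sum_diff_lessThan[OF ij, of "q n"] by (simp add: Qn_def sum_distrib_left)
        finally show ?case .
      qed
      with \<rho>(1) show "\<exists>\<rho>>0. \<forall>u v. 0 \<le> u \<longrightarrow> u \<le> v \<longrightarrow> v \<le> T \<longrightarrow> v - u < \<rho> \<longrightarrow>
        (\<forall>\<^sub>F n in sequentially. \<bar>X n v - X n u - g u * (C n v - C n u)\<bar> \<le> \<epsilon> * (Qn n v - Qn n u))"
        by blast
    qed (rule t)
    then show ?thesis by blast
  qed
  then obtain P where P: "\<And>t. t \<in> {0..T} \<Longrightarrow> (\<lambda>n. X n t) \<longlonglongrightarrow> P t" by metis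
  show ?thesis
  proof (intro exI[of _ P] allI impI)
    fix w :: "nat \<Rightarrow> nat \<Rightarrow> real" and e :: "nat \<Rightarrow> real" and t :: real
    assume t: "t \<in> {0..T}" and e: "e \<longlonglongrightarrow> 0"
      and "\<forall>n l. l < length (\<pi> n) - 1 \<longrightarrow> \<bar>w n l - g (\<pi> n ! l)\<bar> \<le> e n"
    then have w: "\<And>n l. l < length (\<pi> n) - 1 \<Longrightarrow> \<bar>w n l - g (\<pi> n ! l)\<bar> \<le> e n" by blast
    have bd: "\<bar>(\<Sum>l<last_index (\<pi> n) t. w n l * c n l) - X n t\<bar> \<le> e n * Qn n t" for n
    proof -
      let ?L = "last_index (\<pi> n) t"
      have "(\<Sum>l<?L. w n l * c n l) - X n t = (\<Sum>l<?L. (w n l - g (\<pi> n ! l)) * c n l)"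
        by (simp add: X_def sum_subtractf algebra_simps)
      also have "\<bar>\<dots>\<bar> \<le> (\<Sum>l<?L. \<bar>(w n l - g (\<pi> n ! l)) * c n l\<bar>)" by (rule sum_abs)
      also have "\<dots> \<le> (\<Sum>l<?L. e n * q n l)"
      proof (rule sum_mono)
        fix l assume "l \<in> {..<?L}"
        then have "l < length (\<pi> n) - 1" using last_index_le[OF part t, of n] by simp
        from w[OF this] show "\<bar>(w n l - g (\<pi> n ! l)) * c n l\<bar> \<le> e n * q n l"
          unfolding abs_mult using cq by (intro mult_mono) auto
      qed
      finally show ?thesis by (simp add: Qn_def sum_distrib_left)
    qed
    have "(\<lambda>n. e n * Qn n t) \<longlonglongrightarrow> 0 * Q t" unfolding Qn_def by (rule tendsto_mult[OF e q[OF t]])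
    then have lim0: "(\<lambda>n. e n * Qn n t) \<longlonglongrightarrow> 0" by simp
    have "(\<lambda>n. (\<Sum>l<last_index (\<pi> n) t. w n l * c n l) - X n t) \<longlonglongrightarrow> 0"
    proof (rule Lim_null_comparison[OF _ lim0])
      show "\<forall>\<^sub>F n in sequentially. norm ((\<Sum>l<last_index (\<pi> n) t. w n l * c n l) - X n t) \<le> e n * Qn n t"
        unfolding real_norm_def by (rule always_eventually) (rule allI, rule bd)
    qed
    from tendsto_add[OF this P[OF t]] show "(\<lambda>n. \<Sum>l<last_index (\<pi> n) t. w n l * c n l) \<longlonglongrightarrow> P t" by simp
  qed
qed

section \<open>Quadratic variation of continuous paths\<close>

lemma jump_sq_continuous:
  assumes "continuous_on {0..T} x" "s \<in> {0<..T}"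
  shows "jump_sq x s = 0"
proof -
  have "(x \<longlongrightarrow> x s) (at_left s)"
    using continuous_on_Icc_at_leftD[of 0 s x] continuous_on_subset[OF assms(1), of "{0..s}"] assms(2) by auto
  then show ?thesis using assms(2) by (simp add: jump_sq_def left_val_def tendsto_Lim)
qed

lemma Q_real_lim: "x \<in> Q_real T \<pi> \<Longrightarrow> t \<in> {0..T} \<Longrightarrow> (\<lambda>n. qv_sum (\<pi> n) x t) \<longlonglongrightarrow> qv \<pi> x t"
  by (auto simp: Q_real_def qv_def convergent_LIMSEQ_iff)

lemma Q_real_qv_continuous:
  assumes x: "x \<in> Q_real T \<pi>" and cont: "continuous_on {0..T} x"
  shows "continuous_on {0..T} (qv \<pi> x)"
proof -
  from x obtain c where c: "continuous_on {0..T} c"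
    "\<And>t. t \<in> {0..T} \<Longrightarrow> qv \<pi> x t = c t + infsum (jump_sq x) {0<..t}"
    unfolding Q_real_def by blast
  note jump = jump_sq_continuous[OF cont]
  have "qv \<pi> x t = c t" if t: "t \<in> {0..T}" for t
  proof -
    have "infsum (jump_sq x) {0<..t} = 0" by (rule infsum_0) (use jump t in auto)
    with c(2)[OF t] show ?thesis by simp
  qed
  then show ?thesis using continuous_on_eq[OF c(1)] by simp
qed

text \<open>
  Polarization, already at the level of the sums.
\<close>

lemma polarized_sums_converge:
  fixes x :: "real \<Rightarrow> real^'d"
  assumes part: "\<And>n. is_partition T (\<pi> n)" and x: "x \<in> Q_vec T \<pi>" and t: "t \<in> {0..T}"
  shows "(\<lambda>n. \<Sum>l<last_index (\<pi> n) t. (x (\<pi> n ! Suc l) - x (\<pi> n ! l)) $ i * (x (\<pi> n ! Suc l) - x (\<pi> n ! l)) $ j)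
    \<longlonglongrightarrow> qv_mat \<pi> x t $ i $ j"
proof -
  let ?q = "\<lambda>n y. qv_sum (\<pi> n) y t"
  have qs: "qv_sum (\<pi> n) y t = (\<Sum>l<last_index (\<pi> n) t. (y (\<pi> n ! Suc l) - y (\<pi> n ! l))\<^sup>2)" for n y
    unfolding qv_sum_def by (simp only: right_endpoints_eq[OF part t])
  have "(\<Sum>l<last_index (\<pi> n) t. (x (\<pi> n ! Suc l) - x (\<pi> n ! l)) $ i * (x (\<pi> n ! Suc l) - x (\<pi> n ! l)) $ j) =
      (?q n (\<lambda>s. x s $ i + x s $ j) - ?q n (\<lambda>s. x s $ i) - ?q n (\<lambda>s. x s $ j)) / 2" for n
    unfolding qs sum_subtractf[symmetric] sum_divide_distrib
    by (rule sum.cong) (auto simp: power2_eq_square field_simps)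
  moreover have "(\<lambda>n. (?q n (\<lambda>s. x s $ i + x s $ j) - ?q n (\<lambda>s. x s $ i) - ?q n (\<lambda>s. x s $ j)) / 2)
      \<longlonglongrightarrow> qv_mat \<pi> x t $ i $ j"
    unfolding qv_mat_def vec_lambda_beta
    by (intro tendsto_divide tendsto_diff tendsto_const Q_real_lim[OF _ t]) (use x in \<open>auto simp: Q_vec_def\<close>)
  ultimately show ?thesis by (simp only:)
qed

lemma AE_point_in_interval:
  fixes p q :: real
  assumes "AE t in lborel. t \<in> A \<longrightarrow> P t" "p < q" "{p<..<q} \<subseteq> A"
  shows "\<exists>t\<in>{p<..<q}. P t"
proof (rule ccontr)
  assume no: "\<not> (\<exists>t\<in>{p<..<q}. P t)"
  from assms(1) obtain N where N: "{t \<in> space lborel. \<not> (t \<in> A \<longrightarrow> P t)} \<subseteq> N" "emeasure lborel N = 0" "N \<in> sets lborel"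
    by (rule AE_E)
  have "{p<..<q} \<subseteq> N" using no assms(3) N(1) by auto
  then have "emeasure lborel {p<..<q} \<le> emeasure lborel N" using N(3) by (rule emeasure_mono)
  then show False using N(2) assms(2) by simp
qed

section \<open>The pathwise integral along the partitions\<close>

lemma powr_superlinear:
  fixes C :: real
  assumes "1 < \<theta>" "0 \<le> C" "0 < \<epsilon>"
  shows "\<exists>r>0. \<forall>x. 0 \<le> x \<longrightarrow> x < r \<longrightarrow> C * x powr \<theta> \<le> \<epsilon> * x"
proof -
  define r where "r = (\<epsilon> / (C + 1)) powr (1 / (\<theta> - 1))"
  have r: "0 < r" using assms by (simp add: r_def)
  have "C * x powr \<theta> \<le> \<epsilon> * x" if x: "0 \<le> x" "x < r" for x
  proof (cases "x = 0")
    case False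
    have "x powr (\<theta> - 1) \<le> r powr (\<theta> - 1)" using x assms by (intro powr_mono2) auto
    also have "\<dots> = \<epsilon> / (C + 1)" using assms by (simp add: r_def powr_powr)
    finally have le: "x powr (\<theta> - 1) \<le> \<epsilon> / (C + 1)" .
    have "C * x powr (\<theta> - 1) \<le> (C + 1) * (\<epsilon> / (C + 1))" using le assms by (intro mult_mono) auto
    also have "\<dots> = \<epsilon>" using assms by simp
    finally have "C * x powr (\<theta> - 1) * x \<le> \<epsilon> * x" using x by (intro mult_right_mono)
    moreover have "x powr \<theta> = x powr (\<theta> - 1) * x" using False x powr_add[of x "\<theta> - 1" 1] by simp
    ultimately show ?thesis by (simp add: mult.assoc)
  qed simp
  with r show ?thesis by blast
qed

lemma tendsto_null_bound:
  fixes f :: "'b \<Rightarrow> 'v::real_normed_vector"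
  assumes "(g \<longlongrightarrow> 0) F" "\<forall>\<^sub>F x in F. norm (f x) \<le> g x"
  shows "(f \<longlongrightarrow> 0) F"
  by (rule Lim_null_comparison[OF assms(2,1)])

lemma continuous_on_bound:
  fixes f :: "real \<Rightarrow> 'v::real_normed_vector"
  assumes bound: "\<And>x y. x \<in> A \<Longrightarrow> y \<in> A \<Longrightarrow> norm (f y - f x) \<le> b x y"
    and lim: "\<And>x. x \<in> A \<Longrightarrow> (b x \<longlongrightarrow> 0) (at x within A)"
  shows "continuous_on A f"
  unfolding continuous_on_def
proof
  fix x assume x: "x \<in> A"
  have "\<forall>\<^sub>F y in at x within A. norm (f y - f x) \<le> b x y"
    unfolding eventually_at_filter by (rule always_eventually) (use bound x in blast)
  from tendsto_null_bound[OF lim[OF x] this]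
  show "(f \<longlongrightarrow> f x) (at x within A)" by (rule LIM_zero_cancel)
qed

lemma tendsto_abs_diff_powr:
  fixes x :: real
  assumes "0 < c"
  shows "((\<lambda>y. \<bar>y - x\<bar> powr c) \<longlongrightarrow> 0) (at x within A)"
proof -
  have "((\<lambda>y. \<bar>y - x\<bar>) \<longlongrightarrow> \<bar>x - x\<bar>) (at x within A)" by (intro tendsto_intros)
  then have "((\<lambda>y. \<bar>y - x\<bar>) \<longlongrightarrow> 0) (at x within A)" by simp
  from tendsto_powr'[OF this tendsto_const[of c]] show ?thesis using assms by simp
qed

lemma vlin_inner_expand:
  fixes w :: "real^'d^'d::finite"
  shows "vlin w x \<bullet> y = (\<Sum>k\<in>UNIV. \<Sum>i\<in>UNIV. w $ k $ i * (x $ k * y $ i))"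
proof -
  have "vlin w x \<bullet> y = (\<Sum>k\<in>UNIV. x $ k *\<^sub>R (w $ k) \<bullet> y)"
    by (simp add: vlin_def inner_sum_left)
  also have "\<dots> = (\<Sum>k\<in>UNIV. \<Sum>i\<in>UNIV. w $ k $ i * (x $ k * y $ i))"
    by (simp add: inner_vec_def sum_distrib_left algebra_simps)
  finally show ?thesis .
qed

context holder_path
begin

lemma omega_cont: "continuous_on {0..T} \<omega>"
proof (rule continuous_on_bound[OF holder])
  fix x
  have "((\<lambda>y. H * \<bar>y - x\<bar> powr \<alpha>) \<longlongrightarrow> H * 0) (at x within {0..T})"
    using \<alpha> by (intro tendsto_mult tendsto_const tendsto_abs_diff_powr) auto
  then show "((\<lambda>y. H * \<bar>y - x\<bar> powr \<alpha>) \<longlongrightarrow> 0) (at x within {0..T})" by simp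
qed

end

text \<open>
  In the application \<open>M\<close> is the matrix of the quadratic variation of \<open>\<omega>\<close> along \<open>\<pi>\<close>.
\<close>

locale qv_path = holder_path T H \<alpha> \<omega> for T H \<alpha> and \<omega> :: "real \<Rightarrow> real^'d::finite" +
  fixes \<pi> :: "nat \<Rightarrow> real list" and M :: "real \<Rightarrow> real^'d^'d"
  assumes part: "\<And>n. is_partition T (\<pi> n)"
    and mesh: "(\<lambda>n. mesh (\<pi> n)) \<longlonglongrightarrow> 0"
    and covar: "\<And>t i j. t \<in> {0..T} \<Longrightarrow> (\<lambda>n. \<Sum>l<last_index (\<pi> n) t.
      (\<omega> (\<pi> n ! Suc l) - \<omega> (\<pi> n ! l)) $ i * (\<omega> (\<pi> n ! Suc l) - \<omega> (\<pi> n ! l)) $ j) \<longlonglongrightarrow> M t $ i $ j"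
    and M_cont: "\<And>i. continuous_on {0..T} (\<lambda>t. M t $ i $ i)"
begin

abbreviation "a \<equiv> \<lambda>n k. \<pi> n ! k"
abbreviation "m \<equiv> \<lambda>n. length (\<pi> n) - 1"
abbreviation "L \<equiv> \<lambda>n t. last_index (\<pi> n) t"
abbreviation "dw \<equiv> \<lambda>n l. \<omega> (\<pi> n ! Suc l) - \<omega> (\<pi> n ! l)"

text \<open>The trace of \<open>M\<close> is the limit of the sums of \<open>(norm d\<omega>)\<^sup>2\<close>; it dominates all covariations.\<close>

definition Q :: "real \<Rightarrow> real" where "Q t = (\<Sum>i\<in>UNIV. M t $ i $ i)"

definition val :: "('d, 'v) functional \<Rightarrow> nat \<Rightarrow> nat \<Rightarrow> 'v" where
  "val G n l = G (a n l, S (a n) l)"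

definition on_path :: "('d, 'v) functional \<Rightarrow> real \<Rightarrow> 'v" where
  "on_path G t = G (t, stop T t \<omega>)"

abbreviation "remainder u v \<equiv> (v - u) powr (5/4 * \<alpha>) + (Q v - Q u)"

abbreviation "riemann_sum \<phi> n t \<equiv>
  \<Sum>k<m n. \<phi> (min (a n k) t) \<bullet> (\<omega> (min (a n (Suc k)) t) - \<omega> (min (a n k) t))"

lemma Q_lim:
  assumes "t \<in> {0..T}"
  shows "(\<lambda>n. \<Sum>l<L n t. (norm (dw n l))\<^sup>2) \<longlonglongrightarrow> Q t"
proof -
  have "(\<Sum>l<L n t. (norm (dw n l))\<^sup>2) = (\<Sum>i\<in>UNIV. \<Sum>l<L n t. dw n l $ i * dw n l $ i)" for n
    unfolding power2_norm_eq_inner inner_vec_def by (subst sum.swap) simp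
  then show ?thesis unfolding Q_def using covar[OF assms] by (simp add: tendsto_sum)
qed

lemma Q_mono:
  assumes "0 \<le> u" "u \<le> v" "v \<le> T"
  shows "Q u \<le> Q v"
proof (rule LIMSEQ_le[OF Q_lim Q_lim])
  show "\<exists>N. \<forall>n\<ge>N. (\<Sum>l<L n u. (norm (dw n l))\<^sup>2) \<le> (\<Sum>l<L n v. (norm (dw n l))\<^sup>2)"
    using last_index_mono[OF part, of u v] assms by (intro exI allI impI sum_mono2) auto
qed (use assms in auto)

lemma Q_cont: "continuous_on {0..T} Q"
  unfolding Q_def[abs_def] by (intro continuous_on_sum M_cont)

lemma W_compact: "compact W"
  by (rule compact_continuous_image[OF omega_cont]) simp

lemma stop_in_Lam: "t \<in> {0..T} \<Longrightarrow> (t, stop T t \<omega>) \<in> Lam T"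
  by (rule Lam_stop[OF cadlag_continuous[OF omega_cont]])

lemma stop_range: "t \<in> {0..T} \<Longrightarrow> stop T t \<omega> ` {0..T} \<subseteq> W"
  by (auto simp: stop_def)

lemma a_in: "l \<le> m n \<Longrightarrow> a n l \<in> {0..T}"
  using partition_in[OF part, of l n] partition_length[OF part, of n] by simp

lemma a_chain: "chain T (a n) (m n)"
  by (rule grid_chain[OF partition_grid[OF part]])

lemma mesh0: "0 \<le> mesh (\<pi> n)"
  using mesh_pos[OF part, of n] by simp

lemma mesh_powr: "0 < c \<Longrightarrow> (\<lambda>n. mesh (\<pi> n) powr c) \<longlonglongrightarrow> 0"
  using tendsto_powr'[OF mesh tendsto_const[of c]] mesh0 by simp

lemma last_in: "t \<in> {0..T} \<Longrightarrow> L n t \<le> m n"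
  by (rule last_index_le[OF part])

lemma omega_last_lim: "t \<in> {0..T} \<Longrightarrow> (\<lambda>n. \<omega> (a n (L n t))) \<longlonglongrightarrow> \<omega> t"
  by (rule continuous_on_tendsto_compose[OF omega_cont tendsto_last_point[OF part mesh]])
    (use a_in[OF last_in] in auto)

text \<open>
  At any time the step path takes a value of \<open>\<omega>\<close> at most one mesh width ahead.
\<close>
lemma step_path_near_stop:
  assumes l: "l \<le> m n"
  shows "sup_dist T (S (a n) l) (stop T (a n l) \<omega>) \<le> H * mesh (\<pi> n) powr \<alpha>"
proof (rule sup_dist_le[OF T0])
  fix s assume s: "s \<in> {0..T}"
  show "norm (S (a n) l s - stop T (a n l) \<omega> s) \<le> H * mesh (\<pi> n) powr \<alpha>"
  proof (cases "s < a n l")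
    case True
    have "a n 0 \<le> s" using s partition_ends[OF part, of n] by simp
    then obtain k where k: "k < l" "a n k \<le> s" "s < a n (Suc k)"
      using crossing_index[of 0 l "a n" s] True by blast
    have "S (a n) l s = \<omega> (a n (Suc k))"
      by (rule step_path_on[OF a_chain k(1) l s k(2,3)])
    moreover have "stop T (a n l) \<omega> s = \<omega> s" using True s by (simp add: stop_def)
    moreover have "norm (\<omega> (a n (Suc k)) - \<omega> s) \<le> H * mesh (\<pi> n) powr \<alpha>"
      using k l s a_in[of "Suc k" n] partition_step_le_mesh[OF part, of k n]
      by (intro holder_le) auto
    ultimately show ?thesis by simp
  next
    case False
    then have "S (a n) l s = \<omega> (a n l)" using step_path_after[OF a_chain l, of s \<omega>] s by simp
    moreover have "stop T (a n l) \<omega> s = \<omega> (a n l)" using False s by (simp add: stop_def)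
    ultimately show ?thesis using H by simp
  qed
qed

lemma val_near_on_path:
  assumes t: "tame T W K G" and l: "l \<le> m n"
  shows "norm (val G n l - on_path G (a n l)) \<le> K * (H * mesh (\<pi> n) powr \<alpha>)"
proof -
  have "norm (val G n l - on_path G (a n l)) \<le> K * sup_dist T (S (a n) l) (stop T (a n l) \<omega>)"
    unfolding val_def on_path_def
    using path_LipD[OF _ step_path_Lam[OF a_chain l T0] stop_in_Lam[OF a_in[OF l]], of K G] t
    by (simp add: tame_def)
  also have "\<dots> \<le> K * (H * mesh (\<pi> n) powr \<alpha>)"
    using step_path_near_stop[OF l] t by (intro mult_left_mono) (auto simp: tame_def)
  finally show ?thesis .
qed

lemma on_path_diff:
  assumes t: "tame T W K G" and uv: "0 \<le> u" "u \<le> v" "v \<le> T"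
  shows "norm (on_path G v - on_path G u) \<le> K * (H * (v - u) powr \<alpha>) + K * (v - u)"
proof -
  have K: "0 \<le> K" using t by (simp add: tame_def)
  have u: "(u, stop T u \<omega>) \<in> Lam T" and v: "(v, stop T v \<omega>) \<in> Lam T"
    using uv by (auto intro: stop_in_Lam)
  have uv': "(v, stop T u \<omega>) \<in> Lam T" by (rule Lam_later[OF u T0 uv(2,3)])
  have "sup_dist T (stop T v \<omega>) (stop T u \<omega>) \<le> H * (v - u) powr \<alpha>"
  proof (rule sup_dist_le[OF T0])
    fix s assume "s \<in> {0..T}"
    then show "norm (stop T v \<omega> s - stop T u \<omega> s) \<le> H * (v - u) powr \<alpha>"
      unfolding stop_def restrict_apply using uv by (simp, intro holder_le) auto
  qed
  then have "K * sup_dist T (stop T v \<omega>) (stop T u \<omega>) \<le> K * (H * (v - u) powr \<alpha>)"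
    by (rule mult_left_mono[OF _ K])
  moreover have "norm (G (v, stop T v \<omega>) - G (v, stop T u \<omega>)) \<le> K * sup_dist T (stop T v \<omega>) (stop T u \<omega>)"
    using path_LipD[OF _ v uv', of K G] t by (simp add: tame_def)
  ultimately have 1: "norm (G (v, stop T v \<omega>) - G (v, stop T u \<omega>)) \<le> K * (H * (v - u) powr \<alpha>)"
    by linarith
  have 2: "norm (G (v, stop T u \<omega>) - G (u, stop T u \<omega>)) \<le> K * (v - u)"
    by (rule tame_time[OF t u uv(2,3) stop_range]) (use uv in auto)
  have "on_path G v - on_path G u =
      (G (v, stop T v \<omega>) - G (v, stop T u \<omega>)) + (G (v, stop T u \<omega>) - G (u, stop T u \<omega>))"
    by (simp add: on_path_def)
  also have "norm \<dots> \<le> K * (H * (v - u) powr \<alpha>) + K * (v - u)"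
    by (rule norm_triangle_le[OF add_mono[OF 1 2]])
  finally show ?thesis .
qed

lemma on_path_cont:
  assumes t: "tame T W K G"
  shows "continuous_on {0..T} (on_path G)"
proof (rule continuous_on_bound)
  fix x y assume "x \<in> {0..T}" "y \<in> {0..T}"
  then show "norm (on_path G y - on_path G x) \<le> K * (H * \<bar>y - x\<bar> powr \<alpha>) + K * \<bar>y - x\<bar>"
    using on_path_diff[OF t, of x y] on_path_diff[OF t, of y x]
    by (cases "x \<le> y") (auto simp: norm_minus_commute)
next
  fix x
  have "((\<lambda>y. K * (H * \<bar>y - x\<bar> powr \<alpha>) + K * \<bar>y - x\<bar>) \<longlongrightarrow> K * (H * 0) + K * \<bar>x - x\<bar>) (at x within {0..T})"
    using \<alpha> by (intro tendsto_intros tendsto_abs_diff_powr) auto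
  then show "((\<lambda>y. K * (H * \<bar>y - x\<bar> powr \<alpha>) + K * \<bar>y - x\<bar>) \<longlongrightarrow> 0) (at x within {0..T})" by simp
qed

lemma val_lim:
  assumes g: "tame T W K G" and t: "t \<in> {0..T}"
  shows "(\<lambda>n. val G n (L n t)) \<longlonglongrightarrow> on_path G t"
proof -
  have 1: "(\<lambda>n. on_path G (a n (L n t))) \<longlonglongrightarrow> on_path G t"
    by (rule continuous_on_tendsto_compose[OF on_path_cont[OF g] tendsto_last_point[OF part mesh t] t])
      (use a_in[OF last_in[OF t]] in auto)
  have "(\<lambda>n. K * (H * mesh (\<pi> n) powr \<alpha>)) \<longlonglongrightarrow> K * (H * 0)"
    by (intro tendsto_intros mesh_powr) (use \<alpha> in simp)
  then have lim0: "(\<lambda>n. K * (H * mesh (\<pi> n) powr \<alpha>)) \<longlonglongrightarrow> 0" by simp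
  have "(\<lambda>n. val G n (L n t) - on_path G (a n (L n t))) \<longlonglongrightarrow> 0"
    by (rule tendsto_null_bound[OF lim0 always_eventually]) (rule allI, rule val_near_on_path[OF g last_in[OF t]])
  from tendsto_add[OF this 1] show ?thesis by simp
qed

lemma quadratic_sums_converge:
  assumes g: "continuous_on {0..T} g"
  shows "\<exists>P. \<forall>w e t. t \<in> {0..T} \<longrightarrow> e \<longlonglongrightarrow> 0 \<longrightarrow>
      (\<forall>n l. l < m n \<longrightarrow> norm (w n l - g (a n l)) \<le> e n) \<longrightarrow>
      (\<lambda>n. \<Sum>l<L n t. vlin (w n l) (dw n l) \<bullet> dw n l) \<longlonglongrightarrow> (P t :: real)"
proof -
  define good where "good k i P \<longleftrightarrow> (\<forall>w e t. t \<in> {0..T} \<longrightarrow> e \<longlonglongrightarrow> 0 \<longrightarrow>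
      (\<forall>n l. l < m n \<longrightarrow> \<bar>w n l - g (a n l) $ k $ i\<bar> \<le> e n) \<longrightarrow>
      (\<lambda>n. \<Sum>l<L n t. w n l * (dw n l $ k * dw n l $ i)) \<longlonglongrightarrow> P t)" for k i and P :: "real \<Rightarrow> real"
  have ex: "\<exists>P. good k i P" for k i
  proof -
    have gc: "continuous_on {0..T} (\<lambda>t. g t $ k $ i)" by (intro continuous_intros g)
    have le: "\<bar>dw n l $ k * dw n l $ i\<bar> \<le> (norm (dw n l))\<^sup>2" for n l
      unfolding abs_mult power2_eq_square by (intro mult_mono component_le_norm_cart) auto
    show ?thesis unfolding good_def
      by (rule weighted_sums_converge[OF part mesh gc covar[of _ k i] Q_lim le])
  qed
  define P where "P k i = (SOME P. good k i P)" for k i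
  have P: "good k i (P k i)" for k i unfolding P_def by (rule someI_ex[OF ex])
  show ?thesis
  proof (intro exI[of _ "\<lambda>t. \<Sum>k\<in>UNIV. \<Sum>i\<in>UNIV. P k i t"] allI impI)
    fix w :: "nat \<Rightarrow> nat \<Rightarrow> real^'d^'d" and e :: "nat \<Rightarrow> real" and t :: real
    assume t: "t \<in> {0..T}" and e: "e \<longlonglongrightarrow> 0" and w: "\<forall>n l. l < m n \<longrightarrow> norm (w n l - g (a n l)) \<le> e n"
    have eq: "(\<Sum>l<L n t. vlin (w n l) (dw n l) \<bullet> dw n l) =
        (\<Sum>k\<in>UNIV. \<Sum>i\<in>UNIV. \<Sum>l<L n t. w n l $ k $ i * (dw n l $ k * dw n l $ i))" for n
      unfolding vlin_inner_expand
      by (subst sum.swap, rule sum.cong[OF refl], rule sum.swap)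
    have wc: "\<bar>w n l $ k $ i - g (a n l) $ k $ i\<bar> \<le> e n" if "l < m n" for n l k i
    proof -
      have "\<bar>(w n l - g (a n l)) $ k $ i\<bar> \<le> norm (w n l - g (a n l))"
        by (rule order.trans[OF component_le_norm_cart Finite_Cartesian_Product.norm_nth_le])
      also have "\<dots> \<le> e n" using w that by blast
      finally show ?thesis by simp
    qed
    have "(\<lambda>n. \<Sum>l<L n t. w n l $ k $ i * (dw n l $ k * dw n l $ i)) \<longlonglongrightarrow> P k i t" for k i
      using P[of k i, unfolded good_def, rule_format, of t e "\<lambda>n l. w n l $ k $ i"] t e wc by blast
    then show "(\<lambda>n. \<Sum>l<L n t. vlin (w n l) (dw n l) \<bullet> dw n l) \<longlonglongrightarrow> (\<Sum>k\<in>UNIV. \<Sum>i\<in>UNIV. P k i t)"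
      unfolding eq by (intro tendsto_sum)
  qed
qed

text \<open>
  The constant in the expansion along step paths does not depend on the grid, so the expansion passes to
  the limit.
\<close>

lemma on_path_expansion:
  fixes G :: "('d, real) functional"
  assumes g: "tame T W K G" "tame T W K (vderiv T G)" and dif: "vert_differentiable T G"
  shows "\<exists>C\<ge>0. \<forall>u v. 0 \<le> u \<longrightarrow> u \<le> v \<longrightarrow> v \<le> T \<longrightarrow>
    \<bar>on_path G v - on_path G u - on_path (vderiv T G) u \<bullet> (\<omega> v - \<omega> u)\<bar> \<le> C * (v - u) powr (5/4 * \<alpha>)"
proof -
  from first_order_expansion[OF g dif] obtain C where C: "0 \<le> C"
    "\<And>a M i j. grid T a M \<Longrightarrow> i \<le> j \<Longrightarrow> j \<le> M \<Longrightarrow>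
      norm (G (a j, S a j) - G (a i, S a i) - vlin (vderiv T G (a i, S a i)) (\<omega> (a j) - \<omega> (a i)))
      \<le> C * (a j - a i) powr (5/4 * \<alpha>)" by blast
  have "\<bar>on_path G v - on_path G u - on_path (vderiv T G) u \<bullet> (\<omega> v - \<omega> u)\<bar> \<le> C * (v - u) powr (5/4 * \<alpha>)"
    if uv: "0 \<le> u" "u \<le> v" "v \<le> T" for u v
  proof -
    have u: "u \<in> {0..T}" and v: "v \<in> {0..T}" using uv by auto
    have "(\<lambda>n. a n (L n v) - a n (L n u)) \<longlonglongrightarrow> v - u"
      by (intro tendsto_diff tendsto_last_point[OF part mesh] u v)
    then have R: "(\<lambda>n. C * (a n (L n v) - a n (L n u)) powr (5/4 * \<alpha>)) \<longlonglongrightarrow> C * (v - u) powr (5/4 * \<alpha>)"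
      using \<alpha> chain_le[OF a_chain last_index_mono[OF part u v uv(2)] last_in[OF v]]
      by (intro tendsto_mult tendsto_const tendsto_powr') (auto intro!: always_eventually)
    have Lm: "(\<lambda>n. \<bar>val G n (L n v) - val G n (L n u) - val (vderiv T G) n (L n u) \<bullet> (\<omega> (a n (L n v)) - \<omega> (a n (L n u)))\<bar>)
      \<longlonglongrightarrow> \<bar>on_path G v - on_path G u - on_path (vderiv T G) u \<bullet> (\<omega> v - \<omega> u)\<bar>"
      by (intro tendsto_intros val_lim[OF g(1)] val_lim[OF g(2)] omega_last_lim u v)
    show ?thesis
    proof (rule LIMSEQ_le[OF Lm R], intro exI allI impI)
      fix n
      show "\<bar>val G n (L n v) - val G n (L n u) - val (vderiv T G) n (L n u) \<bullet> (\<omega> (a n (L n v)) - \<omega> (a n (L n u)))\<bar>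
          \<le> C * (a n (L n v) - a n (L n u)) powr (5/4 * \<alpha>)"
        using C(2)[OF partition_grid[OF part] last_index_mono[OF part u v uv(2)] last_in[OF v], of n]
        by (simp add: val_def vlin_inner)
    qed
  qed
  with C(1) show ?thesis by blast
qed

text \<open>
  The left limit of the approximating path at a grid point is the value of \<open>\<omega>\<close> there. At index \<open>0\<close> this
  fails: the convention for the left limit at time \<open>0\<close> gives the value \<open>\<omega> (a n 1)\<close>.
\<close>

lemma stop_left_approx_path:
  assumes i: "0 < i" "i < m n"
  shows "stop_left T (a n i) (approx_path T (\<pi> n) \<omega>) = S (a n) i"
proof
  fix s
  have ai: "a n i \<in> {0..T}" "a n i < T" "0 < a n i"
    using a_in[of i n] partition_less[OF part, of i "m n" n] partition_less[OF part, of 0 i n]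
      partition_ends[OF part, of n] partition_length[OF part, of n] i by auto
  have on: "approx_path T (\<pi> n) \<omega> s = \<omega> (a n (Suc k))"
    if k: "k < m n" "a n k \<le> s" "s < a n (Suc k)" for k s
  proof -
    have "s < T" using k a_in[of "Suc k" n] by auto
    have "(\<Sum>j<m n. indicator {a n j..<a n (Suc j)} s *\<^sub>R \<omega> (a n (Suc j))) =
        (\<Sum>j<m n. if j = k then \<omega> (a n (Suc k)) else 0)"
    proof (rule sum.cong)
      fix j assume j: "j \<in> {..<m n}"
      show "indicator {a n j..<a n (Suc j)} s *\<^sub>R \<omega> (a n (Suc j)) = (if j = k then \<omega> (a n (Suc k)) else 0)"
      proof (cases j k rule: linorder_cases)
        case less
        then have "a n (Suc j) \<le> a n k" using partition_le[OF part, of "Suc j" k n] k by simp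
        with less k show ?thesis by simp
      next
        case greater
        then have "a n (Suc k) \<le> a n j" using partition_le[OF part, of "Suc k" j n] j by simp
        with greater k show ?thesis by simp
      qed (use k in simp)
    qed simp
    then show ?thesis using k \<open>s < T\<close> by (simp add: approx_path_def)
  qed
  obtain i' where i': "i = Suc i'" using i by (cases i) auto
  have lv: "left_val (approx_path T (\<pi> n) \<omega>) (a n i) = \<omega> (a n i)"
  proof -
    have "(approx_path T (\<pi> n) \<omega> \<longlongrightarrow> \<omega> (a n i)) (at_left (a n i))"
      by (rule tendsto_at_left_eventually_const[of "a n i'"])
        (use on[of i'] i i' partition_less[OF part, of i' i n] in auto)
    then show ?thesis using ai by (simp add: left_val_def tendsto_Lim)
  qed
  show "stop_left T (a n i) (approx_path T (\<pi> n) \<omega>) s = S (a n) i s"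
  proof (cases "s \<in> {0..T}")
    case False
    have "S (a n) i \<in> extensional {0..T}"
      using step_path_Lam[OF a_chain _ T0, of i n \<omega>] i unfolding Lam_iff[OF T0] by simp
    from extensional_arb[OF this False] show ?thesis unfolding stop_left_def restrict_apply using False by auto
  next
    case s: True
    show ?thesis
    proof (cases "s < a n i")
      case True
      have "a n 0 \<le> s" using s partition_ends[OF part, of n] by simp
      then obtain k where k: "k < i" "a n k \<le> s" "s < a n (Suc k)"
        using crossing_index[of 0 i "a n" s] True by blast
      have "S (a n) i s = \<omega> (a n (Suc k))"
        by (rule step_path_on[OF a_chain k(1) _ s k(2,3)]) (use i in simp)
      then show ?thesis using on[OF _ k(2,3)] k i s True by (simp add: stop_left_def)
    next
      case False
      then show ?thesis using s lv step_path_after[OF a_chain, of i n s \<omega>] i by (simp add: stop_left_def)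
    qed
  qed
qed

text \<open>
  Only the summand with index \<open>0\<close> differs. There the two step paths are constants at distance at most
  \<open>H * mesh powr \<alpha>\<close>, and the increment of \<open>\<omega>\<close> is of the same size.
\<close>

lemma integral_sum_close:
  fixes F :: "('d, real) functional"
  assumes g: "tame T W K (vderiv T F)" and t: "t \<in> {0..T}"
  shows "\<bar>integral_sum T (\<pi> n) F \<omega> t - (\<Sum>i<m n. val (vderiv T F) n i \<bullet> (\<omega> (min (a n (Suc i)) t) - \<omega> (min (a n i) t)))\<bar>
    \<le> K * (H * mesh (\<pi> n) powr \<alpha>) * (H * mesh (\<pi> n) powr \<alpha>)"
proof -
  let ?\<phi> = "vderiv T F"
  let ?d = "\<lambda>i. \<omega> (min (a n (Suc i)) t) - \<omega> (min (a n i) t)"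
  let ?y = "stop_left T (a n 0) (approx_path T (\<pi> n) \<omega>)"
  define c where "c i = (?\<phi> (a n i, stop_left T (a n i) (approx_path T (\<pi> n) \<omega>)) - val ?\<phi> n i) \<bullet> ?d i" for i
  have m0: "0 < m n" by (rule partition_length[OF part])
  have a0: "a n 0 = 0" by (rule partition_ends[OF part])
  have K: "0 \<le> K" using g by (simp add: tame_def)
  have "integral_sum T (\<pi> n) F \<omega> t - (\<Sum>i<m n. val ?\<phi> n i \<bullet> ?d i) = (\<Sum>i<m n. c i)"
    by (simp add: integral_sum_def c_def sum_subtractf inner_diff_left)
  also have "\<dots> = (\<Sum>i\<in>{0}. c i)"
    by (rule sum.mono_neutral_right) (use m0 in \<open>auto simp: c_def stop_left_approx_path val_def\<close>)
  finally have eq: "integral_sum T (\<pi> n) F \<omega> t - (\<Sum>i<m n. val ?\<phi> n i \<bullet> ?d i) = c 0" by simp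
  have st: "a n (Suc 0) - a n 0 \<le> mesh (\<pi> n)" "a n 0 \<le> a n (Suc 0)"
    using partition_step_le_mesh[OF part m0] chain_le[OF a_chain, of 0 "Suc 0" n] m0 by auto
  have a1: "a n (Suc 0) \<in> {0..T}" using a_in[of "Suc 0" n] m0 by simp
  define z where "z = approx_path T (\<pi> n) \<omega> 0"
  have z: "z \<in> W \<and> norm (z - \<omega> 0) \<le> H * mesh (\<pi> n) powr \<alpha>"
  proof -
    have "(\<Sum>j<m n. indicator {a n j..<a n (Suc j)} 0 *\<^sub>R \<omega> (a n (Suc j))) =
        (\<Sum>j<m n. if j = 0 then \<omega> (a n (Suc 0)) else 0)"
    proof (rule sum.cong)
      fix j assume "j \<in> {..<m n}"
      then have j: "j < length (\<pi> n)" "Suc 0 < length (\<pi> n)" by auto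
      show "indicator {a n j..<a n (Suc j)} 0 *\<^sub>R \<omega> (a n (Suc j)) = (if j = 0 then \<omega> (a n (Suc 0)) else 0)"
        using partition_less[OF part, of 0 j n] partition_less[OF part, of 0 "Suc 0" n] a0 j by (cases "j = 0") auto
    qed simp
    then have "z = \<omega> (a n (Suc 0))" using m0 T by (simp add: z_def approx_path_def)
    moreover have "norm (\<omega> (a n (Suc 0)) - \<omega> 0) \<le> H * mesh (\<pi> n) powr \<alpha>"
      using st a0 a1 T by (intro holder_le) auto
    ultimately show ?thesis using a1 by auto
  qed
  have y: "?y = restrict (\<lambda>_. z) {0..T}" by (auto simp: stop_left_def left_val_def a0 z_def)
  have "cadlag T (restrict (\<lambda>_. z) {0..T})" by (rule cadlag_cong[OF cadlag_const]) simp
  then have yL: "(0, ?y) \<in> Lam T" unfolding y Lam_iff[OF T0] using T by auto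
  have SL: "(0, S (a n) 0) \<in> Lam T" using step_path_Lam[OF a_chain _ T0, of 0 n \<omega>] a0 by simp
  have "norm (?\<phi> (a n 0, ?y) - val ?\<phi> n 0) \<le> K * sup_dist T ?y (S (a n) 0)"
    unfolding val_def a0 using path_LipD[OF _ yL SL, of K ?\<phi>] g a0 by (simp add: tame_def)
  also have "\<dots> \<le> K * (H * mesh (\<pi> n) powr \<alpha>)"
    by (intro mult_left_mono K sup_dist_le[OF T0]) (use z a0 in \<open>simp add: y[unfolded a0]\<close>)
  finally have 1: "norm (?\<phi> (a n 0, ?y) - val ?\<phi> n 0) \<le> K * (H * mesh (\<pi> n) powr \<alpha>)" .
  have 2: "norm (?d 0) \<le> H * mesh (\<pi> n) powr \<alpha>"
    using st a0 a1 t by (intro holder_le) auto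
  have "\<bar>c 0\<bar> \<le> norm (?\<phi> (a n 0, ?y) - val ?\<phi> n 0) * norm (?d 0)"
    unfolding c_def by (rule Cauchy_Schwarz_ineq2)
  also have "\<dots> \<le> K * (H * mesh (\<pi> n) powr \<alpha>) * (H * mesh (\<pi> n) powr \<alpha>)"
    using 1 2 K H by (intro mult_mono) auto
  finally show ?thesis unfolding eq .
qed

lemma tendsto_vlin_inner:
  fixes w :: "'b \<Rightarrow> real^'d^'d"
  assumes "(w \<longlongrightarrow> w0) F" "(x \<longlongrightarrow> x0) F"
  shows "((\<lambda>n. vlin (w n) (x n) \<bullet> x n) \<longlongrightarrow> vlin w0 x0 \<bullet> x0) F"
  unfolding vlin_inner_expand by (intro tendsto_intros assms)

text \<open>
  Sewing gives convergence of the compensated sums and, cutting along the partitions \<open>\<pi> m\<close>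
  themselves, identifies the limit as that of the sums of compensated increments of the path itself.
  The compensators converge separately, to the same limit in both cases; so the look-ahead of the
  step paths is invisible in the limit.
\<close>

theorem pathwise_integral:
  fixes F :: "('d, real) functional"
  assumes F: "F \<in> S_class T"
  defines "\<phi> \<equiv> on_path (vderiv T F)"
  shows "\<exists>I. (\<forall>t\<in>{0..T}. (\<lambda>n. integral_sum T (\<pi> n) F \<omega> t) \<longlonglongrightarrow> I t) \<and>
    (\<forall>t\<in>{0..T}. (\<lambda>n. riemann_sum \<phi> n t) \<longlonglongrightarrow> I t) \<and>
    (\<exists>C\<ge>0. \<forall>u v. 0 \<le> u \<longrightarrow> u \<le> v \<longrightarrow> v \<le> T \<longrightarrow>
      \<bar>I v - I u - \<phi> u \<bullet> (\<omega> v - \<omega> u)\<bar> \<le> C * remainder u v)"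
proof -
  obtain K where g: "tame T W K (vderiv T F)" "tame T W K (vderiv T (vderiv T F))"
    and dif: "vert_differentiable T F" "vert_differentiable T (vderiv T F)"
    using S_class_tame[OF T0 F W_compact] by metis
  define \<psi> where "\<psi> = on_path (vderiv T (vderiv T F))"
  have K: "0 \<le> K" using g(1) by (simp add: tame_def)
  define \<theta> where "\<theta> = 9/4 * \<alpha>"
  have \<theta>: "1 < \<theta>" using \<alpha> by (simp add: \<theta>_def)
  let ?v1 = "val (vderiv T F)" and ?v2 = "val (vderiv T (vderiv T F))"
  \<comment> \<open>\<open>J\<close> are the compensated sums along the step paths, \<open>Z\<close> the compensated increments over blocks of
     the grid, and \<open>Z'\<close> those of the path itself.\<close>
  define J where "J n t = (\<Sum>l<L n t. Xi F (a n) l (Suc l))" for n t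
  define Z where "Z n u v = Xi F (a n) (L n u) (L n v)" for n u v
  define Z' where "Z' u v = \<phi> u \<bullet> (\<omega> v - \<omega> u) + 1/2 * (vlin (\<psi> u) (\<omega> v - \<omega> u) \<bullet> (\<omega> v - \<omega> u))" for u v
  have Xi: "Xi F (a n) i j = ?v1 n i \<bullet> (\<omega> (a n j) - \<omega> (a n i)) +
      1/2 * (vlin (?v2 n i) (\<omega> (a n j) - \<omega> (a n i)) \<bullet> (\<omega> (a n j) - \<omega> (a n i)))" for n i j
    by (simp add: Xi_def val_def)
  from Xi_sewing[OF g dif] obtain C where C: "0 \<le> C"
    "\<And>a M i k. grid T a M \<Longrightarrow> i \<le> k \<Longrightarrow> k \<le> M \<Longrightarrow>
      \<bar>(\<Sum>l=i..<k. Xi F a l (Suc l)) - Xi F a i k\<bar> \<le> C * (a k - a i) powr \<theta>"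
    unfolding \<theta>_def by blast
  have JZ: "\<bar>J n v - J n u - Z n u v\<bar> \<le> C * (a n (L n v) - a n (L n u)) powr \<theta>"
    if uv: "0 \<le> u" "u \<le> v" "v \<le> T" for n u v
  proof -
    have u: "u \<in> {0..T}" and v: "v \<in> {0..T}" using uv by auto
    have le: "L n u \<le> L n v" by (rule last_index_mono[OF part u v uv(2)])
    show ?thesis
      using C(2)[OF partition_grid[OF part] le last_in[OF v]]
      unfolding J_def Z_def sum_diff_lessThan[OF le] .
  qed
  have Zlim: "(\<lambda>n. Z n u v) \<longlonglongrightarrow> Z' u v" if uv: "0 \<le> u" "u \<le> v" "v \<le> T" for u v
  proof -
    have u: "u \<in> {0..T}" and v: "v \<in> {0..T}" using uv by auto
    show ?thesis unfolding Z_def Z'_def Xi \<phi>_def \<psi>_def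
      by (intro tendsto_intros tendsto_vlin_inner val_lim[OF g(1)] val_lim[OF g(2)] omega_last_lim u v)
  qed
  \<comment> \<open>The sewing error has an exponent above \<open>1\<close>, so on short blocks it is a small multiple of the length.\<close>
  have ex: "\<exists>l. (\<lambda>n. J n t) \<longlonglongrightarrow> l \<and> (\<lambda>n. \<Sum>k<m n. Z' (min (a n k) t) (min (a n (Suc k)) t)) \<longlonglongrightarrow> l"
    if t: "t \<in> {0..T}" for t
  proof (rule convergence_by_blocks[OF part mesh, where V = "\<lambda>n s. a n (L n s)" and V' = "\<lambda>s. s" and Z = Z])
    show "(\<lambda>n. a n (L n s)) \<longlonglongrightarrow> s" if "s \<in> {0..T}" for s by (rule tendsto_last_point[OF part mesh that])
    show "J n 0 = 0" for n using last_index_0[OF part T0] by (simp add: J_def)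
  next
    fix \<epsilon> :: real assume "0 < \<epsilon>"
    from powr_superlinear[OF \<theta> C(1) this] obtain r where r: "0 < r"
      "\<And>x. 0 \<le> x \<Longrightarrow> x < r \<Longrightarrow> C * x powr \<theta> \<le> \<epsilon> * x" by blast
    have "\<forall>\<^sub>F n in sequentially. \<bar>J n v - J n u - Z n u v\<bar> \<le> \<epsilon> * (a n (L n v) - a n (L n u))"
      if uv: "0 \<le> u" "u \<le> v" "v \<le> T" "v - u < r / 2" for u v
    proof -
      have u: "u \<in> {0..T}" and v: "v \<in> {0..T}" using uv by auto
      have "\<forall>\<^sub>F n in sequentially. mesh (\<pi> n) < r / 2" by (rule order_tendstoD(2)[OF mesh]) (use r in simp)
      then show ?thesis
      proof (rule eventually_mono)
        fix n assume n: "mesh (\<pi> n) < r / 2"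
        have "a n (L n u) \<le> a n (L n v)"
          by (rule chain_le[OF a_chain last_index_mono[OF part u v uv(2)] last_in[OF v]])
        moreover have "a n (L n v) \<le> v" using last_index_props[OF part v] by simp
        moreover have "u - a n (L n u) \<le> mesh (\<pi> n)" by (rule last_index_close[OF part u])
        ultimately have "C * (a n (L n v) - a n (L n u)) powr \<theta> \<le> \<epsilon> * (a n (L n v) - a n (L n u))"
          using n uv by (intro r(2)) auto
        with JZ[OF uv(1-3), of n] show "\<bar>J n v - J n u - Z n u v\<bar> \<le> \<epsilon> * (a n (L n v) - a n (L n u))"
          by linarith
      qed
    qed
    with r(1) show "\<exists>\<rho>>0. \<forall>u v. 0 \<le> u \<longrightarrow> u \<le> v \<longrightarrow> v \<le> T \<longrightarrow> v - u < \<rho> \<longrightarrow>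
      (\<forall>\<^sub>F n in sequentially. \<bar>J n v - J n u - Z n u v\<bar> \<le> \<epsilon> * (a n (L n v) - a n (L n u)))"
      by (intro exI[of _ "r / 2"]) auto
  qed (use Zlim t in auto)
  define Jl where "Jl t = lim (\<lambda>n. J n t)" for t
  have Jl: "(\<lambda>n. J n t) \<longlonglongrightarrow> Jl t"
    "(\<lambda>n. \<Sum>k<m n. Z' (min (a n k) t) (min (a n (Suc k)) t)) \<longlonglongrightarrow> Jl t" if t: "t \<in> {0..T}" for t
    using ex[OF t] limI unfolding Jl_def by blast+
  \<comment> \<open>\<open>P\<close> is the common limit of the compensators along the step paths and along the path.\<close>
  have "continuous_on {0..T} \<psi>" unfolding \<psi>_def by (rule on_path_cont[OF g(2)])
  from quadratic_sums_converge[OF this] obtain P :: "real \<Rightarrow> real" where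
    P: "\<forall>w e t. t \<in> {0..T} \<longrightarrow> e \<longlonglongrightarrow> 0 \<longrightarrow>
      (\<forall>n l. l < m n \<longrightarrow> norm (w n l - \<psi> (a n l)) \<le> e n) \<longrightarrow>
      (\<lambda>n. \<Sum>l<L n t. vlin (w n l) (dw n l) \<bullet> dw n l) \<longlonglongrightarrow> P t" by blast
  have mp: "(\<lambda>n. mesh (\<pi> n) powr \<alpha>) \<longlonglongrightarrow> 0" by (rule mesh_powr) (use \<alpha> in simp)
  have "(\<lambda>n. K * (H * mesh (\<pi> n) powr \<alpha>)) \<longlonglongrightarrow> K * (H * 0)" by (intro tendsto_intros mp)
  then have e0: "(\<lambda>n. K * (H * mesh (\<pi> n) powr \<alpha>)) \<longlonglongrightarrow> 0" by simp
  have Pval: "(\<lambda>n. \<Sum>l<L n t. vlin (?v2 n l) (dw n l) \<bullet> dw n l) \<longlonglongrightarrow> P t" if t: "t \<in> {0..T}" for t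
    by (rule P[rule_format, OF t e0]) (simp add: \<psi>_def val_near_on_path[OF g(2)])
  have Ppath: "(\<lambda>n. \<Sum>l<L n t. vlin (\<psi> (a n l)) (dw n l) \<bullet> dw n l) \<longlonglongrightarrow> P t" if t: "t \<in> {0..T}" for t
    by (rule P[rule_format, OF t tendsto_const]) simp
  define I where "I t = Jl t - 1/2 * P t" for t
  have last: "(\<lambda>n. \<omega> t - \<omega> (a n (L n t))) \<longlonglongrightarrow> 0" if t: "t \<in> {0..T}" for t
    using tendsto_diff[OF tendsto_const omega_last_lim[OF t], of "\<omega> t"] by simp
  have "(\<lambda>n. integral_sum T (\<pi> n) F \<omega> t) \<longlonglongrightarrow> I t" if t: "t \<in> {0..T}" for t
  proof -
    define R where "R n = (\<Sum>i<m n. ?v1 n i \<bullet> (\<omega> (min (a n (Suc i)) t) - \<omega> (min (a n i) t)))" for n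
    have R: "R n = J n t - 1/2 * (\<Sum>l<L n t. vlin (?v2 n l) (dw n l) \<bullet> dw n l) +
        ?v1 n (L n t) \<bullet> (\<omega> t - \<omega> (a n (L n t)))" for n
    proof -
      have "R n = (\<Sum>l<L n t. ?v1 n l \<bullet> dw n l) + ?v1 n (L n t) \<bullet> (\<omega> t - \<omega> (a n (L n t)))"
        unfolding R_def
        using sum_stopped_partition[OF part t, of "\<lambda>i x y. ?v1 n i \<bullet> (\<omega> y - \<omega> x)" n] by simp
      moreover have "J n t = (\<Sum>l<L n t. ?v1 n l \<bullet> dw n l) + 1/2 * (\<Sum>l<L n t. vlin (?v2 n l) (dw n l) \<bullet> dw n l)"
        by (simp add: J_def Xi sum.distrib sum_divide_distrib[symmetric])
      ultimately show ?thesis by simp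
    qed
    have "R \<longlonglongrightarrow> Jl t - 1/2 * P t + on_path (vderiv T F) t \<bullet> 0"
      unfolding R by (intro tendsto_intros Jl Pval last val_lim[OF g(1)] t)
    then have RI: "R \<longlonglongrightarrow> I t" by (simp add: I_def)
    have "(\<lambda>n. K * (H * mesh (\<pi> n) powr \<alpha>) * (H * mesh (\<pi> n) powr \<alpha>)) \<longlonglongrightarrow> 0 * (H * 0)"
      by (intro tendsto_mult e0 tendsto_const mp)
    then have lim0: "(\<lambda>n. K * (H * mesh (\<pi> n) powr \<alpha>) * (H * mesh (\<pi> n) powr \<alpha>)) \<longlonglongrightarrow> 0" by simp
    have "\<forall>n. norm (integral_sum T (\<pi> n) F \<omega> t - R n) \<le>
        K * (H * mesh (\<pi> n) powr \<alpha>) * (H * mesh (\<pi> n) powr \<alpha>)"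
      unfolding R_def real_norm_def using integral_sum_close[OF g(1) t] by blast
    from tendsto_null_bound[OF lim0 always_eventually[OF this]]
    have "(\<lambda>n. integral_sum T (\<pi> n) F \<omega> t - R n) \<longlonglongrightarrow> 0" .
    from tendsto_add[OF this RI] show ?thesis by simp
  qed
  moreover have "(\<lambda>n. riemann_sum \<phi> n t) \<longlonglongrightarrow> I t"
    if t: "t \<in> {0..T}" for t
  proof -
    define R where "R n = (\<Sum>k<m n. vlin (\<psi> (min (a n k) t)) (\<omega> (min (a n (Suc k)) t) - \<omega> (min (a n k) t))
      \<bullet> (\<omega> (min (a n (Suc k)) t) - \<omega> (min (a n k) t)))" for n
    have R: "R n = (\<Sum>l<L n t. vlin (\<psi> (a n l)) (dw n l) \<bullet> dw n l) +
        vlin (\<psi> (a n (L n t))) (\<omega> t - \<omega> (a n (L n t))) \<bullet> (\<omega> t - \<omega> (a n (L n t)))" for n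
      unfolding R_def
      using sum_stopped_partition[OF part t, of "\<lambda>i x y. vlin (\<psi> x) (\<omega> y - \<omega> x) \<bullet> (\<omega> y - \<omega> x)" n] by simp
    have "(\<lambda>n. \<psi> (a n (L n t))) \<longlonglongrightarrow> \<psi> t"
      unfolding \<psi>_def
      by (rule continuous_on_tendsto_compose[OF on_path_cont[OF g(2)] tendsto_last_point[OF part mesh t] t])
        (use a_in[OF last_in[OF t]] in auto)
    then have "R \<longlonglongrightarrow> P t + vlin (\<psi> t) 0 \<bullet> 0"
      unfolding R by (intro tendsto_intros tendsto_vlin_inner Ppath last t)
    then have "R \<longlonglongrightarrow> P t" by simp
    then have "(\<lambda>n. (\<Sum>k<m n. Z' (min (a n k) t) (min (a n (Suc k)) t)) - 1/2 * R n) \<longlonglongrightarrow> I t"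
      unfolding I_def by (intro tendsto_intros Jl t)
    moreover have "(\<Sum>k<m n. Z' (min (a n k) t) (min (a n (Suc k)) t)) - 1/2 * R n =
        riemann_sum \<phi> n t" for n
      by (simp add: Z'_def R_def sum.distrib sum_divide_distrib[symmetric])
    ultimately show ?thesis by simp
  qed
  moreover have "\<exists>C\<ge>0. \<forall>u v. 0 \<le> u \<longrightarrow> u \<le> v \<longrightarrow> v \<le> T \<longrightarrow>
      \<bar>I v - I u - \<phi> u \<bullet> (\<omega> v - \<omega> u)\<bar> \<le> C * remainder u v"
  proof -
    have "compact (\<psi> ` {0..T})"
      unfolding \<psi>_def by (rule compact_continuous_image[OF on_path_cont[OF g(2)]]) simp
    from compact_imp_bounded[OF this] obtain B where B: "\<And>t. t \<in> {0..T} \<Longrightarrow> norm (\<psi> t) \<le> B"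
      unfolding bounded_iff by blast
    have B0: "0 \<le> B" using order.trans[OF norm_ge_zero B[of 0]] T by simp
    have quad: "\<bar>vlin w x \<bullet> x\<bar> \<le> norm w * (norm x)\<^sup>2" for w :: "real^'d^'d" and x
      using order.trans[OF Cauchy_Schwarz_ineq2 mult_right_mono[OF norm_vlin_le norm_ge_zero], of w x x]
      by (simp add: power2_eq_square mult.assoc)
    define D where "D = C * T powr (\<theta> - 5/4 * \<alpha>) + 1/2 * B * H\<^sup>2 * T powr (2 * \<alpha> - 5/4 * \<alpha>) + 1/2 * B"
    have D0: "0 \<le> D" using C B0 by (simp add: D_def)
    have "\<bar>I v - I u - \<phi> u \<bullet> (\<omega> v - \<omega> u)\<bar> \<le> D * remainder u v"
      if uv: "0 \<le> u" "u \<le> v" "v \<le> T" for u v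
    proof -
      have u: "u \<in> {0..T}" and v: "v \<in> {0..T}" using uv by auto
      define h where "h = v - u"
      have h: "0 \<le> h" "h \<le> T" using uv by (auto simp: h_def)
      have "\<bar>Jl v - Jl u - Z' u v\<bar> \<le> C * h powr \<theta>"
      proof (rule LIMSEQ_le)
        show "(\<lambda>n. \<bar>J n v - J n u - Z n u v\<bar>) \<longlonglongrightarrow> \<bar>Jl v - Jl u - Z' u v\<bar>"
          by (intro tendsto_intros Jl Zlim u v uv)
        have "(\<lambda>n. a n (L n v) - a n (L n u)) \<longlonglongrightarrow> h"
          unfolding h_def by (intro tendsto_diff tendsto_last_point[OF part mesh] u v)
        then show "(\<lambda>n. C * (a n (L n v) - a n (L n u)) powr \<theta>) \<longlonglongrightarrow> C * h powr \<theta>"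
          using \<theta> chain_le[OF a_chain last_index_mono[OF part u v uv(2)] last_in[OF v]]
          by (intro tendsto_mult tendsto_const tendsto_powr') (auto intro!: always_eventually)
      qed (use JZ[OF uv] in auto)
      also have "\<dots> \<le> C * (T powr (\<theta> - 5/4 * \<alpha>) * h powr (5/4 * \<alpha>))"
        using C(1) \<alpha> by (intro mult_left_mono powr_le_scale h) (auto simp: \<theta>_def)
      finally have 1: "\<bar>Jl v - Jl u - Z' u v\<bar> \<le> C * (T powr (\<theta> - 5/4 * \<alpha>) * h powr (5/4 * \<alpha>))" .
      have 2: "\<bar>P v - P u\<bar> \<le> B * (Q v - Q u)"
      proof (rule LIMSEQ_le)
        show "(\<lambda>n. \<bar>(\<Sum>l<L n v. vlin (\<psi> (a n l)) (dw n l) \<bullet> dw n l) - (\<Sum>l<L n u. vlin (\<psi> (a n l)) (dw n l) \<bullet> dw n l)\<bar>)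
          \<longlonglongrightarrow> \<bar>P v - P u\<bar>" by (intro tendsto_intros Ppath u v)
        show "(\<lambda>n. B * ((\<Sum>l<L n v. (norm (dw n l))\<^sup>2) - (\<Sum>l<L n u. (norm (dw n l))\<^sup>2))) \<longlonglongrightarrow> B * (Q v - Q u)"
          by (intro tendsto_intros Q_lim u v)
        show "\<exists>N. \<forall>n\<ge>N. \<bar>(\<Sum>l<L n v. vlin (\<psi> (a n l)) (dw n l) \<bullet> dw n l) - (\<Sum>l<L n u. vlin (\<psi> (a n l)) (dw n l) \<bullet> dw n l)\<bar>
          \<le> B * ((\<Sum>l<L n v. (norm (dw n l))\<^sup>2) - (\<Sum>l<L n u. (norm (dw n l))\<^sup>2))"
        proof (intro exI allI impI)
          fix n
          have le: "L n u \<le> L n v" by (rule last_index_mono[OF part u v uv(2)])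
          have "\<bar>\<Sum>l=L n u..<L n v. vlin (\<psi> (a n l)) (dw n l) \<bullet> dw n l\<bar> \<le>
              (\<Sum>l=L n u..<L n v. B * (norm (dw n l))\<^sup>2)"
          proof (rule order.trans[OF sum_abs sum_mono])
            fix l assume "l \<in> {L n u..<L n v}"
            then have "a n l \<in> {0..T}" using a_in[of l n] last_in[OF v, of n] by simp
            from mult_right_mono[OF B[OF this], of "(norm (dw n l))\<^sup>2"] quad[of "\<psi> (a n l)" "dw n l"]
            show "\<bar>vlin (\<psi> (a n l)) (dw n l) \<bullet> dw n l\<bar> \<le> B * (norm (dw n l))\<^sup>2" by simp
          qed
          then show "\<bar>(\<Sum>l<L n v. vlin (\<psi> (a n l)) (dw n l) \<bullet> dw n l) - (\<Sum>l<L n u. vlin (\<psi> (a n l)) (dw n l) \<bullet> dw n l)\<bar>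
            \<le> B * ((\<Sum>l<L n v. (norm (dw n l))\<^sup>2) - (\<Sum>l<L n u. (norm (dw n l))\<^sup>2))"
            unfolding sum_diff_lessThan[OF le] by (simp only: sum_distrib_left)
        qed
      qed
      have "\<bar>vlin (\<psi> u) (\<omega> v - \<omega> u) \<bullet> (\<omega> v - \<omega> u)\<bar> \<le> norm (\<psi> u) * (norm (\<omega> v - \<omega> u))\<^sup>2" by (rule quad)
      also have "\<dots> \<le> B * (H * h powr \<alpha>)\<^sup>2"
        using B[OF u] holder_le[OF u v, of h] uv B0 by (intro mult_mono power_mono) (auto simp: h_def)
      also have "\<dots> = B * H\<^sup>2 * h powr (2 * \<alpha>)"
        using powr_add[of h \<alpha> \<alpha>] by (simp add: power2_eq_square)
      also have "\<dots> \<le> B * H\<^sup>2 * (T powr (2 * \<alpha> - 5/4 * \<alpha>) * h powr (5/4 * \<alpha>))"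
        using B0 \<alpha> by (intro mult_left_mono powr_le_scale h) auto
      finally have 3: "\<bar>vlin (\<psi> u) (\<omega> v - \<omega> u) \<bullet> (\<omega> v - \<omega> u)\<bar> \<le>
          B * H\<^sup>2 * (T powr (2 * \<alpha> - 5/4 * \<alpha>) * h powr (5/4 * \<alpha>))" .
      have combine: "\<bar>x - 1/2 * y + 1/2 * z\<bar> \<le> b + 1/2 * c + 1/2 * d"
        if "\<bar>x\<bar> \<le> b" "\<bar>y\<bar> \<le> c" "\<bar>z\<bar> \<le> d" for x y z b c d :: real
        using that by linarith
      have "I v - I u - \<phi> u \<bullet> (\<omega> v - \<omega> u) = (Jl v - Jl u - Z' u v) - 1/2 * (P v - P u) +
          1/2 * (vlin (\<psi> u) (\<omega> v - \<omega> u) \<bullet> (\<omega> v - \<omega> u))"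
        by (simp add: I_def Z'_def field_simps)
      then have "\<bar>I v - I u - \<phi> u \<bullet> (\<omega> v - \<omega> u)\<bar> \<le> C * (T powr (\<theta> - 5/4 * \<alpha>) * h powr (5/4 * \<alpha>)) +
          1/2 * (B * (Q v - Q u)) + 1/2 * (B * H\<^sup>2 * (T powr (2 * \<alpha> - 5/4 * \<alpha>) * h powr (5/4 * \<alpha>)))"
        using combine[OF 1 2 3] by (simp only:)
      also have "\<dots> = (C * T powr (\<theta> - 5/4 * \<alpha>) + 1/2 * B * H\<^sup>2 * T powr (2 * \<alpha> - 5/4 * \<alpha>)) * h powr (5/4 * \<alpha>) +
          1/2 * B * (Q v - Q u)" by (simp add: algebra_simps)
      also have "\<dots> \<le> D * h powr (5/4 * \<alpha>) + D * (Q v - Q u)"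
        using Q_mono[OF uv] B0 C(1) H by (intro add_mono mult_right_mono) (auto simp: D_def)
      finally show ?thesis by (simp add: h_def distrib_left)
    qed
    with D0 show ?thesis by blast
  qed
  ultimately show ?thesis by blast
qed

section \<open>Negligible remainders and uniqueness\<close>

text \<open>
  The exponent \<open>5/4 * \<alpha>\<close> exceeds \<open>1/2\<close>, and the increments of the continuous monotone function \<open>Q\<close> are
  uniformly small with bounded sum.
\<close>

lemma remainder_squares_vanish:
  "(\<lambda>n. \<Sum>l<m n. (remainder (a n l) (a n (Suc l)))\<^sup>2) \<longlonglongrightarrow> 0"
proof (rule tendstoI)
  fix e :: real assume e: "0 < e"
  define B where "B = 2 * (T + (Q T - Q 0)) + 1"
  have QT: "0 \<le> Q T - Q 0" using Q_mono[of 0 T] T by simp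
  have B: "0 < B" using T QT by (simp add: B_def)
  define \<epsilon> where "\<epsilon> = e / B"
  have \<epsilon>: "0 < \<epsilon>" using e B by (simp add: \<epsilon>_def)
  have "uniformly_continuous_on {0..T} Q" using compact_uniformly_continuous[OF Q_cont] by simp
  then obtain \<rho> where \<rho>: "0 < \<rho>"
    "\<And>x y. x \<in> {0..T} \<Longrightarrow> y \<in> {0..T} \<Longrightarrow> dist y x < \<rho> \<Longrightarrow> dist (Q y) (Q x) < \<epsilon>"
    unfolding uniformly_continuous_on_def using \<epsilon> by meson
  have "(\<lambda>n. mesh (\<pi> n) powr (5/2 * \<alpha> - 1)) \<longlonglongrightarrow> 0" by (rule mesh_powr) (use \<alpha> in simp)
  then have "\<forall>\<^sub>F n in sequentially. mesh (\<pi> n) powr (5/2 * \<alpha> - 1) < \<epsilon>" by (rule order_tendstoD(2)[OF _ \<epsilon>])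
  with order_tendstoD(2)[OF mesh \<rho>(1)]
  show "\<forall>\<^sub>F n in sequentially. dist (\<Sum>l<m n. (remainder (a n l) (a n (Suc l)))\<^sup>2) 0 < e"
  proof eventually_elim
    case (elim n)
    have "(remainder (a n l) (a n (Suc l)))\<^sup>2
        \<le> 2 * \<epsilon> * (a n (Suc l) - a n l) + 2 * \<epsilon> * (Q (a n (Suc l)) - Q (a n l))" if l: "l < m n" for l
    proof -
      define h where "h = a n (Suc l) - a n l"
      define q where "q = Q (a n (Suc l)) - Q (a n l)"
      have al: "a n l \<in> {0..T}" "a n (Suc l) \<in> {0..T}" using a_in l by auto
      have h: "0 < h" "h \<le> mesh (\<pi> n)"
        using partition_less[OF part, of l "Suc l" n] partition_step_le_mesh[OF part l] l by (auto simp: h_def)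
      have q: "0 \<le> q" unfolding q_def using Q_mono[of "a n l" "a n (Suc l)"] al h by (auto simp: h_def)
      have "dist (Q (a n (Suc l))) (Q (a n l)) < \<epsilon>"
        by (rule \<rho>(2)[OF al]) (use h elim in \<open>auto simp: h_def dist_real_def\<close>)
      then have q\<epsilon>: "q \<le> \<epsilon>" by (auto simp: q_def dist_real_def)
      have "(h powr (5/4 * \<alpha>))\<^sup>2 = h powr (5/2 * \<alpha> - 1) * h"
        using h powr_add[of h "5/4 * \<alpha>" "5/4 * \<alpha>"] powr_add[of h "5/2 * \<alpha> - 1" 1]
        by (simp add: power2_eq_square)
      also have "\<dots> \<le> \<epsilon> * h"
        using h elim(2) powr_mono2[of "5/2 * \<alpha> - 1" h "mesh (\<pi> n)"] \<alpha> by (intro mult_right_mono) auto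
      finally have 1: "(h powr (5/4 * \<alpha>))\<^sup>2 \<le> \<epsilon> * h" .
      have 2: "q\<^sup>2 \<le> \<epsilon> * q" unfolding power2_eq_square by (rule mult_right_mono[OF q\<epsilon> q])
      have "(h powr (5/4 * \<alpha>) + q)\<^sup>2 \<le> 2 * (h powr (5/4 * \<alpha>))\<^sup>2 + 2 * q\<^sup>2"
        using sum_squares_bound[of "h powr (5/4 * \<alpha>)" q] by (simp add: power2_sum)
      also have "\<dots> \<le> 2 * \<epsilon> * h + 2 * \<epsilon> * q" using 1 2 by simp
      finally show ?thesis by (simp add: h_def q_def)
    qed
    then have "(\<Sum>l<m n. (remainder (a n l) (a n (Suc l)))\<^sup>2)
        \<le> (\<Sum>l<m n. 2 * \<epsilon> * (a n (Suc l) - a n l) + 2 * \<epsilon> * (Q (a n (Suc l)) - Q (a n l)))"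
      by (intro sum_mono) auto
    also have "\<dots> = 2 * \<epsilon> * (a n (m n) - a n 0) + 2 * \<epsilon> * (Q (a n (m n)) - Q (a n 0))"
      unfolding sum.distrib sum_distrib_left[symmetric]
      using sum_lessThan_telescope[of "a n" "m n"] sum_lessThan_telescope[of "\<lambda>l. Q (a n l)" "m n"] by simp
    also have "\<dots> = \<epsilon> * (B - 1)"
      using partition_ends[OF part, of n] by (simp add: B_def algebra_simps)
    also have "\<dots> < \<epsilon> * B" using \<epsilon> by (intro mult_strict_left_mono) auto
    also have "\<dots> = e" using B by (simp add: \<epsilon>_def)
    finally show ?case by (simp add: dist_real_def sum_nonneg)
  qed
qed

lemma qv_sum_eq:
  "t \<in> {0..T} \<Longrightarrow> qv_sum (\<pi> n) x t = (\<Sum>l<L n t. (x (a n (Suc l)) - x (a n l))\<^sup>2)"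
  unfolding qv_sum_def by (simp only: right_endpoints_eq[OF part])

lemma negligible_quadratic_variation:
  assumes C: "0 \<le> C" and x: "\<And>u v. 0 \<le> u \<Longrightarrow> u \<le> v \<Longrightarrow> v \<le> T \<Longrightarrow>
      \<bar>x v - x u\<bar> \<le> C * remainder u v"
    and t: "t \<in> {0..T}"
  shows "(\<lambda>n. qv_sum (\<pi> n) x t) \<longlonglongrightarrow> 0"
proof -
  let ?E = "\<lambda>n l. remainder (a n l) (a n (Suc l))"
  have "(\<lambda>n. C\<^sup>2 * (\<Sum>l<m n. (?E n l)\<^sup>2)) \<longlonglongrightarrow> C\<^sup>2 * 0" by (intro tendsto_intros remainder_squares_vanish)
  then have lim0: "(\<lambda>n. C\<^sup>2 * (\<Sum>l<m n. (?E n l)\<^sup>2)) \<longlonglongrightarrow> 0" by simp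
  have "\<forall>n. norm (qv_sum (\<pi> n) x t) \<le> C\<^sup>2 * (\<Sum>l<m n. (?E n l)\<^sup>2)"
  proof
    fix n
    have "qv_sum (\<pi> n) x t \<le> (\<Sum>l<m n. (x (a n (Suc l)) - x (a n l))\<^sup>2)"
      unfolding qv_sum_eq[OF t] using last_in[OF t, of n] by (intro sum_mono2) auto
    also have "\<dots> \<le> (\<Sum>l<m n. (C * ?E n l)\<^sup>2)"
    proof (rule sum_mono)
      fix l assume "l \<in> {..<m n}"
      then have "\<bar>x (a n (Suc l)) - x (a n l)\<bar> \<le> C * ?E n l"
        using a_in[of l n] a_in[of "Suc l" n] chain_le[OF a_chain, of l "Suc l" n] by (intro x) auto
      from power_mono[OF this, of 2] show "(x (a n (Suc l)) - x (a n l))\<^sup>2 \<le> (C * ?E n l)\<^sup>2" by simp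
    qed
    also have "\<dots> = C\<^sup>2 * (\<Sum>l<m n. (?E n l)\<^sup>2)" by (simp add: power_mult_distrib sum_distrib_left)
    finally show "norm (qv_sum (\<pi> n) x t) \<le> C\<^sup>2 * (\<Sum>l<m n. (?E n l)\<^sup>2)"
      unfolding real_norm_def qv_sum_def by (simp add: sum_nonneg)
  qed
  from tendsto_null_bound[OF lim0 always_eventually[OF this]] show ?thesis .
qed

lemma small_increments_continuous:
  assumes C: "0 \<le> C" and x: "\<And>u v. 0 \<le> u \<Longrightarrow> u \<le> v \<Longrightarrow> v \<le> T \<Longrightarrow>
      \<bar>x v - x u\<bar> \<le> C * remainder u v"
  shows "continuous_on {0..T} x"
proof (rule continuous_on_bound)
  fix z y assume "z \<in> {0..T}" "y \<in> {0..T}"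
  then show "norm (x y - x z) \<le> C * (\<bar>y - z\<bar> powr (5/4 * \<alpha>) + \<bar>Q y - Q z\<bar>)"
    using x[of y z] x[of z y] Q_mono[of y z] Q_mono[of z y]
    by (cases "y \<le> z") (auto simp: abs_minus_commute)
next
  fix z assume "z \<in> {0..T}"
  then have "(Q \<longlongrightarrow> Q z) (at z within {0..T})" using Q_cont by (simp add: continuous_on_def)
  then have "((\<lambda>y. C * (\<bar>y - z\<bar> powr (5/4 * \<alpha>) + \<bar>Q y - Q z\<bar>)) \<longlongrightarrow> C * (0 + \<bar>Q z - Q z\<bar>)) (at z within {0..T})"
    using \<alpha> by (intro tendsto_intros tendsto_abs_diff_powr) auto
  then show "((\<lambda>y. C * (\<bar>y - z\<bar> powr (5/4 * \<alpha>) + \<bar>Q y - Q z\<bar>)) \<longlongrightarrow> 0) (at z within {0..T})" by simp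
qed

lemma negligible_Q_real:
  assumes C: "0 \<le> C" and x: "\<And>u v. 0 \<le> u \<Longrightarrow> u \<le> v \<Longrightarrow> v \<le> T \<Longrightarrow>
      \<bar>x v - x u\<bar> \<le> C * remainder u v"
  shows "x \<in> Q_real T \<pi>" "\<And>t. t \<in> {0..T} \<Longrightarrow> qv \<pi> x t = 0"
proof -
  note lim = negligible_quadratic_variation[OF C x]
  note cont = small_increments_continuous[OF C x]
  show qv0: "qv \<pi> x t = 0" if "t \<in> {0..T}" for t
    unfolding qv_def by (rule limI[OF lim[OF _ _ _ that]])
  note jump = jump_sq_continuous[OF cont]
  have "\<exists>c. continuous_on {0..T} c \<and> mono_on {0..T} c \<and>
      (\<forall>t\<in>{0..T}. qv \<pi> x t = c t + infsum (jump_sq x) {0<..t})"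
  proof (intro exI[of _ "\<lambda>_. 0"] conjI ballI)
    fix t assume t: "t \<in> {0..T}"
    have "infsum (jump_sq x) {0<..t} = 0" by (rule infsum_0) (use jump t in auto)
    with qv0[OF t] show "qv \<pi> x t = 0 + infsum (jump_sq x) {0<..t}" by simp
  qed (auto simp: mono_on_def)
  moreover have "jump_sq x summable_on {0<..T}"
    using summable_on_cong[of "{0<..T}" "jump_sq x" "\<lambda>_. 0"] jump by simp
  moreover have "cadlag T x" by (rule cadlag_continuous[OF cont])
  ultimately show "x \<in> Q_real T \<pi>"
    unfolding Q_real_def mem_Collect_eq using convergentI[OF lim] by blast
qed

text \<open>
  If the sums of the squares \<open>(\<eta> \<bullet> d\<omega>)\<^sup>2\<close> vanish, then near a time \<open>s\<close> where the quadratic variation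
  has derivative \<open>A\<close> they are close to \<open>\<eta> s \<bullet> (A *v \<eta> s)\<close> per unit of time, so this vanishes. The
  existence of such times in every interval, with \<open>A\<close> positive definite, forces \<open>\<eta> = 0\<close>.
\<close>

lemma integrand_zero:
  fixes \<eta> :: "real \<Rightarrow> real^'d"
  assumes \<eta>: "continuous_on {0..T} \<eta>"
    and sums: "(\<lambda>n. \<Sum>l<m n. (\<eta> (a n l) \<bullet> dw n l)\<^sup>2) \<longlonglongrightarrow> 0"
    and ae: "AE t\<in>{0..T} in lborel. \<exists>A. (M has_vector_derivative A) (at t within {0..T}) \<and> pos_def A"
    and t0: "t0 \<in> {0..T}"
  shows "\<eta> t0 = 0"
proof (rule ccontr)
  assume ne: "\<eta> t0 \<noteq> 0"
  have "(\<eta> \<longlongrightarrow> \<eta> t0) (at t0 within {0..T})" using \<eta> t0 by (simp add: continuous_on_def)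
  then have "\<forall>\<^sub>F t in at t0 within {0..T}. \<eta> t \<noteq> 0" using ne by (rule tendsto_imp_eventually_ne)
  then obtain d where d: "0 < d" "\<And>t. t \<in> {0..T} \<Longrightarrow> t \<noteq> t0 \<Longrightarrow> dist t t0 < d \<Longrightarrow> \<eta> t \<noteq> 0"
    unfolding eventually_at by blast
  define p where "p = max 0 (t0 - d)"
  define q where "q = min T (t0 + d)"
  have pq: "p < q" "{p<..<q} \<subseteq> {0..T}" using t0 d(1) T by (auto simp: p_def q_def)
  obtain s where s: "s \<in> {p<..<q}" "\<exists>A. (M has_vector_derivative A) (at s within {0..T}) \<and> pos_def A"
    using AE_point_in_interval[OF ae pq] by blast
  then obtain A where A: "(M has_vector_derivative A) (at s within {0..T})" "pos_def A" by blast
  have sT: "0 \<le> s" "s < T" "s \<in> {0..T}" using s(1) by (auto simp: p_def q_def)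
  have "\<eta> s \<noteq> 0" using ne d(2)[of s] s(1) sT(3) by (cases "s = t0") (auto simp: p_def q_def dist_real_def abs_less_iff)
  define v where "v = \<eta> s"
  \<comment> \<open>\<open>quad B\<close> is \<open>v \<bullet> (B *v v)\<close>, written as a sum to expose its linearity in \<open>B\<close>.\<close>
  define quad where "quad B = (\<Sum>i\<in>UNIV. \<Sum>j\<in>UNIV. (v $ i * v $ j) * B $ i $ j)" for B :: "real^'d^'d"
  define tr where "tr B = (\<Sum>i\<in>UNIV. B $ i $ i)" for B :: "real^'d^'d"
  have "0 < v \<bullet> (A *v v)" using A(2) \<open>\<eta> s \<noteq> 0\<close> by (simp add: pos_def_def v_def)
  also have "v \<bullet> (A *v v) = quad A"
    by (simp add: quad_def inner_vec_def matrix_vector_mult_def sum_distrib_left algebra_simps)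
  finally have pos: "0 < quad A" .
  obtain B where B: "\<And>t. t \<in> {0..T} \<Longrightarrow> norm (\<eta> t) \<le> B"
    using compact_imp_bounded[OF compact_continuous_image[OF \<eta> compact_Icc]] unfolding bounded_iff by blast
  have B0: "0 \<le> B" using order.trans[OF norm_ge_zero B[OF sT(3)]] .
  \<comment> \<open>Freezing \<open>\<eta>\<close> at \<open>s\<close> costs a small multiple of the trace. So \<open>\<epsilon> * tr M - quad M\<close> does not fall below
     its value at \<open>s\<close> shortly afterwards, and its derivative there is nonnegative.\<close>
  have key: "quad A \<le> \<epsilon> * tr A" if \<epsilon>: "0 < \<epsilon>" for \<epsilon>
  proof -
    have "0 < \<epsilon> / (2 * B + 1)" using \<epsilon> B0 by simp
    then obtain \<rho> where \<rho>: "0 < \<rho>"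
      "\<And>r. r \<in> {0..T} \<Longrightarrow> dist r s < \<rho> \<Longrightarrow> dist (\<eta> r) (\<eta> s) < \<epsilon> / (2 * B + 1)"
      using \<eta> sT(3) unfolding continuous_on_iff by blast
    have sq: "(v \<bullet> x)\<^sup>2 - \<epsilon> * (norm x)\<^sup>2 \<le> (\<eta> r \<bullet> x)\<^sup>2" if r: "r \<in> {0..T}" "dist r s < \<rho>" for r x
    proof -
      have "(v \<bullet> x)\<^sup>2 - (\<eta> r \<bullet> x)\<^sup>2 = ((v - \<eta> r) \<bullet> x) * ((v + \<eta> r) \<bullet> x)"
        by (simp add: inner_diff_left inner_add_left power2_eq_square algebra_simps)
      also have "\<dots> \<le> \<bar>(v - \<eta> r) \<bullet> x\<bar> * \<bar>(v + \<eta> r) \<bullet> x\<bar>"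
        by (metis abs_ge_self abs_mult)
      also have "\<dots> \<le> (norm (v - \<eta> r) * norm x) * (norm (v + \<eta> r) * norm x)"
        by (intro mult_mono Cauchy_Schwarz_ineq2) auto
      also have "\<dots> \<le> ((\<epsilon> / (2 * B + 1)) * norm x) * ((2 * B) * norm x)"
      proof (intro mult_mono)
        show "norm (v - \<eta> r) \<le> \<epsilon> / (2 * B + 1)"
          using \<rho>(2)[OF r] by (simp add: v_def dist_norm norm_minus_commute)
        show "norm (v + \<eta> r) \<le> 2 * B"
          using norm_triangle_ineq[of v "\<eta> r"] B[OF r(1)] B[OF sT(3)] by (simp add: v_def)
      qed (use \<epsilon> B0 in auto)
      also have "\<dots> = \<epsilon> * (2 * B / (2 * B + 1)) * (norm x)\<^sup>2" by (simp add: power2_eq_square)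
      also have "\<dots> \<le> \<epsilon> * 1 * (norm x)\<^sup>2"
        using \<epsilon> B0 by (intro mult_right_mono mult_left_mono) auto
      finally show ?thesis by simp
    qed
    have incr: "quad (M t) - quad (M s) \<le> \<epsilon> * (tr (M t) - tr (M s))" if t: "s < t" "t < s + \<rho>" "t \<le> T" for t
    proof -
      have t': "t \<in> {0..T}" using t sT by auto
      define X where "X n r = (\<Sum>l<L n r. (v \<bullet> dw n l)\<^sup>2 - \<epsilon> * (norm (dw n l))\<^sup>2)" for n r
      have X: "(\<lambda>n. X n r) \<longlonglongrightarrow> quad (M r) - \<epsilon> * tr (M r)" if r: "r \<in> {0..T}" for r
      proof -
        have "(\<Sum>l<L n r. (v \<bullet> dw n l)\<^sup>2) =
            (\<Sum>i\<in>UNIV. \<Sum>j\<in>UNIV. (v $ i * v $ j) * (\<Sum>l<L n r. dw n l $ i * dw n l $ j))" for n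
        proof -
          have "(\<Sum>l<L n r. (v \<bullet> dw n l)\<^sup>2) =
              (\<Sum>l<L n r. \<Sum>i\<in>UNIV. \<Sum>j\<in>UNIV. (v $ i * v $ j) * (dw n l $ i * dw n l $ j))"
            by (simp add: power2_eq_square inner_vec_def sum_product algebra_simps)
          also have "\<dots> = (\<Sum>i\<in>UNIV. \<Sum>j\<in>UNIV. \<Sum>l<L n r. (v $ i * v $ j) * (dw n l $ i * dw n l $ j))"
            by (subst sum.swap, rule sum.cong[OF refl], rule sum.swap)
          finally show ?thesis by (simp only: sum_distrib_left)
        qed
        then have "(\<lambda>n. \<Sum>l<L n r. (v \<bullet> dw n l)\<^sup>2) \<longlonglongrightarrow> quad (M r)"
          unfolding quad_def by (simp only:) (intro tendsto_sum tendsto_mult tendsto_const covar r)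
        moreover have "(\<lambda>n. \<epsilon> * (\<Sum>l<L n r. (norm (dw n l))\<^sup>2)) \<longlonglongrightarrow> \<epsilon> * tr (M r)"
          using Q_lim[OF r] unfolding Q_def tr_def by (intro tendsto_mult tendsto_const)
        ultimately show ?thesis
          unfolding X_def sum_subtractf sum_distrib_left[symmetric] by (rule tendsto_diff)
      qed
      have "quad (M t) - \<epsilon> * tr (M t) - (quad (M s) - \<epsilon> * tr (M s)) \<le> 0"
      proof (rule tendsto_le[OF _ sums tendsto_diff[OF X[OF t'] X[OF sT(3)]]])
        show "\<forall>\<^sub>F n in sequentially. X n t - X n s \<le> (\<Sum>l<m n. (\<eta> (a n l) \<bullet> dw n l)\<^sup>2)"
          using order_tendstoD(2)[OF mesh \<rho>(1)]
        proof eventually_elim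
          case (elim n)
          have le: "L n s \<le> L n t" by (rule last_index_mono[OF part sT(3) t']) (use t in simp)
          have "X n t - X n s = (\<Sum>l=L n s..<L n t. (v \<bullet> dw n l)\<^sup>2 - \<epsilon> * (norm (dw n l))\<^sup>2)"
            unfolding X_def by (rule sum_diff_lessThan[OF le])
          also have "\<dots> \<le> (\<Sum>l=L n s..<L n t. (\<eta> (a n l) \<bullet> dw n l)\<^sup>2)"
          proof (rule sum_mono)
            fix l assume l: "l \<in> {L n s..<L n t}"
            have lm: "l \<le> m n" using l last_in[OF t', of n] by simp
            have "a n (L n s) \<le> a n l" by (rule chain_le[OF a_chain]) (use l lm in auto)
            moreover have "a n l \<le> t"
              using last_index_iff[OF part t', of l n] l lm partition_length[OF part, of n] by auto
            ultimately have "dist (a n l) s < \<rho>"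
              using last_index_close[OF part sT(3), of n] elim t unfolding dist_real_def by linarith
            then show "(v \<bullet> dw n l)\<^sup>2 - \<epsilon> * (norm (dw n l))\<^sup>2 \<le> (\<eta> (a n l) \<bullet> dw n l)\<^sup>2"
              by (rule sq[OF a_in[OF lm]])
          qed
          also have "\<dots> \<le> (\<Sum>l<m n. (\<eta> (a n l) \<bullet> dw n l)\<^sup>2)"
            using last_in[OF t', of n] by (intro sum_mono2) auto
          finally show ?case .
        qed
      qed simp
      then show ?thesis by (simp add: algebra_simps)
    qed
    define f where "f t = \<epsilon> * tr (M t) - quad (M t)" for t
    have nth: "((\<lambda>t. M t $ i $ j) has_vector_derivative A $ i $ j) (at s within {0..T})" for i j
      by (intro bounded_linear.has_vector_derivative[OF bounded_linear_vec_nth] A(1))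
    have "(f has_vector_derivative \<epsilon> * tr A - quad A) (at s within {0..T})"
      unfolding f_def[abs_def] tr_def quad_def
      by (intro has_vector_derivative_diff has_vector_derivative_mult_right has_vector_derivative_sum nth)
    then have "((\<lambda>y. (f y - f s) / (y - s)) \<longlongrightarrow> \<epsilon> * tr A - quad A) (at s within {0..T})"
      by (simp add: has_real_derivative_iff_has_vector_derivative[symmetric] has_field_derivative_iff)
    then have "((\<lambda>y. (f y - f s) / (y - s)) \<longlongrightarrow> \<epsilon> * tr A - quad A) (at s within {s..T})"
      by (rule tendsto_within_subset) (use sT in auto)
    then have lim: "((\<lambda>y. (f y - f s) / (y - s)) \<longlongrightarrow> \<epsilon> * tr A - quad A) (at_right s)"
      using at_within_Icc_at_right[OF sT(2)] by simp
    have "s < min T (s + \<rho>)" using sT \<rho>(1) by simp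
    from eventually_at_right_real[OF this]
    have "\<forall>\<^sub>F y in at_right s. 0 \<le> (f y - f s) / (y - s)"
    proof (rule eventually_mono)
      fix y assume "y \<in> {s<..<min T (s + \<rho>)}"
      then have y: "s < y" "y < s + \<rho>" "y \<le> T" by auto
      have "f s \<le> f y" using incr[OF y] by (simp add: f_def right_diff_distrib)
      then show "0 \<le> (f y - f s) / (y - s)" using y(1) by simp
    qed
    from tendsto_lowerbound[OF lim this] show ?thesis by simp
  qed
  have "quad A \<le> 0"
  proof (rule field_le_epsilon)
    fix e :: real assume e: "0 < e"
    have "quad A \<le> e / (\<bar>tr A\<bar> + 1) * tr A" by (rule key) (use e in simp)
    also have "\<dots> \<le> e / (\<bar>tr A\<bar> + 1) * (\<bar>tr A\<bar> + 1)" using e by (intro mult_left_mono) auto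
    also have "\<dots> = 0 + e" by simp
    finally show "quad A \<le> 0 + e" .
  qed
  with pos show False by simp
qed

text \<open>
  Since \<open>I - I' = s' - s\<close>, the increment \<open>(\<phi> - \<phi>') \<bullet> d\<omega>\<close> equals one of \<open>s' - s\<close> up to remainders; both have
  vanishing sums of squares.
\<close>

lemma integrands_agree:
  fixes \<phi> \<phi>' :: "real \<Rightarrow> real^'d"
  assumes cont: "continuous_on {0..T} \<phi>" "continuous_on {0..T} \<phi>'"
    and C: "0 \<le> C" "\<And>u v. 0 \<le> u \<Longrightarrow> u \<le> v \<Longrightarrow> v \<le> T \<Longrightarrow>
      \<bar>I v - I u - \<phi> u \<bullet> (\<omega> v - \<omega> u)\<bar> \<le> C * remainder u v"
    and C': "0 \<le> C'" "\<And>u v. 0 \<le> u \<Longrightarrow> u \<le> v \<Longrightarrow> v \<le> T \<Longrightarrow>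
      \<bar>I' v - I' u - \<phi>' u \<bullet> (\<omega> v - \<omega> u)\<bar> \<le> C' * remainder u v"
    and s: "(\<lambda>n. qv_sum (\<pi> n) s T) \<longlonglongrightarrow> 0" "(\<lambda>n. qv_sum (\<pi> n) s' T) \<longlonglongrightarrow> 0"
    and eq: "\<And>t. t \<in> {0..T} \<Longrightarrow> I t + s t = I' t + s' t"
    and ae: "AE t\<in>{0..T} in lborel. \<exists>A. (M has_vector_derivative A) (at t within {0..T}) \<and> pos_def A"
    and t: "t \<in> {0..T}"
  shows "\<phi> t = \<phi>' t"
proof -
  let ?E = "\<lambda>n l. remainder (a n l) (a n (Suc l))"
  have TT: "T \<in> {0..T}" using T by simp
  have square3: "(x + y + z)\<^sup>2 \<le> 3 * x\<^sup>2 + 3 * y\<^sup>2 + 3 * z\<^sup>2" for x y z :: real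
    using sum_squares_bound[of x y] sum_squares_bound[of x z] sum_squares_bound[of y z]
    by (simp add: power2_eq_square algebra_simps)
  have "(\<lambda>n. \<Sum>l<m n. ((\<phi> (a n l) - \<phi>' (a n l)) \<bullet> dw n l)\<^sup>2) \<longlonglongrightarrow> 0"
  proof (rule tendsto_null_bound)
    have "(\<lambda>n. 3 * qv_sum (\<pi> n) s T + 3 * qv_sum (\<pi> n) s' T + 3 * (C + C')\<^sup>2 * (\<Sum>l<m n. (?E n l)\<^sup>2))
      \<longlonglongrightarrow> 3 * 0 + 3 * 0 + 3 * (C + C')\<^sup>2 * 0"
      by (intro tendsto_add tendsto_mult tendsto_const s remainder_squares_vanish)
    then show "(\<lambda>n. 3 * qv_sum (\<pi> n) s T + 3 * qv_sum (\<pi> n) s' T + 3 * (C + C')\<^sup>2 * (\<Sum>l<m n. (?E n l)\<^sup>2)) \<longlonglongrightarrow> 0"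
      by simp
    show "\<forall>\<^sub>F n in sequentially. norm (\<Sum>l<m n. ((\<phi> (a n l) - \<phi>' (a n l)) \<bullet> dw n l)\<^sup>2) \<le>
      3 * qv_sum (\<pi> n) s T + 3 * qv_sum (\<pi> n) s' T + 3 * (C + C')\<^sup>2 * (\<Sum>l<m n. (?E n l)\<^sup>2)"
    proof (rule always_eventually, rule allI)
      fix n
      have "((\<phi> (a n l) - \<phi>' (a n l)) \<bullet> dw n l)\<^sup>2 \<le> 3 * (s (a n (Suc l)) - s (a n l))\<^sup>2 +
          3 * (s' (a n (Suc l)) - s' (a n l))\<^sup>2 + 3 * ((C + C')\<^sup>2 * (?E n l)\<^sup>2)" if l: "l < m n" for l
      proof -
        let ?u = "a n l" and ?v = "a n (Suc l)"
        have uv: "0 \<le> ?u" "?u \<le> ?v" "?v \<le> T" "?u \<in> {0..T}" "?v \<in> {0..T}"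
          using a_in[of l n] a_in[of "Suc l" n] chain_le[OF a_chain, of l "Suc l" n] l by auto
        define R where "R = (I' ?v - I' ?u - \<phi>' ?u \<bullet> dw n l) - (I ?v - I ?u - \<phi> ?u \<bullet> dw n l)"
        have "\<bar>R\<bar> \<le> (C + C') * ?E n l"
          using C(2)[OF uv(1-3)] C'(2)[OF uv(1-3)] unfolding R_def distrib_right by linarith
        from power_mono[OF this, of 2] have R: "R\<^sup>2 \<le> (C + C')\<^sup>2 * (?E n l)\<^sup>2"
          by (simp add: power_mult_distrib)
        have "(\<phi> ?u - \<phi>' ?u) \<bullet> dw n l = - (s ?v - s ?u) + (s' ?v - s' ?u) + R"
          using eq[OF uv(4)] eq[OF uv(5)] by (simp add: R_def inner_diff_left)
        also have "\<dots>\<^sup>2 \<le> 3 * (- (s ?v - s ?u))\<^sup>2 + 3 * (s' ?v - s' ?u)\<^sup>2 + 3 * R\<^sup>2" by (rule square3)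
        also have "(- (s ?v - s ?u))\<^sup>2 = (s ?v - s ?u)\<^sup>2" by (rule power2_minus)
        finally show ?thesis using R by linarith
      qed
      then have "(\<Sum>l<m n. ((\<phi> (a n l) - \<phi>' (a n l)) \<bullet> dw n l)\<^sup>2) \<le>
          (\<Sum>l<m n. 3 * (s (a n (Suc l)) - s (a n l))\<^sup>2 + 3 * (s' (a n (Suc l)) - s' (a n l))\<^sup>2 +
            3 * ((C + C')\<^sup>2 * (?E n l)\<^sup>2))"
        by (intro sum_mono) auto
      also have "\<dots> = 3 * qv_sum (\<pi> n) s T + 3 * qv_sum (\<pi> n) s' T + 3 * (C + C')\<^sup>2 * (\<Sum>l<m n. (?E n l)\<^sup>2)"
        unfolding qv_sum_eq[OF TT] last_index_T[OF part T0]
        by (simp only: sum.distrib sum_distrib_left mult.assoc)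
      finally show "norm (\<Sum>l<m n. ((\<phi> (a n l) - \<phi>' (a n l)) \<bullet> dw n l)\<^sup>2) \<le>
        3 * qv_sum (\<pi> n) s T + 3 * qv_sum (\<pi> n) s' T + 3 * (C + C')\<^sup>2 * (\<Sum>l<m n. (?E n l)\<^sup>2)"
        unfolding real_norm_def by (subst abs_of_nonneg) (auto intro: sum_nonneg)
    qed
  qed
  from integrand_zero[OF continuous_on_diff[OF cont] this ae t] show ?thesis by simp
qed

text \<open>
  Both \<open>F\<close> and the integral have first order increment \<open>\<phi> \<bullet> d\<omega>\<close>; it cancels in the difference \<open>s\<close>.
\<close>

lemma decomposition_exists:
  fixes F :: "('d, real) functional"
  assumes F: "F \<in> S_class T"
  defines "\<phi> \<equiv> along T (vderiv T F) \<omega>"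
  shows "\<exists>s. s \<in> extensional {0..T} \<and> s \<in> Q_real T \<pi> \<and> (\<forall>t\<in>{0..T}. qv \<pi> s t = 0) \<and>
    (\<exists>I. has_path_integral T \<pi> \<omega> \<phi> I \<and> (\<forall>t\<in>{0..T}. along T F \<omega> t = along T F \<omega> 0 + I t + s t))"
proof -
  obtain K where g: "tame T W K F" "tame T W K (vderiv T F)" and dif: "vert_differentiable T F"
    using S_class_tame[OF T0 F W_compact] by metis
  from pathwise_integral[OF F] obtain I C where
    I: "\<forall>t\<in>{0..T}. (\<lambda>n. integral_sum T (\<pi> n) F \<omega> t) \<longlonglongrightarrow> I t" and
    C: "0 \<le> C" "\<And>u v. 0 \<le> u \<Longrightarrow> u \<le> v \<Longrightarrow> v \<le> T \<Longrightarrow>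
      \<bar>I v - I u - on_path (vderiv T F) u \<bullet> (\<omega> v - \<omega> u)\<bar> \<le> C * remainder u v"
    by blast
  from on_path_expansion[OF g dif] obtain C' where
    C': "0 \<le> C'" "\<And>u v. 0 \<le> u \<Longrightarrow> u \<le> v \<Longrightarrow> v \<le> T \<Longrightarrow>
      \<bar>on_path F v - on_path F u - on_path (vderiv T F) u \<bullet> (\<omega> v - \<omega> u)\<bar> \<le> C' * (v - u) powr (5/4 * \<alpha>)"
    by blast
  define s where "s = restrict (\<lambda>t. along T F \<omega> t - along T F \<omega> 0 - I t) {0..T}"
  have s: "\<bar>s v - s u\<bar> \<le> (C + C') * remainder u v"
    if uv: "0 \<le> u" "u \<le> v" "v \<le> T" for u v
  proof -
    have "s v - s u = (on_path F v - on_path F u - on_path (vderiv T F) u \<bullet> (\<omega> v - \<omega> u)) -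
        (I v - I u - on_path (vderiv T F) u \<bullet> (\<omega> v - \<omega> u))"
      using uv by (simp add: s_def along_def on_path_def)
    then have "\<bar>s v - s u\<bar> \<le> C' * (v - u) powr (5/4 * \<alpha>) + C * remainder u v"
      using C(2)[OF uv] C'(2)[OF uv] by linarith
    also have "\<dots> \<le> C' * remainder u v + C * remainder u v"
      using C'(1) Q_mono[OF uv] by (intro add_right_mono mult_left_mono) auto
    finally show ?thesis by (simp add: distrib_right add.commute)
  qed
  have "0 \<le> C + C'" using C(1) C'(1) by simp
  note s_props = negligible_Q_real[OF this s]
  have "has_path_integral T \<pi> \<omega> \<phi> I"
    unfolding has_path_integral_def \<phi>_def using F I by blast
  moreover have "\<forall>t\<in>{0..T}. along T F \<omega> t = along T F \<omega> 0 + I t + s t" by (simp add: s_def)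
  moreover have "s \<in> extensional {0..T}" by (simp add: s_def)
  ultimately show ?thesis using s_props by blast
qed

text \<open>
  The functionals that represent the two integrands may differ. Once the integrands agree along the path,
  the integrals agree as limits of the same Riemann sums.
\<close>

lemma decomposition_unique:
  fixes x :: "real \<Rightarrow> real"
  assumes ae: "AE t\<in>{0..T} in lborel. \<exists>A. (M has_vector_derivative A) (at t within {0..T}) \<and> pos_def A"
    and s: "s \<in> extensional {0..T}" "s \<in> Q_real T \<pi>" "\<forall>t\<in>{0..T}. qv \<pi> s t = 0"
    and s': "s' \<in> extensional {0..T}" "s' \<in> Q_real T \<pi>" "\<forall>t\<in>{0..T}. qv \<pi> s' t = 0"
    and I: "has_path_integral T \<pi> \<omega> \<phi> I" "\<forall>t\<in>{0..T}. x t = x 0 + I t + s t"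
    and I': "has_path_integral T \<pi> \<omega> \<phi>' I'" "\<forall>t\<in>{0..T}. x t = x 0 + I' t + s' t"
  shows "\<phi> = \<phi>' \<and> s = s'"
proof -
  have TT: "T \<in> {0..T}" using T by simp
  have qv0: "(\<lambda>n. qv_sum (\<pi> n) y T) \<longlonglongrightarrow> 0" if "y \<in> Q_real T \<pi>" "\<forall>t\<in>{0..T}. qv \<pi> y t = 0" for y
    using that TT unfolding Q_real_def qv_def by (auto simp: convergent_LIMSEQ_iff)
  from I(1) obtain F where F: "F \<in> S_class T" "\<phi> = along T (vderiv T F) \<omega>"
    "\<forall>t\<in>{0..T}. (\<lambda>n. integral_sum T (\<pi> n) F \<omega> t) \<longlonglongrightarrow> I t" unfolding has_path_integral_def by blast
  from I'(1) obtain F' where F': "F' \<in> S_class T" "\<phi>' = along T (vderiv T F') \<omega>"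
    "\<forall>t\<in>{0..T}. (\<lambda>n. integral_sum T (\<pi> n) F' \<omega> t) \<longlonglongrightarrow> I' t" unfolding has_path_integral_def by blast
  let ?f = "on_path (vderiv T F)" and ?f' = "on_path (vderiv T F')"
  from pathwise_integral[OF F(1)] obtain J C where J:
    "\<forall>t\<in>{0..T}. (\<lambda>n. integral_sum T (\<pi> n) F \<omega> t) \<longlonglongrightarrow> J t"
    "\<forall>t\<in>{0..T}. (\<lambda>n. riemann_sum ?f n t) \<longlonglongrightarrow> J t"
    and C: "0 \<le> C" "\<And>u v. 0 \<le> u \<Longrightarrow> u \<le> v \<Longrightarrow> v \<le> T \<Longrightarrow>
      \<bar>J v - J u - ?f u \<bullet> (\<omega> v - \<omega> u)\<bar> \<le> C * remainder u v"
    by blast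
  from pathwise_integral[OF F'(1)] obtain J' C' where J':
    "\<forall>t\<in>{0..T}. (\<lambda>n. integral_sum T (\<pi> n) F' \<omega> t) \<longlonglongrightarrow> J' t"
    "\<forall>t\<in>{0..T}. (\<lambda>n. riemann_sum ?f' n t) \<longlonglongrightarrow> J' t"
    and C': "0 \<le> C'" "\<And>u v. 0 \<le> u \<Longrightarrow> u \<le> v \<Longrightarrow> v \<le> T \<Longrightarrow>
      \<bar>J' v - J' u - ?f' u \<bullet> (\<omega> v - \<omega> u)\<bar> \<le> C' * remainder u v"
    by blast
  have IJ: "I t = J t" "I' t = J' t" if "t \<in> {0..T}" for t
    using that F(3) J(1) F'(3) J'(1) LIMSEQ_unique by blast+
  obtain K K' where K: "tame T W K (vderiv T F)" "tame T W K' (vderiv T F')"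
    using S_class_tame[OF T0 F(1) W_compact] S_class_tame[OF T0 F'(1) W_compact] by metis
  have eq: "J t + s t = J' t + s' t" if "t \<in> {0..T}" for t
  proof -
    have "x t = x 0 + I t + s t" "x t = x 0 + I' t + s' t" using I(2) I'(2) that by blast+
    then show ?thesis using IJ[OF that] by linarith
  qed
  have ff: "?f t = ?f' t" if "t \<in> {0..T}" for t
    by (rule integrands_agree[OF on_path_cont[OF K(1)] on_path_cont[OF K(2)] C C' qv0[OF s(2,3)] qv0[OF s'(2,3)] eq ae that])
  then have "\<phi> = \<phi>'"
    unfolding F(2) F'(2) along_def on_path_def by (intro restrict_ext) simp
  moreover have "s = s'"
  proof (rule extensionalityI[OF s(1) s'(1)])
    fix t assume t: "t \<in> {0..T}"
    have "riemann_sum ?f n t =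
        riemann_sum ?f' n t" for n
    proof (rule sum.cong[OF refl])
      fix k assume "k \<in> {..<m n}"
      then have "min (a n k) t \<in> {0..T}" using a_in[of k n] t by (simp add: min_def)
      from ff[OF this] show "?f (min (a n k) t) \<bullet> (\<omega> (min (a n (Suc k)) t) - \<omega> (min (a n k) t)) =
        ?f' (min (a n k) t) \<bullet> (\<omega> (min (a n (Suc k)) t) - \<omega> (min (a n k) t))" by simp
    qed
    then have "J t = J' t"
      using LIMSEQ_unique[OF J(2)[rule_format, OF t]] J'(2)[rule_format, OF t] by simp
    with eq[OF t] show "s t = s' t" by simp
  qed
  ultimately show ?thesis by blast
qed

end

theorem proposition4p1:
  fixes T :: real
    and \<pi> :: "nat \<Rightarrow> real list"
    and \<omega>b :: "real \<Rightarrow> real^'d::finite"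
    and \<omega> :: "real \<Rightarrow> real"
  assumes "T > 0"
    and "\<And>n. is_partition T (\<pi> n)"
    and "(\<lambda>n. mesh (\<pi> n)) \<longlonglongrightarrow> 0"
    and "\<omega>b \<in> Q_vec T \<pi> \<inter> Holder_half_minus T"
    and "strictly_increasing_qv T \<pi> \<omega>b"
    and "AE t\<in>{0..T} in lborel. \<exists>A. (qv_mat \<pi> \<omega>b has_vector_derivative A) (at t within {0..T}) \<and> pos_def A"
    and "\<omega> \<in> U_paths T \<omega>b"
  shows "\<exists>!(\<phi>, s). \<phi> \<in> V_a T \<omega>b \<and> s \<in> extensional {0..T} \<and>
           s \<in> Q_real T \<pi> \<and> (\<forall>t\<in>{0..T}. qv \<pi> s t = 0) \<and>
           (\<exists>I. has_path_integral T \<pi> \<omega>b \<phi> I \<and> (\<forall>t\<in>{0..T}. \<omega> t = \<omega> 0 + I t + s t))"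
proof -
  have hol: "\<omega>b \<in> Holder T (12/25)" and Qv: "\<omega>b \<in> Q_vec T \<pi>"
    using assms(4) by (auto simp: Holder_half_minus_def)
  \<comment> \<open>Any exponent strictly between \<open>4/9\<close> and \<open>1/2\<close> would do.\<close>
  from hol obtain C where C: "\<forall>s\<in>{0..T}. \<forall>t\<in>{0..T}. norm (\<omega>b t - \<omega>b s) \<le> C * \<bar>t - s\<bar> powr (12/25)"
    by (auto simp: Holder_def)
  interpret holder_path T "\<bar>C\<bar>" "12/25" \<omega>b
  proof
    fix s t assume "s \<in> {0..T}" "t \<in> {0..T}"
    with C have "norm (\<omega>b t - \<omega>b s) \<le> C * \<bar>t - s\<bar> powr (12/25)" by blast
    also have "\<dots> \<le> \<bar>C\<bar> * \<bar>t - s\<bar> powr (12/25)" by (intro mult_right_mono) auto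
    finally show "norm (\<omega>b t - \<omega>b s) \<le> \<bar>C\<bar> * \<bar>t - s\<bar> powr (12/25)" .
  qed (use assms(1) in auto)
  interpret qv_path T "\<bar>C\<bar>" "12/25" \<omega>b \<pi> "qv_mat \<pi> \<omega>b"
  proof
    fix i
    have "continuous_on {0..T} (qv \<pi> (\<lambda>s. \<omega>b s $ i + \<omega>b s $ i))" "continuous_on {0..T} (qv \<pi> (\<lambda>s. \<omega>b s $ i))"
      using Qv unfolding Q_vec_def mem_Collect_eq
      by (intro Q_real_qv_continuous continuous_intros omega_cont; blast)+
    then show "continuous_on {0..T} (\<lambda>t. qv_mat \<pi> \<omega>b t $ i $ i)"
      unfolding qv_mat_def vec_lambda_beta by (intro continuous_intros) auto
  qed (use assms(2,3) polarized_sums_converge[OF assms(2) Qv] in auto)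
  from assms(7) obtain F where F: "F \<in> S_class T" "\<omega> = along T F \<omega>b" by (auto simp: U_paths_def)
  let ?P = "\<lambda>\<phi> s. \<phi> \<in> V_a T \<omega>b \<and> s \<in> extensional {0..T} \<and> s \<in> Q_real T \<pi> \<and> (\<forall>t\<in>{0..T}. qv \<pi> s t = 0) \<and>
           (\<exists>I. has_path_integral T \<pi> \<omega>b \<phi> I \<and> (\<forall>t\<in>{0..T}. \<omega> t = \<omega> 0 + I t + s t))"
  have "along T (vderiv T F) \<omega>b \<in> V_a T \<omega>b" using F(1) by (auto simp: V_a_def)
  then obtain s where s: "?P (along T (vderiv T F) \<omega>b) s"
    using decomposition_exists[OF F(1)] unfolding F(2) by blast
  show ?thesis
  proof (rule ex1I[of _ "(along T (vderiv T F) \<omega>b, s)"])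
    show "case (along T (vderiv T F) \<omega>b, s) of (\<phi>, s) \<Rightarrow> ?P \<phi> s" using s by simp
    fix y assume y: "case y of (\<phi>, s) \<Rightarrow> ?P \<phi> s"
    obtain \<phi>' s' where ys: "y = (\<phi>', s')" by (cases y)
    with y have "?P \<phi>' s'" by simp
    then have "\<phi>' = along T (vderiv T F) \<omega>b \<and> s' = s"
      using s decomposition_unique[OF assms(6), of s' s] by blast
    with ys show "y = (along T (vderiv T F) \<omega>b, s)" by simp
  qed
qed

end
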